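(* Let $\kappa$ be an integrable kernel on a type space $(\mathcal S,\mu)$ with $\mu(\mathcal S)=1$. (i) If $\kappa$ is subcritical, i.e. $\|T_\kappa\|<1$, then $\chi(\kappa;x)=(I-T_\kappa)^{-1}1(x)$ for a.e. $x$, and $\chi(\kappa)=\langle(I-T_\kappa)^{-1}1,1\rangle_\mu<\infty$. (ii) Suppose that $\kappa$ is supercritical, i.e. $\|T_\kappa\|>1$, and also that $\|\hat T_\kappa\|<1$. Then $\hat\chi(\kappa;x)=(1-\rho(\kappa;x))(I-\hat T_\kappa)^{-1}1(x)$ for a.e. $x$, and $\hat\chi(\kappa)=\langle(I-\hat T_\kappa)^{-1}1,1\rangle_{\hat\mu}<\infty$. The conditions of (ii) hold whenever $\|T_\kappa\|>1$, $\kappa$ is quasi-irreducible, and $\int_{\mathcal S^2}\kappa^2<\infty$.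
   Context: A kernel is a symmetric measurable $\kappa:\mathcal S^2\to[0,\infty)$ with $\int\kappa<\infty$ and $\int\kappa(x,y)d\mu(y)<\infty$ for all $x$. Branching process $\mathfrak X_\kappa(x)$: one particle of type $x$; each particle of type $y$ independently has children whose types form a Poisson process with intensity $\kappa(y,z)\,d\mu(z)$. $\rho(\kappa;x)=\mathbb P(|\mathfrak X_\kappa(x)|=\infty)$; $\chi(\kappa;x)=\mathbb E|\mathfrak X_\kappa(x)|$, $\hat\chi(\kappa;x)=\mathbb E(|\mathfrak X_\kappa(x)|;|\mathfrak X_\kappa(x)|<\infty)$, $\chi(\kappa)=\int\chi(\kappa;x)d\mu$, $\hat\chi(\kappa)=\int\hat\chi(\kappa;x)d\mu$. $T_\kappa f(x)=\int\kappa(x,y)f(y)d\mu(y)$; $\|T_\kappa\|=\sup\{\|T_\kappa f\|_{L^2(\mu)}:f\ge0,\|f\|_{L^2(\mu)}\le1\}$. $\hat\mu$: $d\hat\mu=(1-\rho(\kappa;x))d\mu$; $\hat T_\kappa f(x)=\int\kappa(x,y)f(y)d\hat\mu(y)$, regarded as an operator on $L^2(\hat\mu)$, with norm defined analogously. $\langle f,g\rangle_\nu=\int fg\,d\nu$; $1$ the constant function. $\kappa$ is irreducible if there is no measurable $A$ with $0<\mu(A)<1$ and $\kappa=0$ a.e. on $A\times(\mathcal S\setminus A)$; quasi-irreducible if there is a measurable $\mathcal S'$ with $\mu(\mathcal S')>0$ such that $\kappa$ restricted to $\mathcal S'\times\mathcal S'$ is irreducible and $\kappa(x,y)=0$ whenever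 $x\notin\mathcal S'$ or $y\notin\mathcal S'$. *)

theory Defs
  imports "HOL-Probability.Probability" "HOL-Library.Multiset"
begin

definition is_kernel :: "'a measure \<Rightarrow> ('a \<Rightarrow> 'a \<Rightarrow> real) \<Rightarrow> bool" where
  "is_kernel M \<kappa> \<longleftrightarrow>
     (\<lambda>(x, y). \<kappa> x y) \<in> borel_measurable (M \<Otimes>\<^sub>M M) \<and>
     (\<forall>x\<in>space M. \<forall>y\<in>space M. 0 \<le> \<kappa> x y \<and> \<kappa> x y = \<kappa> y x) \<and>
     (\<integral>\<^sup>+ p. ennreal (\<kappa> (fst p) (snd p)) \<partial>(M \<Otimes>\<^sub>M M)) < \<top> \<and>
     (\<forall>x\<in>space M. (\<integral>\<^sup>+ y. ennreal (\<kappa> x y) \<partial>M) < \<top>)"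

definition irreducible_kernel :: "'a measure \<Rightarrow> ('a \<Rightarrow> 'a \<Rightarrow> real) \<Rightarrow> bool" where
  "irreducible_kernel N \<kappa> \<longleftrightarrow>
     \<not> (\<exists>A\<in>sets N. 0 < measure N A \<and> measure N A < measure N (space N) \<and>
          (AE p in N \<Otimes>\<^sub>M N. fst p \<in> A \<and> snd p \<notin> A \<longrightarrow> \<kappa> (fst p) (snd p) = 0))"

definition quasi_irreducible_kernel :: "'a measure \<Rightarrow> ('a \<Rightarrow> 'a \<Rightarrow> real) \<Rightarrow> bool" where
  "quasi_irreducible_kernel M \<kappa> \<longleftrightarrow>
     (\<exists>S'\<in>sets M. 0 < measure M S' \<and>
        irreducible_kernel (restrict_space M S') \<kappa> \<and>
        (\<forall>x\<in>space M. \<forall>y\<in>space M. (x \<notin> S' \<or> y \<notin> S') \<longrightarrow> \<kappa> x y = 0))"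

definition enn_sqrt :: "ennreal \<Rightarrow> ennreal" where
  "enn_sqrt v = (if v = \<top> then \<top> else ennreal (sqrt (enn2real v)))"

definition kernel_norm :: "'a measure \<Rightarrow> ('a \<Rightarrow> 'a \<Rightarrow> real) \<Rightarrow> ennreal" where
  "kernel_norm N \<kappa> =
     (SUP f \<in> {f. f \<in> borel_measurable N \<and> (\<forall>x\<in>space N. 0 \<le> f x) \<and>
                  (\<integral>\<^sup>+ x. ennreal ((f x)\<^sup>2) \<partial>N) \<le> 1}.
        enn_sqrt (\<integral>\<^sup>+ x. (\<integral>\<^sup>+ y. ennreal (\<kappa> x y * f y) \<partial>N)\<^sup>2 \<partial>N))"

definition L2_fun :: "'a measure \<Rightarrow> ('a \<Rightarrow> real) \<Rightarrow> bool" where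
  "L2_fun N g \<longleftrightarrow> g \<in> borel_measurable N \<and> integrable N (\<lambda>x. (g x)\<^sup>2)"

definition resolvent_one :: "'a measure \<Rightarrow> ('a \<Rightarrow> 'a \<Rightarrow> real) \<Rightarrow> ('a \<Rightarrow> real) \<Rightarrow> bool" where
  "resolvent_one N \<kappa> g \<longleftrightarrow> L2_fun N g \<and>
     (AE x in N. integrable N (\<lambda>y. \<kappa> x y * g y) \<and> g x - (\<integral> y. \<kappa> x y * g y \<partial>N) = 1)"

definition cnt :: "'a set \<Rightarrow> 'a multiset \<Rightarrow> nat" where
  "cnt A z = size (filter_mset (\<lambda>y. y \<in> A) z)"

definition offspring_mean :: "'a measure \<Rightarrow> ('a \<Rightarrow> 'a \<Rightarrow> real) \<Rightarrow> 'a multiset \<Rightarrow> 'a set \<Rightarrow> real" where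
  "offspring_mean M \<kappa> z A = sum_mset (image_mset (\<lambda>y. enn2real (\<integral>\<^sup>+ u\<in>A. ennreal (\<kappa> y u) \<partial>M)) z)"

definition poisson_prob :: "real \<Rightarrow> nat \<Rightarrow> real" where
  "poisson_prob l n = exp (- l) * l ^ n / fact n"

definition gen_events :: "'b measure \<Rightarrow> 'a measure \<Rightarrow> (nat \<Rightarrow> 'b \<Rightarrow> 'a multiset) \<Rightarrow> nat \<Rightarrow> 'b set set" where
  "gen_events P M Z k = sigma_sets (space P)
     {{\<omega> \<in> space P. cnt A (Z j \<omega>) = n} | j A n. j \<le> k \<and> A \<in> sets M}"

text \<open>\<open>(P, Z)\<close> realises the generations of the branching process \<open>\<XX>\<^sub>\<kappa>(x)\<close>:
  \<open>Z k \<omega>\<close> is the multiset of types of generation k. Starting from one particle of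
  type x, conditionally on generations 0..k, each particle of type y in generation k
  has children forming independent Poisson processes with intensity \<open>\<kappa>(y,u) d\<mu>(u)\<close>;
  equivalently the (k+1)-st generation is a Poisson process with intensity
  \<open>\<Sum>\<^sub>y\<^sub>\<in>\<^sub>Z\<^sub>k \<kappa>(y,u) d\<mu>(u)\<close>, i.e. its counts in disjoint measurable sets are
  conditionally independent Poisson variables with the corresponding means.\<close>
definition BP_realisation ::
  "'a measure \<Rightarrow> ('a \<Rightarrow> 'a \<Rightarrow> real) \<Rightarrow> 'a \<Rightarrow> 'b measure \<Rightarrow> (nat \<Rightarrow> 'b \<Rightarrow> 'a multiset) \<Rightarrow> bool" where
  "BP_realisation M \<kappa> x P Z \<longleftrightarrow>
     prob_space P \<and>
     (\<forall>\<omega>\<in>space P. Z 0 \<omega> = {#x#}) \<and>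
     (\<forall>k. \<forall>\<omega>\<in>space P. set_mset (Z k \<omega>) \<subseteq> space M) \<and>
     (\<forall>k A n. A \<in> sets M \<longrightarrow> {\<omega> \<in> space P. cnt A (Z k \<omega>) = n} \<in> sets P) \<and>
     (\<forall>k (As :: 'a set list) (ns :: nat list) E.
        length ns = length As \<longrightarrow> set As \<subseteq> sets M \<longrightarrow>
        (\<forall>i<length As. \<forall>j<length As. i \<noteq> j \<longrightarrow> As ! i \<inter> As ! j = {}) \<longrightarrow>
        E \<in> gen_events P M Z k \<longrightarrow>
        emeasure P (E \<inter> {\<omega> \<in> space P. \<forall>i<length As. cnt (As ! i) (Z (Suc k) \<omega>) = ns ! i})
        = (\<integral>\<^sup>+ \<omega>\<in>E. ennreal (\<Prod>i<length As.
                 poisson_prob (offspring_mean M \<kappa> (Z k \<omega>) (As ! i)) (ns ! i)) \<partial>P))"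

definition is_BP_family ::
  "'a measure \<Rightarrow> ('a \<Rightarrow> 'a \<Rightarrow> real) \<Rightarrow> ('a \<Rightarrow> 'b measure) \<Rightarrow> ('a \<Rightarrow> nat \<Rightarrow> 'b \<Rightarrow> 'a multiset) \<Rightarrow> bool" where
  "is_BP_family M \<kappa> P Z \<longleftrightarrow> (\<forall>x\<in>space M. BP_realisation M \<kappa> x (P x) (Z x))"

definition total_size :: "(nat \<Rightarrow> 'b \<Rightarrow> 'a multiset) \<Rightarrow> 'b \<Rightarrow> ennreal" where
  "total_size Z \<omega> = (\<Sum>k. of_nat (size (Z k \<omega>)))"

definition rho_BP :: "('a \<Rightarrow> 'b measure) \<Rightarrow> ('a \<Rightarrow> nat \<Rightarrow> 'b \<Rightarrow> 'a multiset) \<Rightarrow> 'a \<Rightarrow> real" where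
  "rho_BP P Z x = measure (P x) {\<omega> \<in> space (P x). total_size (Z x) \<omega> = \<top>}"

definition chi_BP :: "('a \<Rightarrow> 'b measure) \<Rightarrow> ('a \<Rightarrow> nat \<Rightarrow> 'b \<Rightarrow> 'a multiset) \<Rightarrow> 'a \<Rightarrow> ennreal" where
  "chi_BP P Z x = (\<integral>\<^sup>+ \<omega>. total_size (Z x) \<omega> \<partial>(P x))"

definition chi_hat_BP :: "('a \<Rightarrow> 'b measure) \<Rightarrow> ('a \<Rightarrow> nat \<Rightarrow> 'b \<Rightarrow> 'a multiset) \<Rightarrow> 'a \<Rightarrow> ennreal" where
  "chi_hat_BP P Z x = (\<integral>\<^sup>+ \<omega>. total_size (Z x) \<omega> * indicator {\<omega>. total_size (Z x) \<omega> < \<top>} \<omega> \<partial>(P x))"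

definition mu_hat :: "'a measure \<Rightarrow> ('a \<Rightarrow> real) \<Rightarrow> 'a measure" where
  "mu_hat M \<rho> = density M (\<lambda>x. ennreal (1 - \<rho> x))"

end

(* Write q = 1 - rho. The generating functional of the k-th generation is
   E prod_{y in Z_k} (1 - s y) = 1 - Psi^k s (x), where Psi s = 1 - exp (- T s). Taking s = 1 gives
   rho as the limit of Psi^n 1, hence rho = Psi rho. For any fixed point r of Psi, differentiating
   the generating functional at 1 - r gives E (|Z_k| prod_{y in Z_k} (1 - r y)) =
   ((1 - r) T)^k (1 - r) (x); the choice r = 0 yields chi, and r = rho yields chi-hat, because
   prod_{y in Z_k} q y is the conditional probability of extinction given the first k generations.
   The Neumann series converge in L^2 since the norm is below 1.

   If the norm exceeds 1, then so does the growth rate of powers of some bounded truncation of the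
   kernel (log-convexity of |T^k f|^2), and 1 - exp (- s) >= (1 - eta) s for small s contradicts
   Psi^n 1 -> 0; so rho is not a.e. 0, and irreducibility makes it a.e. positive on S'. Finally
   T rho = - ln q, so the Schur test with weight rho bounds the dual operator by the factor
   q (- ln q) / rho <= 1 / (1 + rho / 2); where rho is small, this factor is not bounded away from 1,
   but there the Hilbert-Schmidt norm of the kernel is small. *)
theory Submission
  imports Defs
begin

subsection \<open>Kernel operators and their Neumann series\<close>

text \<open>T need not be compact, so a supercritical kernel need not have an eigenfunction;
  survival is therefore derived from a growth estimate rather than from an eigenvalue equation.
  Operators act on nonnegative extended-real functions: series, moments and monotone limits then
  make sense pointwise, infinite values included, and finiteness is read off afterwards from the L^2
  bound. The process is specified only through counts in disjoint measurable sets, so the generating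
  functional is first computed for simple \<open>s\<close>, whose level sets supply those counts,
  and then extended by dominated convergence. Its derivative is taken through difference quotients
  with steps 2^-n, which increase with n, so that monotone convergence replaces moment assumptions.
  The dual norm is a supremum, so a strict gain for each test function is not enough; a uniform
  bound comes from weighing two estimates against each other by the mass that the test function has
  where rho is bounded below. The summand rho / 2 in the contraction factor is the quadratic Taylor
  term of exp.\<close>

definition kernel_op :: "'a measure \<Rightarrow> ('a \<Rightarrow> 'a \<Rightarrow> real) \<Rightarrow> ('a \<Rightarrow> ennreal) \<Rightarrow> 'a \<Rightarrow> ennreal" where
  "kernel_op N \<kappa> F x = (\<integral>\<^sup>+ y. ennreal (\<kappa> x y) * F y \<partial>N)"

definition L2_sq :: "'a measure \<Rightarrow> ('a \<Rightarrow> ennreal) \<Rightarrow> ennreal" where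
  "L2_sq N F = (\<integral>\<^sup>+ x. (F x)\<^sup>2 \<partial>N)"

lemma enn_sqrt_le_imp:
  assumes "enn_sqrt v \<le> c" shows "v \<le> c\<^sup>2"
proof (cases "v = \<top>")
  case True
  with assms have "c = \<top>" by (auto simp: enn_sqrt_def top_unique)
  then show ?thesis by (simp add: power2_eq_square ennreal_top_mult)
next
  case False
  then have "ennreal (sqrt (enn2real v)) \<le> c" using assms by (auto simp: enn_sqrt_def)
  then have "(ennreal (sqrt (enn2real v)))\<^sup>2 \<le> c\<^sup>2" by (rule power_mono) auto
  moreover have "(ennreal (sqrt (enn2real v)))\<^sup>2 = v"
    using False by (simp add: ennreal_power top.not_eq_extremum)
  ultimately show ?thesis by simp
qed

text \<open>Stands in for the Minkowski inequality: the factor \<open>1 + e\<close> can be so close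
  to 1 that a contraction acting on \<open>b\<close> keeps a constant below 1, at the price of a
  large factor on \<open>a\<^sup>2\<close>. It is the expansion of
  \<open>0 \<le> (x / sqrt e - sqrt e * y)\<^sup>2\<close>.\<close>

lemma sq_sum_weighted:
  fixes a b :: ennreal assumes "0 < e"
  shows "(a + b)\<^sup>2 \<le> ennreal (1 + 1/e) * a\<^sup>2 + ennreal (1 + e) * b\<^sup>2"
proof (cases "a = \<top> \<or> b = \<top>")
  case True
  have "ennreal (1 + 1/e) > 0" "ennreal (1+e) > 0" using assms by (auto intro: add_pos_pos)
  with True show ?thesis by (auto simp: power2_eq_square ennreal_top_mult ennreal_mult_top ennreal_mult_eq_top_iff zero_less_iff_neq_zero)
next
  case False
  then obtain x y where xy: "a = ennreal x" "b = ennreal y" "0 \<le> x" "0 \<le> y"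
    by (metis ennreal_cases)
  have "0 \<le> (x / sqrt e - sqrt e * y)\<^sup>2" by simp
  also have "(x / sqrt e - sqrt e * y)\<^sup>2 = x\<^sup>2/e - 2*x*y + e*y\<^sup>2"
    using assms by (simp add: power2_diff power_divide power_mult_distrib)
  finally have "(x+y)\<^sup>2 \<le> (1+1/e)*x\<^sup>2 + (1+e)*y\<^sup>2"
    by (simp add: power2_sum algebra_simps)
  then show ?thesis using xy assms
    by (simp add: ennreal_plus[symmetric] ennreal_power ennreal_mult[symmetric] ennreal_leI del: ennreal_plus)
qed

locale kernel_space = finite_measure N for N :: "'a measure" +
  fixes \<kappa> :: "'a \<Rightarrow> 'a \<Rightarrow> real"
  assumes kernel_measurable: "(\<lambda>(x, y). \<kappa> x y) \<in> borel_measurable (N \<Otimes>\<^sub>M N)"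
    and kernel_nonneg: "\<And>x y. x \<in> space N \<Longrightarrow> y \<in> space N \<Longrightarrow> 0 \<le> \<kappa> x y"
begin

lemma kernel_comp_measurable [measurable (raw)]:
  assumes "f \<in> measurable L N" "g \<in> measurable L N"
  shows "(\<lambda>x. \<kappa> (f x) (g x)) \<in> borel_measurable L"
proof -
  have "(\<lambda>x. (\<lambda>(x, y). \<kappa> x y) (f x, g x)) \<in> borel_measurable L"
    by (rule measurable_compose[OF _ kernel_measurable]) (use assms in measurable)
  then show ?thesis by simp
qed

lemma kernel_op_measurable [measurable]:
  assumes [measurable]: "F \<in> borel_measurable N"
  shows "kernel_op N \<kappa> F \<in> borel_measurable N"
  unfolding kernel_op_def by measurable

lemma kernel_op_funpow_measurable [measurable]:
  assumes "F \<in> borel_measurable N"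
  shows "(kernel_op N \<kappa> ^^ k) F \<in> borel_measurable N"
  using assms by (induction k) auto

lemma kernel_op_cong_AE:
  assumes "AE y in N. F y = G y"
  shows "kernel_op N \<kappa> F x = kernel_op N \<kappa> G x"
  unfolding kernel_op_def by (rule nn_integral_cong_AE) (use assms in auto)

lemma kernel_op_mono_AE:
  assumes "AE y in N. F y \<le> G y"
  shows "kernel_op N \<kappa> F x \<le> kernel_op N \<kappa> G x"
  unfolding kernel_op_def
  by (rule nn_integral_mono_AE) (use assms in \<open>eventually_elim, auto intro: mult_left_mono\<close>)

lemma kernel_op_mono:
  assumes "\<And>y. y \<in> space N \<Longrightarrow> F y \<le> G y"
  shows "kernel_op N \<kappa> F x \<le> kernel_op N \<kappa> G x"
  using assms by (intro kernel_op_mono_AE) auto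

lemma kernel_op_add:
  assumes [measurable]: "F \<in> borel_measurable N" "G \<in> borel_measurable N" and "x \<in> space N"
  shows "kernel_op N \<kappa> (\<lambda>y. F y + G y) x = kernel_op N \<kappa> F x + kernel_op N \<kappa> G x"
proof -
  have [measurable]: "(\<lambda>y. \<kappa> x y) \<in> borel_measurable N" using assms by measurable
  show ?thesis unfolding kernel_op_def distrib_left by (rule nn_integral_add) auto
qed

lemma kernel_op_cmult:
  assumes [measurable]: "F \<in> borel_measurable N" and "x \<in> space N"
  shows "kernel_op N \<kappa> (\<lambda>y. c * F y) x = c * kernel_op N \<kappa> F x"
proof -
  have [measurable]: "(\<lambda>y. \<kappa> x y) \<in> borel_measurable N" using assms by measurable
  show ?thesis unfolding kernel_op_def
    by (subst nn_integral_cmult[symmetric]) (auto simp: mult_ac)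
qed

lemma kernel_op_SUP:
  assumes [measurable]: "\<And>i. F i \<in> borel_measurable N" and "x \<in> space N"
    and inc: "\<And>i y. y \<in> space N \<Longrightarrow> F i y \<le> F (Suc i) y"
  shows "kernel_op N \<kappa> (\<lambda>y. SUP i. F i y) x = (SUP i::nat. kernel_op N \<kappa> (F i) x)"
proof -
  have [measurable]: "(\<lambda>y. \<kappa> x y) \<in> borel_measurable N" using assms by measurable
  show ?thesis unfolding kernel_op_def SUP_mult_left_ennreal
    by (rule nn_integral_monotone_convergence_SUP_AE) (auto intro!: AE_I2 mult_left_mono inc)
qed

text \<open>Homogeneity: a function of finite norm is finite almost everywhere, hence up to a null
  set a multiple of a real test function of norm one, as in the supremum. Norm zero cannot be scaled
  to one and is treated apart.\<close>

lemma kernel_norm_bound: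
  assumes F [measurable]: "F \<in> borel_measurable N" and fin: "L2_sq N F < \<top>"
  shows "L2_sq N (kernel_op N \<kappa> F) \<le> (kernel_norm N \<kappa>)\<^sup>2 * L2_sq N F"
proof (cases "L2_sq N F = 0")
  case True
  then have "AE x in N. F x = 0"
    unfolding L2_sq_def by (subst (asm) nn_integral_0_iff_AE) auto
  then have "kernel_op N \<kappa> F x = 0" for x
    using kernel_op_cong_AE[of F "\<lambda>_. 0" x] by (simp add: kernel_op_def)
  then show ?thesis by (simp add: L2_sq_def)
next
  case False
  define s where "s = enn2real (L2_sq N F)"
  have s: "L2_sq N F = ennreal s" "0 < s"
    using fin False by (auto simp: s_def enn2real_positive_iff top.not_eq_extremum zero_less_iff_neq_zero)
  define f where "f x = enn2real (F x) / sqrt s" for x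
  have [measurable]: "f \<in> borel_measurable N" unfolding f_def by measurable
  have "AE x in N. (F x)\<^sup>2 \<noteq> \<infinity>"
    by (rule nn_integral_PInf_AE) (use fin in \<open>auto simp: L2_sq_def\<close>)
  then have AEF: "AE x in N. F x = ennreal (sqrt s) * ennreal (f x)"
  proof eventually_elim
    case (elim x)
    then have "F x \<noteq> \<top>" by (auto simp: power2_eq_square ennreal_mult_eq_top_iff)
    then show ?case using s
      by (simp add: f_def ennreal_mult[symmetric] top.not_eq_extremum)
  qed
  have f0: "0 \<le> f x" for x using s by (simp add: f_def)
  have "ennreal s = L2_sq N (\<lambda>x. ennreal (sqrt s) * ennreal (f x))"
    unfolding s(1)[symmetric] L2_sq_def by (rule nn_integral_cong_AE) (use AEF in auto)
  also have "\<dots> = ennreal s * (\<integral>\<^sup>+ x. ennreal ((f x)\<^sup>2) \<partial>N)"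
    unfolding L2_sq_def using s f0
    by (subst nn_integral_cmult[symmetric])
       (auto simp: power_mult_distrib ennreal_power intro!: nn_integral_cong)
  finally have f1: "(\<integral>\<^sup>+ x. ennreal ((f x)\<^sup>2) \<partial>N) = 1"
    using s by (metis ennreal_mult_cancel_left ennreal_neq_top ennreal_eq_0_iff mult.right_neutral not_le)
  have kf: "(\<integral>\<^sup>+ y. ennreal (\<kappa> x y * f y) \<partial>N) = kernel_op N \<kappa> (\<lambda>y. ennreal (f y)) x" if "x \<in> space N" for x
    unfolding kernel_op_def using that kernel_nonneg f0
    by (intro nn_integral_cong) (auto simp: ennreal_mult)
  have "enn_sqrt (\<integral>\<^sup>+ x. (\<integral>\<^sup>+ y. ennreal (\<kappa> x y * f y) \<partial>N)\<^sup>2 \<partial>N) \<le> kernel_norm N \<kappa>"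
    unfolding kernel_norm_def by (rule SUP_upper) (use f1 f0 in auto)
  then have le: "(\<integral>\<^sup>+ x. (\<integral>\<^sup>+ y. ennreal (\<kappa> x y * f y) \<partial>N)\<^sup>2 \<partial>N) \<le> (kernel_norm N \<kappa>)\<^sup>2"
    by (rule enn_sqrt_le_imp)
  have "L2_sq N (kernel_op N \<kappa> F) = L2_sq N (\<lambda>x. ennreal (sqrt s) * kernel_op N \<kappa> (\<lambda>y. ennreal (f y)) x)"
    unfolding L2_sq_def using kernel_op_cong_AE[OF AEF] by (intro nn_integral_cong) (auto simp: kernel_op_cmult)
  also have "\<dots> = ennreal s * L2_sq N (kernel_op N \<kappa> (\<lambda>y. ennreal (f y)))"
    unfolding L2_sq_def using s
    by (subst nn_integral_cmult[symmetric]) (auto simp: power_mult_distrib ennreal_power)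
  also have "\<dots> \<le> ennreal s * (kernel_norm N \<kappa>)\<^sup>2"
    using le unfolding L2_sq_def by (intro mult_left_mono) (auto simp: kf cong: nn_integral_cong)
  finally show ?thesis by (simp add: s mult.commute)
qed

text \<open>The series for (I - T)^{-1} applied to 1, summed in \<open>ennreal\<close>, so that it
  exists at every point before any condition on the norm.\<close>

definition neumann_one :: "'a \<Rightarrow> ennreal" where
  "neumann_one x = (\<Sum>k. (kernel_op N \<kappa> ^^ k) (\<lambda>_. 1) x)"

lemma neumann_one_measurable [measurable]: "neumann_one \<in> borel_measurable N"
  unfolding neumann_one_def[abs_def] by measurable

lemma neumann_one_partial_Suc:
  assumes "x \<in> space N"
  shows "(\<Sum>k<Suc n. (kernel_op N \<kappa> ^^ k) (\<lambda>_. 1) x)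
    = 1 + kernel_op N \<kappa> (\<lambda>y. \<Sum>k<n. (kernel_op N \<kappa> ^^ k) (\<lambda>_. 1) y) x"
proof -
  have "kernel_op N \<kappa> (\<lambda>y. \<Sum>k<n. (kernel_op N \<kappa> ^^ k) (\<lambda>_. 1) y) x = (\<Sum>k<n. (kernel_op N \<kappa> ^^ Suc k) (\<lambda>_. 1) x)"
  proof (induction n)
    case 0 show ?case by (simp add: kernel_op_def)
  next
    case (Suc n) then show ?case using assms by (simp add: kernel_op_add)
  qed
  then show ?thesis by (simp add: sum.lessThan_Suc_shift del: sum.lessThan_Suc)
qed

lemma neumann_one_SUP: "neumann_one x = (SUP n. \<Sum>k<n. (kernel_op N \<kappa> ^^ k) (\<lambda>_. 1) x)"
  unfolding neumann_one_def by (rule suminf_eq_SUP)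

text \<open>Monotone convergence passes T through the increasing partial sums, so the equation holds
  at every point, also where the value is infinite.\<close>

lemma neumann_one_fixpoint:
  assumes "x \<in> space N"
  shows "neumann_one x = 1 + kernel_op N \<kappa> neumann_one x"
proof -
  let ?S = "\<lambda>n x. \<Sum>k<n. (kernel_op N \<kappa> ^^ k) (\<lambda>_. 1) x"
  have "neumann_one x = (SUP n. ?S (Suc n) x)"
    unfolding neumann_one_SUP
  proof (rule antisym)
    show "(SUP n. ?S n x) \<le> (SUP n. ?S (Suc n) x)"
      by (rule SUP_mono') auto
    show "(SUP n. ?S (Suc n) x) \<le> (SUP n. ?S n x)"
      by (rule SUP_mono) blast
  qed
  also have "\<dots> = (SUP n. 1 + kernel_op N \<kappa> (?S n) x)"
    using neumann_one_partial_Suc[OF assms] by simp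
  also have "\<dots> = 1 + (SUP n. kernel_op N \<kappa> (?S n) x)"
    by (rule ennreal_SUP_add_right[symmetric]) auto
  also have "(SUP n. kernel_op N \<kappa> (?S n) x) = kernel_op N \<kappa> (\<lambda>y. SUP n. ?S n y) x"
    using assms by (intro kernel_op_SUP[symmetric]) auto
  finally show ?thesis by (simp add: neumann_one_SUP[abs_def])
qed

text \<open>Each partial sum is 1 plus T of the previous one. By \<open>sq_sum_weighted\<close> the
  squared norms obey an affine recursion with slope \<open>d < 1\<close>, which keeps them below its
  fixed point; the induction bound also supplies the finiteness that
  \<open>kernel_norm_bound\<close> asks for.\<close>

lemma L2_sq_neumann_one_finite:
  assumes norm: "kernel_norm N \<kappa> < 1"
  shows "L2_sq N neumann_one < \<top>"
proof -
  let ?S = "\<lambda>n x. \<Sum>k<n. (kernel_op N \<kappa> ^^ k) (\<lambda>_. 1) x"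
  define c where "c = enn2real (kernel_norm N \<kappa>)"
  have c: "kernel_norm N \<kappa> = ennreal c" "0 \<le> c" "c < 1"
  proof -
    show "kernel_norm N \<kappa> = ennreal c" using norm unfolding c_def
      by (intro ennreal_enn2real[symmetric]) (auto intro: less_trans)
    with norm show "c < 1" by simp
  qed (simp add: c_def)
  \<comment> \<open>Chosen to make \<open>(1 + e) * c\<^sup>2 < 1\<close>: the difference is (1 -
    c^2) (2 - c^2) / 2.\<close>
  define e where "e = (1 - c\<^sup>2) / 2"
  have c2: "c\<^sup>2 < 1" using c by (simp add: power_less_one_iff abs_square_less_1)
  have e: "0 < e" using c2 by (simp add: e_def)
  define d where "d = (1 + e) * c\<^sup>2"
  have "(1+e) * c\<^sup>2 < 1"
  proof -
    have "(1+e) * c\<^sup>2 = (3 * c\<^sup>2 - c\<^sup>2 * c\<^sup>2)/2" by (simp add: e_def field_simps)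
    moreover have "0 < (1 - c\<^sup>2) * (2 - c\<^sup>2)" using c2 by (intro mult_pos_pos) auto
    ultimately show ?thesis by (simp add: algebra_simps)
  qed
  then have d: "0 \<le> d" "d < 1" using e by (auto simp: d_def)
  define m where "m = measure N (space N)"
  \<comment> \<open>The solution of K = (1 + 1/e) m + d K, so that the bound reproduces itself in
    the induction step.\<close>
  define K where "K = (1 + 1/e) * m / (1 - d)"
  have K: "0 \<le> K" using d e by (simp add: K_def m_def)
  have Kfix: "(1+1/e) * m + d * K = K"
  proof -
    have "K * (1 - d) = (1+1/e) * m" using d by (simp add: K_def)
    then show ?thesis by (simp add: algebra_simps)
  qed
  have bound: "L2_sq N (?S n) \<le> ennreal K" for n
  proof (induction n)
    case 0 then show ?case by (simp add: L2_sq_def)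
  next
    case (Suc n)
    have "L2_sq N (?S (Suc n)) = (\<integral>\<^sup>+ x. (1 + kernel_op N \<kappa> (?S n) x)\<^sup>2 \<partial>N)"
      unfolding L2_sq_def by (intro nn_integral_cong) (simp only: neumann_one_partial_Suc)
    also have "\<dots> \<le> (\<integral>\<^sup>+ x. ennreal (1 + 1/e) * 1\<^sup>2 + ennreal (1 + e) * (kernel_op N \<kappa> (?S n) x)\<^sup>2 \<partial>N)"
      by (intro nn_integral_mono sq_sum_weighted e)
    also have "\<dots> = ennreal (1+1/e) * ennreal m + ennreal (1 + e) * L2_sq N (kernel_op N \<kappa> (?S n))"
      unfolding L2_sq_def by (subst nn_integral_add) (auto simp: nn_integral_cmult m_def emeasure_eq_measure)
    also have "\<dots> \<le> ennreal (1+1/e) * ennreal m + ennreal (1 + e) * ((ennreal c)\<^sup>2 * ennreal K)"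
    proof (intro add_left_mono mult_left_mono)
      have "L2_sq N (kernel_op N \<kappa> (?S n)) \<le> (ennreal c)\<^sup>2 * L2_sq N (?S n)"
        using kernel_norm_bound[of "?S n"] le_less_trans[OF Suc.IH] c by simp
      also have "\<dots> \<le> (ennreal c)\<^sup>2 * ennreal K" by (intro mult_left_mono Suc.IH) auto
      finally show "L2_sq N (kernel_op N \<kappa> (?S n)) \<le> (ennreal c)\<^sup>2 * ennreal K" .
    qed auto
    also have "\<dots> = ennreal ((1+1/e) * m + d * K)"
      using c e K d by (simp add: ennreal_power ennreal_mult[symmetric] d_def m_def mult.assoc
          flip: ennreal_plus ennreal_1)
    finally show ?case by (simp add: Kfix)
  qed
  have "L2_sq N neumann_one = (\<integral>\<^sup>+ x. (SUP n. (?S n x)\<^sup>2) \<partial>N)"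
    unfolding L2_sq_def
  proof (intro nn_integral_cong)
    fix x
    have "(\<lambda>n. ?S n x) \<longlonglongrightarrow> neumann_one x" unfolding neumann_one_def by (rule summable_LIMSEQ) auto
    then have "(\<lambda>n. (?S n x)\<^sup>2) \<longlonglongrightarrow> (neumann_one x)\<^sup>2"
      unfolding power2_eq_square by (intro tendsto_mult_ennreal) auto
    moreover have "(\<lambda>n. (?S n x)\<^sup>2) \<longlonglongrightarrow> (SUP n. (?S n x)\<^sup>2)"
      by (rule LIMSEQ_SUP) (auto simp: incseq_def intro!: power_mono sum_mono2)
    ultimately show "(neumann_one x)\<^sup>2 = (SUP n. (?S n x)\<^sup>2)" by (rule LIMSEQ_unique)
  qed
  also have "\<dots> = (SUP n. L2_sq N (?S n))" unfolding L2_sq_def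
    by (rule nn_integral_monotone_convergence_SUP) (auto simp: incseq_def le_fun_def intro!: power_mono sum_mono2)
  also have "\<dots> \<le> ennreal K" using bound by (intro SUP_least) auto
  finally show ?thesis by (rule le_less_trans) auto
qed

lemma resolvent_one_neumann_one:
  assumes norm: "kernel_norm N \<kappa> < 1"
  shows "resolvent_one N \<kappa> (\<lambda>x. enn2real (neumann_one x))"
    and "AE x in N. neumann_one x < \<top>"
    and "(\<integral>\<^sup>+ x. neumann_one x \<partial>N) < \<top>"
    and "(\<integral>\<^sup>+ x. neumann_one x \<partial>N) = ennreal (\<integral> x. enn2real (neumann_one x) \<partial>N)"
proof -
  have sq: "(\<integral>\<^sup>+ x. (neumann_one x)\<^sup>2 \<partial>N) < \<top>" using L2_sq_neumann_one_finite[OF norm] by (simp add: L2_sq_def)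
  have "AE x in N. (neumann_one x)\<^sup>2 \<noteq> \<infinity>"
    by (rule nn_integral_PInf_AE) (use sq in auto)
  then show fin: "AE x in N. neumann_one x < \<top>"
    by eventually_elim (auto simp: power2_eq_square ennreal_mult_eq_top_iff top.not_eq_extremum)
  then have eq: "AE x in N. ennreal (enn2real (neumann_one x)) = neumann_one x" by eventually_elim simp
  \<comment> \<open>Cauchy-Schwarz against the constant 1: on a finite measure space the L^2 bound
    gives integrability.\<close>
  have "(\<integral>\<^sup>+ x. neumann_one x * 1 \<partial>N)\<^sup>2 \<le> (\<integral>\<^sup>+ x. (neumann_one x)\<^sup>2 \<partial>N) * (\<integral>\<^sup>+ x. 1\<^sup>2 \<partial>N)"
    by (rule Cauchy_Schwarz_nn_integral) auto
  also have "\<dots> < \<top>" using sq by (auto simp: ennreal_mult_less_top emeasure_eq_measure)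
  finally show fint: "(\<integral>\<^sup>+ x. neumann_one x \<partial>N) < \<top>"
    by (auto simp: power2_eq_square ennreal_mult_less_top)
  have e1: "(\<integral>\<^sup>+ x. ennreal (enn2real (neumann_one x)) \<partial>N) = (\<integral>\<^sup>+ x. neumann_one x \<partial>N)"
    by (rule nn_integral_cong_AE) (use eq in auto)
  then have int: "integrable N (\<lambda>x. enn2real (neumann_one x))"
    using fint by (intro integrableI_nonneg) auto
  show "(\<integral>\<^sup>+ x. neumann_one x \<partial>N) = ennreal (\<integral> x. enn2real (neumann_one x) \<partial>N)"
    using nn_integral_eq_integral[OF int] e1 by simp
  have "(\<integral>\<^sup>+ x. ennreal ((enn2real (neumann_one x))\<^sup>2) \<partial>N) = (\<integral>\<^sup>+ x. (neumann_one x)\<^sup>2 \<partial>N)"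
    by (rule nn_integral_cong_AE) (use eq in eventually_elim, simp flip: ennreal_power)
  then have L2: "L2_fun N (\<lambda>x. enn2real (neumann_one x))"
    unfolding L2_fun_def using sq by (auto intro!: integrableI_nonneg)
  have "AE x in N. integrable N (\<lambda>y. \<kappa> x y * enn2real (neumann_one y)) \<and>
      enn2real (neumann_one x) - (\<integral> y. \<kappa> x y * enn2real (neumann_one y) \<partial>N) = 1"
    using fin AE_space
  proof eventually_elim
    case (elim x)
    have [measurable]: "(\<lambda>y. \<kappa> x y) \<in> borel_measurable N" using elim by measurable
    have "(\<integral>\<^sup>+ y. ennreal (\<kappa> x y * enn2real (neumann_one y)) \<partial>N) = kernel_op N \<kappa> (\<lambda>y. ennreal (enn2real (neumann_one y))) x"
      unfolding kernel_op_def using elim kernel_nonneg by (intro nn_integral_cong) (auto simp: ennreal_mult)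
    also have "\<dots> = kernel_op N \<kappa> neumann_one x" by (rule kernel_op_cong_AE[OF eq])
    finally have i: "(\<integral>\<^sup>+ y. ennreal (\<kappa> x y * enn2real (neumann_one y)) \<partial>N) = kernel_op N \<kappa> neumann_one x" .
    have fp: "neumann_one x = 1 + kernel_op N \<kappa> neumann_one x" using neumann_one_fixpoint elim by auto
    \<comment> \<open>The fixed-point equation itself yields the row integral: it is a summand of
      the finite number \<open>neumann_one x\<close>.\<close>
    with elim have kf: "kernel_op N \<kappa> neumann_one x < \<top>" by (metis ennreal_add_eq_top top.not_eq_extremum)
    have int: "integrable N (\<lambda>y. \<kappa> x y * enn2real (neumann_one y))"
      using i kf elim kernel_nonneg by (intro integrableI_nonneg AE_I2) auto
    have "ennreal (\<integral> y. \<kappa> x y * enn2real (neumann_one y) \<partial>N) = kernel_op N \<kappa> neumann_one x"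
      using nn_integral_eq_integral[OF int] i elim kernel_nonneg by auto
    then have "(\<integral> y. \<kappa> x y * enn2real (neumann_one y) \<partial>N) = enn2real (kernel_op N \<kappa> neumann_one x)"
      using elim kernel_nonneg by (metis (no_types, lifting) enn2real_ennreal integral_nonneg_AE AE_I2 mult_nonneg_nonneg enn2real_nonneg)
    moreover have "enn2real (neumann_one x) = 1 + enn2real (kernel_op N \<kappa> neumann_one x)"
      by (subst fp) (use kf in \<open>simp add: enn2real_plus\<close>)
    ultimately show ?case using int by simp
  qed
  with L2 show "resolvent_one N \<kappa> (\<lambda>x. enn2real (neumann_one x))" by (simp add: resolvent_one_def)
qed

end

subsection \<open>Generating functionals of the branching process\<close>

text \<open>If each particle \<open>y\<close> is marked independently with probability
  \<open>s y\<close>, this is the probability that no particle of \<open>z\<close> is marked. Its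
  expectation is the generating functional at 1 - s.\<close>

definition pgf_prod :: "('a \<Rightarrow> real) \<Rightarrow> 'a multiset \<Rightarrow> real" where
  "pgf_prod s z = (\<Prod>y\<in>#z. 1 - s y)"

lemma pgf_prod_simps [simp]:
  "pgf_prod s {#} = 1" "pgf_prod s (add_mset y z) = (1 - s y) * pgf_prod s z"
  by (simp_all add: pgf_prod_def)

lemma pgf_prod_bounds:
  assumes "\<And>y. y \<in># z \<Longrightarrow> 0 \<le> s y \<and> s y \<le> 1"
  shows "0 \<le> pgf_prod s z" "pgf_prod s z \<le> 1"
  using assms by (induction z) (auto intro!: mult_le_one)

lemma pgf_prod_tendsto:
  assumes "\<And>y. y \<in># z \<Longrightarrow> (\<lambda>i. s i y) \<longlonglongrightarrow> t y"
  shows "(\<lambda>i. pgf_prod (s i) z) \<longlonglongrightarrow> pgf_prod t z"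
  using assms by (induction z) (auto intro!: tendsto_intros)

lemma cnt_simps [simp]:
  "cnt A {#} = 0" "cnt A (add_mset y z) = (if y \<in> A then Suc (cnt A z) else cnt A z)"
  by (simp_all add: cnt_def)

lemma cnt_eq_size: "set_mset z \<subseteq> A \<Longrightarrow> cnt A z = size z"
  by (induction z) auto

lemma prod_list_index:
  assumes "distinct vs"
  shows "(\<Prod>i<length vs. g (vs ! i)) = (\<Prod>v\<in>set vs. g v :: real)"
  by (rule prod.reindex_bij_betw) (use bij_betw_nth[OF assms refl] in auto)

text \<open>\<open>BP_realisation\<close> describes only counts in disjoint sets. For a function
  with finitely many values the product depends on such counts alone, one for each level
  set.\<close>

lemma pgf_prod_level_sets:
  assumes "finite V" "set_mset z \<subseteq> X" "s ` X \<subseteq> V"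
  shows "pgf_prod s z = (\<Prod>v\<in>V. (1 - v) ^ cnt (s -` {v} \<inter> X) z)"
  using assms(2)
proof (induction z)
  case empty
  then show ?case by simp
next
  case (add y z)
  then have y: "y \<in> X" "s y \<in> V" and z: "set_mset z \<subseteq> X" using assms(3) by auto
  have "(\<Prod>v\<in>V. (1 - v) ^ cnt (s -` {v} \<inter> X) (add_mset y z))
      = (\<Prod>v\<in>V. (if v = s y then 1 - v else 1) * (1 - v) ^ cnt (s -` {v} \<inter> X) z)"
    using y by (intro prod.cong) auto
  also have "\<dots> = (1 - s y) * pgf_prod s z"
    using y add.IH[OF z] assms(1) by (simp add: prod.distrib prod.delta')
  finally show ?case by simp
qed

lemma poisson_prob_nonneg: "0 \<le> l \<Longrightarrow> 0 \<le> poisson_prob l n"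
  by (simp add: poisson_prob_def)

lemma poisson_pgf: "(\<lambda>n. a ^ n * poisson_prob l n) sums exp (- (l * (1 - a)))"
proof -
  have "(\<lambda>n. exp (- l) * ((l * a) ^ n /\<^sub>R fact n)) sums (exp (- l) * exp (l * a))"
    by (intro sums_mult exp_converges)
  moreover have "exp (- l) * ((l * a) ^ n /\<^sub>R fact n) = a ^ n * poisson_prob l n" for n
    by (simp add: poisson_prob_def power_mult_distrib field_simps)
  moreover have "exp (- l) * exp (l * a) = exp (- (l * (1 - a)))"
    by (simp add: exp_add[symmetric] algebra_simps)
  ultimately show ?thesis by simp
qed

section \<open>The survival operator\<close>

locale kernel_rows = kernel_space M \<kappa> for M :: "'a measure" and \<kappa> +
  assumes rows: "\<And>x. x \<in> space M \<Longrightarrow> kernel_op M \<kappa> (\<lambda>_. 1) x < \<top>"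
begin

text \<open>On bounded functions this is the real form of \<open>kernel_op\<close>, by the row
  bound. Since \<open>enn2real\<close> would send an infinite value to 0, the lemmas that compare
  values carry a bound \<open>B\<close>.\<close>

definition kernel_opr :: "('a \<Rightarrow> real) \<Rightarrow> 'a \<Rightarrow> real" where
  "kernel_opr s x = enn2real (kernel_op M \<kappa> (\<lambda>y. ennreal (s y)) x)"

text \<open>The Psi of the overview: if children are marked independently with probability
  \<open>s\<close>, the marked ones have Poisson number with mean \<open>kernel_opr s x\<close>, and
  this is the probability that there is one.\<close>

definition surv_step :: "('a \<Rightarrow> real) \<Rightarrow> 'a \<Rightarrow> real" where
  "surv_step s x = 1 - exp (- kernel_opr s x)"

definition unit_fun :: "('a \<Rightarrow> real) \<Rightarrow> bool" where
  "unit_fun s \<longleftrightarrow> s \<in> borel_measurable M \<and> (\<forall>y\<in>space M. 0 \<le> s y \<and> s y \<le> 1)"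

lemma unit_funD [dest]:
  assumes "unit_fun s"
  shows "s \<in> borel_measurable M" "y \<in> space M \<Longrightarrow> 0 \<le> s y" "y \<in> space M \<Longrightarrow> s y \<le> 1"
  using assms by (auto simp: unit_fun_def)

lemma kernel_opr_nonneg: "0 \<le> kernel_opr s x"
  by (simp add: kernel_opr_def)

lemma kernel_op_bounded_finite:
  assumes "\<And>y. y \<in> space M \<Longrightarrow> s y \<le> B" "x \<in> space M"
  shows "kernel_op M \<kappa> (\<lambda>y. ennreal (s y)) x < \<top>"
proof -
  have "kernel_op M \<kappa> (\<lambda>y. ennreal (s y)) x \<le> kernel_op M \<kappa> (\<lambda>y. ennreal B * 1) x"
    using assms by (intro kernel_op_mono) (auto intro: ennreal_leI)
  also have "\<dots> = ennreal B * kernel_op M \<kappa> (\<lambda>_. 1) x" using assms by (intro kernel_op_cmult) auto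
  also have "\<dots> < \<top>" using rows[OF assms(2)] by (auto simp: ennreal_mult_less_top)
  finally show ?thesis .
qed

lemma ennreal_kernel_opr:
  assumes "\<And>y. y \<in> space M \<Longrightarrow> s y \<le> B" "x \<in> space M"
  shows "ennreal (kernel_opr s x) = kernel_op M \<kappa> (\<lambda>y. ennreal (s y)) x"
  unfolding kernel_opr_def using kernel_op_bounded_finite[OF assms] by simp

lemma kernel_opr_mono:
  assumes "\<And>y. y \<in> space M \<Longrightarrow> s y \<le> t y" "\<And>y. y \<in> space M \<Longrightarrow> t y \<le> B" "x \<in> space M"
  shows "kernel_opr s x \<le> kernel_opr t x"
  unfolding kernel_opr_def using assms
  by (intro enn2real_mono kernel_op_mono kernel_op_bounded_finite) (auto intro: ennreal_leI)

lemma kernel_opr_cong: "(\<And>y. y \<in> space M \<Longrightarrow> s y = t y) \<Longrightarrow> kernel_opr s x = kernel_opr t x"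
  unfolding kernel_opr_def kernel_op_def by (simp cong: nn_integral_cong)

lemma kernel_opr_measurable [measurable]: "s \<in> borel_measurable M \<Longrightarrow> kernel_opr s \<in> borel_measurable M"
  unfolding kernel_opr_def[abs_def] by measurable

lemma surv_step_measurable [measurable]: "s \<in> borel_measurable M \<Longrightarrow> surv_step s \<in> borel_measurable M"
  unfolding surv_step_def[abs_def] by measurable

lemma surv_step_bounds: "0 \<le> surv_step s x" "surv_step s x < 1"
  using kernel_opr_nonneg[of s x] by (auto simp: surv_step_def)

lemma surv_step_mono:
  assumes "\<And>y. y \<in> space M \<Longrightarrow> s y \<le> t y" "\<And>y. y \<in> space M \<Longrightarrow> t y \<le> B" "x \<in> space M"
  shows "surv_step s x \<le> surv_step t x"
  using kernel_opr_mono[OF assms] by (simp add: surv_step_def)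

lemma surv_step_cong: "(\<And>y. y \<in> space M \<Longrightarrow> s y = t y) \<Longrightarrow> surv_step s x = surv_step t x"
  using kernel_opr_cong[of s t x] by (simp add: surv_step_def)

lemma unit_fun_surv_step: "unit_fun s \<Longrightarrow> unit_fun (surv_step s)"
  using surv_step_bounds by (auto simp: unit_fun_def less_imp_le)

lemma unit_fun_surv_step_funpow: "unit_fun s \<Longrightarrow> unit_fun ((surv_step ^^ k) s)"
  by (induction k) (auto intro: unit_fun_surv_step)

lemma kernel_opr_tendsto:
  assumes s: "\<And>i. unit_fun (s i)" and t: "unit_fun t"
    and lim: "\<And>y. y \<in> space M \<Longrightarrow> (\<lambda>i. s i y) \<longlonglongrightarrow> t y" and x: "x \<in> space M"
  shows "(\<lambda>i. kernel_opr (s i) x) \<longlonglongrightarrow> kernel_opr t x"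
proof -
  have [measurable]: "s i \<in> borel_measurable M" "t \<in> borel_measurable M" for i using s t by auto
  have [measurable]: "(\<lambda>y. \<kappa> x y) \<in> borel_measurable M" using x by measurable
  have "(\<lambda>i. kernel_op M \<kappa> (\<lambda>y. ennreal (s i y)) x) \<longlonglongrightarrow> kernel_op M \<kappa> (\<lambda>y. ennreal (t y)) x"
    unfolding kernel_op_def
  proof (rule nn_integral_dominated_convergence[where w = "\<lambda>y. ennreal (\<kappa> x y) * 1"])
    show "(\<integral>\<^sup>+ y. ennreal (\<kappa> x y) * 1 \<partial>M) < \<infinity>" using rows[OF x] by (simp add: kernel_op_def)
    show "AE y in M. ennreal (\<kappa> x y) * ennreal (s i y) \<le> ennreal (\<kappa> x y) * 1" for i
      using s[of i] by (intro AE_I2 mult_left_mono) auto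
    show "AE y in M. (\<lambda>i. ennreal (\<kappa> x y) * ennreal (s i y)) \<longlonglongrightarrow> ennreal (\<kappa> x y) * ennreal (t y)"
      using lim by (intro AE_I2 tendsto_mult_ennreal tendsto_ennrealI tendsto_const) auto
  qed auto
  moreover have "kernel_op M \<kappa> (\<lambda>y. ennreal (t y)) x = ennreal (kernel_opr t x)"
    using ennreal_kernel_opr[OF unit_funD(3)[OF t] x] by simp
  ultimately show ?thesis unfolding kernel_opr_def[of "s _"]
    by (intro tendsto_enn2real) (auto simp: kernel_opr_nonneg)
qed

lemma surv_step_tendsto:
  assumes "\<And>i. unit_fun (s i)" "unit_fun t"
    and "\<And>y. y \<in> space M \<Longrightarrow> (\<lambda>i. s i y) \<longlonglongrightarrow> t y" "x \<in> space M"
  shows "(\<lambda>i. surv_step (s i) x) \<longlonglongrightarrow> surv_step t x"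
  unfolding surv_step_def by (intro tendsto_intros kernel_opr_tendsto assms)

definition row_mass :: "'a \<Rightarrow> 'a set \<Rightarrow> real" where
  "row_mass y A = enn2real (\<integral>\<^sup>+ u\<in>A. ennreal (\<kappa> y u) \<partial>M)"

text \<open>Integration over the level sets of \<open>s\<close> turns the exponent in
  \<open>surv_step\<close> into a combination of the Poisson means of these sets.\<close>

lemma kernel_opr_simple:
  assumes V: "finite V" "s ` space M \<subseteq> V" "\<And>v. v \<in> V \<Longrightarrow> 0 \<le> v" and s [measurable]: "s \<in> borel_measurable M"
    and x: "x \<in> space M"
  shows "kernel_opr s x = (\<Sum>v\<in>V. v * row_mass x (s -` {v} \<inter> space M))"
proof -
  have [measurable]: "(\<lambda>y. \<kappa> x y) \<in> borel_measurable M" using x by measurable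
  have [measurable]: "s -` {v} \<inter> space M \<in> sets M" for v by measurable
  have fin: "(\<integral>\<^sup>+ u\<in>A. ennreal (\<kappa> x u) \<partial>M) < \<top>" for A
  proof -
    have "(\<integral>\<^sup>+ u\<in>A. ennreal (\<kappa> x u) \<partial>M) \<le> kernel_op M \<kappa> (\<lambda>_. 1) x"
      unfolding kernel_op_def by (intro nn_integral_mono) (auto simp: indicator_def)
    then show ?thesis using rows[OF x] by auto
  qed
  have "kernel_op M \<kappa> (\<lambda>y. ennreal (s y)) x
      = (\<integral>\<^sup>+ y. (\<Sum>v\<in>V. ennreal v * (ennreal (\<kappa> x y) * indicator (s -` {v} \<inter> space M) y)) \<partial>M)"
    unfolding kernel_op_def
  proof (intro nn_integral_cong)
    fix y assume y: "y \<in> space M"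
    have "(\<Sum>v\<in>V. ennreal v * (ennreal (\<kappa> x y) * indicator (s -` {v} \<inter> space M) y))
       = (\<Sum>v\<in>V. if v = s y then ennreal v * ennreal (\<kappa> x y) else 0)"
      using y by (intro sum.cong) (auto simp: indicator_def)
    also have "\<dots> = ennreal (s y) * ennreal (\<kappa> x y)" using V y by (simp add: image_subset_iff)
    finally show "ennreal (\<kappa> x y) * ennreal (s y) =
      (\<Sum>v\<in>V. ennreal v * (ennreal (\<kappa> x y) * indicator (s -` {v} \<inter> space M) y))"
      by (simp add: mult.commute)
  qed
  also have "\<dots> = (\<Sum>v\<in>V. ennreal v * (\<integral>\<^sup>+ u\<in>(s -` {v} \<inter> space M). ennreal (\<kappa> x u) \<partial>M))"
    by (subst nn_integral_sum) (auto intro!: sum.cong nn_integral_cmult)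
  also have "\<dots> = (\<Sum>v\<in>V. ennreal (v * row_mass x (s -` {v} \<inter> space M)))"
    unfolding row_mass_def using V fin by (intro sum.cong) (auto simp: ennreal_mult)
  also have "\<dots> = ennreal (\<Sum>v\<in>V. v * row_mass x (s -` {v} \<inter> space M))"
    using V by (intro sum_ennreal) (auto simp: row_mass_def)
  finally show ?thesis unfolding kernel_opr_def
    using V by (simp add: sum_nonneg row_mass_def)
qed

end

section \<open>One generation step of the branching process\<close>

locale bp = kernel_rows M \<kappa> for M :: "'a measure" and \<kappa> +
  fixes x :: 'a and P :: "'b measure" and Z :: "nat \<Rightarrow> 'b \<Rightarrow> 'a multiset"
  assumes x: "x \<in> space M" and bp: "BP_realisation M \<kappa> x P Z"
begin

sublocale P: prob_space P using bp by (simp add: BP_realisation_def)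

lemma Z_0: "\<omega> \<in> space P \<Longrightarrow> Z 0 \<omega> = {#x#}"
  using bp by (auto simp: BP_realisation_def)

lemma Z_space: "\<omega> \<in> space P \<Longrightarrow> y \<in># Z k \<omega> \<Longrightarrow> y \<in> space M"
  using bp by (fastforce simp: BP_realisation_def)

lemma cnt_event [measurable]: "A \<in> sets M \<Longrightarrow> {\<omega> \<in> space P. cnt A (Z k \<omega>) = n} \<in> sets P"
  using bp by (auto simp: BP_realisation_def)

lemma cnt_measurable [measurable]:
  "A \<in> sets M \<Longrightarrow> (\<lambda>\<omega>. cnt A (Z k \<omega>)) \<in> measurable P (count_space UNIV)"
  by (subst measurable_count_space_eq2_countable) (auto simp: vimage_def Int_def conj_commute)

lemma size_eq_cnt: "\<omega> \<in> space P \<Longrightarrow> size (Z k \<omega>) = cnt (space M) (Z k \<omega>)"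
  using Z_space by (intro cnt_eq_size[symmetric]) auto

lemma size_measurable [measurable]: "(\<lambda>\<omega>. size (Z k \<omega>)) \<in> measurable P (count_space UNIV)"
proof -
  have "(\<lambda>\<omega>. cnt (space M) (Z k \<omega>)) \<in> measurable P (count_space UNIV)" by measurable
  then show ?thesis by (simp add: size_eq_cnt cong: measurable_cong)
qed

lemma gen_events_sets: "E \<in> gen_events P M Z k \<Longrightarrow> E \<in> sets P"
proof -
  have "{{\<omega> \<in> space P. cnt A (Z j \<omega>) = n} | j A n. j \<le> k \<and> A \<in> sets M} \<subseteq> sets P"
    by auto
  from sets.sigma_sets_subset[OF this] show "E \<in> gen_events P M Z k \<Longrightarrow> E \<in> sets P"
    unfolding gen_events_def by blast
qed

lemma gen_events_mono: "j \<le> k \<Longrightarrow> gen_events P M Z j \<subseteq> gen_events P M Z k"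
  unfolding gen_events_def by (rule sigma_sets_mono') (use order_trans in blast)

lemma gen_events_space: "space P \<in> gen_events P M Z k"
  unfolding gen_events_def by (rule sigma_sets_top)

lemma gen_events_size: "{\<omega> \<in> space P. size (Z k \<omega>) = n} \<in> gen_events P M Z k"
proof -
  have "{\<omega> \<in> space P. size (Z k \<omega>) = n} = {\<omega> \<in> space P. cnt (space M) (Z k \<omega>) = n}"
    by (auto simp: size_eq_cnt)
  then show ?thesis unfolding gen_events_def by (auto intro!: sigma_sets.Basic)
qed

lemma offspring_mean_eq: "offspring_mean M \<kappa> z A = (\<Sum>y\<in>#z. row_mass y A)"
  by (simp add: offspring_mean_def row_mass_def)

lemma offspring_mean_nonneg: "0 \<le> offspring_mean M \<kappa> z A"
  unfolding offspring_mean_def by (induction z) auto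

lemma row_mass_measurable [measurable]: "A \<in> sets M \<Longrightarrow> (\<lambda>y. row_mass y A) \<in> borel_measurable M"
proof -
  assume A [measurable]: "A \<in> sets M"
  have "kernel_op M \<kappa> (indicator A) \<in> borel_measurable M" by measurable
  then show ?thesis unfolding row_mass_def kernel_op_def by measurable
qed

lemma bp_step:
  assumes "length ns = length As" "set As \<subseteq> sets M"
    "\<And>i j. i < length As \<Longrightarrow> j < length As \<Longrightarrow> i \<noteq> j \<Longrightarrow> As ! i \<inter> As ! j = {}"
    "E \<in> gen_events P M Z k"
  shows "emeasure P (E \<inter> {\<omega> \<in> space P. \<forall>i<length As. cnt (As ! i) (Z (Suc k) \<omega>) = ns ! i})
        = (\<integral>\<^sup>+ \<omega>\<in>E. ennreal (\<Prod>i<length As.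
                 poisson_prob (offspring_mean M \<kappa> (Z k \<omega>) (As ! i)) (ns ! i)) \<partial>P)"
proof -
  have "\<forall>k (As :: 'a set list) (ns :: nat list) E.
        length ns = length As \<longrightarrow> set As \<subseteq> sets M \<longrightarrow>
        (\<forall>i<length As. \<forall>j<length As. i \<noteq> j \<longrightarrow> As ! i \<inter> As ! j = {}) \<longrightarrow>
        E \<in> gen_events P M Z k \<longrightarrow>
        emeasure P (E \<inter> {\<omega> \<in> space P. \<forall>i<length As. cnt (As ! i) (Z (Suc k) \<omega>) = ns ! i})
        = (\<integral>\<^sup>+ \<omega>\<in>E. ennreal (\<Prod>i<length As.
                 poisson_prob (offspring_mean M \<kappa> (Z k \<omega>) (As ! i)) (ns ! i)) \<partial>P)"
    using bp unfolding BP_realisation_def by (elim conjE)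
  from this[rule_format, OF assms(1,2) _ assms(4)] show ?thesis using assms(3) by auto
qed

text \<open>\<open>Z k\<close> is not assumed measurable into a space of multisets; only its counts
  are measurable, and for simple \<open>s\<close> the product is a polynomial in powers with these
  counts as exponents.\<close>

lemma simple_pgf_prod_measurable:
  assumes s: "simple_function M s"
  shows "(\<lambda>\<omega>. pgf_prod s (Z k \<omega>)) \<in> borel_measurable P"
proof -
  have [measurable]: "s \<in> borel_measurable M" using s by (rule borel_measurable_simple_function)
  have [measurable]: "s -` {v} \<inter> space M \<in> sets M" for v by measurable
  have f: "finite (s ` space M)" using s by (simp add: simple_function_def)
  have eq: "pgf_prod s (Z k \<omega>) = (\<Prod>v\<in>s ` space M. (1 - v) ^ cnt (s -` {v} \<inter> space M) (Z k \<omega>))"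
    if "\<omega> \<in> space P" for \<omega>
    using Z_space that by (intro pgf_prod_level_sets f) auto
  show ?thesis
    by (subst measurable_cong[OF eq]) (assumption, measurable)
qed

lemma simple_approx:
  assumes "unit_fun s"
  obtains t where "\<And>i. simple_function M (t i)" "\<And>i. unit_fun (t i)"
    "\<And>y. y \<in> space M \<Longrightarrow> (\<lambda>i. t i y) \<longlonglongrightarrow> s y"
proof -
  have [measurable]: "s \<in> borel_measurable M" using assms by auto
  \<comment> \<open>Nonnegativity of \<open>s\<close> is known on \<open>space M\<close> only, hence
    the positive part.\<close>
  obtain t :: "nat \<Rightarrow> 'a \<Rightarrow> real" where t: "incseq t" "\<And>i. simple_function M (t i)"
      "\<And>x. bdd_above (range (\<lambda>i. t i x))" "\<And>i x. 0 \<le> t i x" "(\<lambda>y. max 0 (s y)) = (SUP i. t i)"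
    using borel_measurable_implies_simple_function_sequence_real[of "\<lambda>y. max 0 (s y)" M] by auto
  have sup: "max 0 (s y) = (SUP i. t i y)" for y
    using fun_cong[OF t(5), of y] by (simp add: image_image)
  have lim: "(\<lambda>i. t i y) \<longlonglongrightarrow> s y" if "y \<in> space M" for y
  proof -
    have "(\<lambda>i. t i y) \<longlonglongrightarrow> (SUP i. t i y)"
      using t(1) by (intro LIMSEQ_incseq_SUP t(3)) (auto simp: incseq_def le_fun_def)
    then show ?thesis using sup[of y] assms that by (auto simp: max_def split: if_splits)
  qed
  have "t i y \<le> s y" if "y \<in> space M" for i y
    using cSUP_upper[OF UNIV_I t(3), of i y] sup[of y] assms that by (auto simp: max_def split: if_splits)
  moreover have "s y \<le> 1" if "y \<in> space M" for y using assms that by auto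
  ultimately have "t i y \<le> 1" if "y \<in> space M" for i y using that by (meson order_trans)
  then have "unit_fun (t i)" for i
    using t(2,4) by (auto simp: unit_fun_def borel_measurable_simple_function)
  then show ?thesis using that t(2) lim by blast
qed

lemma pgf_prod_measurable:
  assumes "unit_fun s"
  shows "(\<lambda>\<omega>. pgf_prod s (Z k \<omega>)) \<in> borel_measurable P"
proof -
  obtain t where t: "\<And>i. simple_function M (t i)" "\<And>i. unit_fun (t i)"
    "\<And>y. y \<in> space M \<Longrightarrow> (\<lambda>i. t i y) \<longlonglongrightarrow> s y"
    using simple_approx[OF assms] by blast
  show ?thesis
  proof (rule borel_measurable_LIMSEQ_real)
    show "(\<lambda>i. pgf_prod (t i) (Z k \<omega>)) \<longlonglongrightarrow> pgf_prod s (Z k \<omega>)" if "\<omega> \<in> space P" for \<omega>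
      using that by (intro pgf_prod_tendsto t(3)) (auto intro: Z_space)
    show "(\<lambda>\<omega>. pgf_prod (t i) (Z k \<omega>)) \<in> borel_measurable P" for i
      by (rule simple_pgf_prod_measurable[OF t(1)])
  qed
qed

lemma pgf_prod_Z_bounds:
  assumes "unit_fun s" "\<omega> \<in> space P"
  shows "0 \<le> pgf_prod s (Z k \<omega>)" "pgf_prod s (Z k \<omega>) \<le> 1"
  using assms Z_space by (auto intro!: pgf_prod_bounds)

text \<open>The mean is a sum over a random multiset. But exp (- mean) is the
  \<open>pgf_prod\<close> of the function 1 - exp (- row mass), which takes values in [0,1), and the
  logarithm recovers the mean.\<close>

lemma offspring_mean_measurable [measurable]:
  assumes [measurable]: "A \<in> sets M"
  shows "(\<lambda>\<omega>. offspring_mean M \<kappa> (Z k \<omega>) A) \<in> borel_measurable P"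
proof -
  have u: "unit_fun (\<lambda>y. 1 - exp (- row_mass y A))"
    by (auto simp: unit_fun_def row_mass_def)
  have "pgf_prod (\<lambda>y. 1 - exp (- row_mass y A)) z = exp (- offspring_mean M \<kappa> z A)" for z
    unfolding offspring_mean_eq by (induction z) (simp_all flip: exp_add)
  then have "offspring_mean M \<kappa> z A = - ln (pgf_prod (\<lambda>y. 1 - exp (- row_mass y A)) z)" for z by simp
  then show ?thesis using pgf_prod_measurable[OF u, of k] by simp
qed

lemma poisson_prob_measurable [measurable]: "(\<lambda>l. poisson_prob l n) \<in> borel_measurable borel"
  unfolding poisson_prob_def by measurable

text \<open>Interpolates between point probabilities and generating functions: the first
  \<open>m\<close> counts enter through powers, the remaining ones are prescribed. For
  \<open>m = 0\<close> this is \<open>bp_step\<close>; raising \<open>m\<close> sums over one count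
  and applies \<open>poisson_pgf\<close>.\<close>

lemma pgf_prefix:
  assumes As: "set As \<subseteq> sets M"
    "\<And>i j. i < length As \<Longrightarrow> j < length As \<Longrightarrow> i \<noteq> j \<Longrightarrow> As ! i \<inter> As ! j = {}"
    and E: "E \<in> gen_events P M Z k" and a: "\<And>i. i < length As \<Longrightarrow> 0 \<le> a i \<and> a i \<le> (1::real)"
    and m: "m \<le> length As" and ns: "length ns = length As"
  defines "lam \<equiv> \<lambda>\<omega> i. offspring_mean M \<kappa> (Z k \<omega>) (As ! i)"
  shows "(\<integral>\<^sup>+ \<omega>\<in>E \<inter> {\<omega> \<in> space P. \<forall>i\<in>{m..<length As}. cnt (As ! i) (Z (Suc k) \<omega>) = ns ! i}.
           ennreal (\<Prod>i<m. a i ^ cnt (As ! i) (Z (Suc k) \<omega>)) \<partial>P)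
       = (\<integral>\<^sup>+ \<omega>\<in>E. ennreal ((\<Prod>i<m. exp (- (lam \<omega> i * (1 - a i)))) *
           (\<Prod>i\<in>{m..<length As}. poisson_prob (lam \<omega> i) (ns ! i))) \<partial>P)"
  using m ns
proof (induction m arbitrary: ns)
  case 0
  have "(\<integral>\<^sup>+ \<omega>\<in>E \<inter> {\<omega> \<in> space P. \<forall>i\<in>{0..<length As}. cnt (As ! i) (Z (Suc k) \<omega>) = ns ! i}.
           ennreal (\<Prod>i<0. a i ^ cnt (As ! i) (Z (Suc k) \<omega>)) \<partial>P)
     = emeasure P (E \<inter> {\<omega> \<in> space P. \<forall>i<length As. cnt (As ! i) (Z (Suc k) \<omega>) = ns ! i})"
  proof -
    have "E \<inter> {\<omega> \<in> space P. \<forall>i<length As. cnt (As ! i) (Z (Suc k) \<omega>) = ns ! i} \<in> sets P"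
    proof (rule sets.Int[OF gen_events_sets[OF E]])
      have "{\<omega> \<in> space P. \<forall>i\<in>{..<length As}. cnt (As ! i) (Z (Suc k) \<omega>) = ns ! i} \<in> sets P"
        by (rule sets.sets_Collect_finite_All) (use As(1) in \<open>auto intro!: cnt_event\<close>)
      then show "{\<omega> \<in> space P. \<forall>i<length As. cnt (As ! i) (Z (Suc k) \<omega>) = ns ! i} \<in> sets P"
        by (simp only: Ball_def lessThan_iff)
    qed
    then show ?thesis by (simp only: Ball_def atLeast0LessThan lessThan_iff lessThan_0 prod.empty
      ennreal_1 mult_1 nn_integral_indicator)
  qed
  also have "\<dots> = (\<integral>\<^sup>+ \<omega>\<in>E. ennreal (\<Prod>i<length As. poisson_prob (lam \<omega> i) (ns ! i)) \<partial>P)"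
    unfolding lam_def using As E 0 by (intro bp_step) auto
  finally show ?case by (simp only: atLeast0LessThan lessThan_0 prod.empty mult_1)
next
  case (Suc m)
  have [measurable]: "As ! i \<in> sets M" if "i < length As" for i using As(1) that by auto
  have E' [measurable]: "E \<in> sets P" by (rule gen_events_sets[OF E])
  let ?C = "\<lambda>j ns. {\<omega> \<in> space P. \<forall>i\<in>{j..<length As}. cnt (As ! i) (Z (Suc k) \<omega>) = ns ! i}"
  let ?G = "\<lambda>m \<omega>. (\<Prod>i<m. a i ^ cnt (As ! i) (Z (Suc k) \<omega>))"
  let ?R = "\<lambda>\<omega>. (\<Prod>i\<in>{Suc m..<length As}. poisson_prob (lam \<omega> i) (ns ! i))"
  let ?X = "\<lambda>m \<omega>. (\<Prod>i<m. exp (- (lam \<omega> i * (1 - a i))))"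
  have l: "0 \<le> lam \<omega> i" for \<omega> i by (simp add: lam_def offspring_mean_nonneg)
  have m': "m < length As" using Suc.prems by simp
  have lm [measurable]: "(\<lambda>\<omega>. lam \<omega> i) \<in> borel_measurable P" if "i < length As" for i
    unfolding lam_def using that by measurable
  have Cm [measurable]: "?C j ns' \<in> sets P" for j ns'
    by (rule sets.sets_Collect_finite_All) auto
  have Gm [measurable]: "?G m \<in> borel_measurable P"
    using m' by (intro borel_measurable_prod borel_measurable_power) auto
  \<comment> \<open>The count in set number \<open>m\<close> is free on the left. In the series only
    the actual count \<open>n\<close> gives a nonzero indicator, and \<open>ns[m := n]\<close>
    brings each term into the form of the induction hypothesis.\<close>
  have split: "ennreal (?G (Suc m) \<omega>) * indicator (E \<inter> ?C (Suc m) ns) \<omega>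
      = (\<Sum>n. ennreal (a m ^ n) * (ennreal (?G m \<omega>) * indicator (E \<inter> ?C m (ns[m := n])) \<omega>))"
    if \<omega>: "\<omega> \<in> space P" for \<omega>
  proof -
    let ?n = "cnt (As ! m) (Z (Suc k) \<omega>)"
    have ivl: "{m..<length As} = insert m {Suc m..<length As}" using m' by auto
    have ind: "indicator (E \<inter> ?C m (ns[m := n])) \<omega>
        = (if n = ?n then indicator (E \<inter> ?C (Suc m) ns) \<omega> else (0::ennreal))" for n
      using m' Suc.prems unfolding ivl by (auto simp: indicator_def)
    have "(\<Sum>n. ennreal (a m ^ n) * (ennreal (?G m \<omega>) * indicator (E \<inter> ?C m (ns[m := n])) \<omega>))
       = (\<Sum>n\<in>{?n}. ennreal (a m ^ n) * (ennreal (?G m \<omega>) * indicator (E \<inter> ?C m (ns[m := n])) \<omega>))"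
      by (rule suminf_finite) (auto simp: ind)
    also have "\<dots> = ennreal (?G (Suc m) \<omega>) * indicator (E \<inter> ?C (Suc m) ns) \<omega>"
    proof -
      have "ennreal (?G (Suc m) \<omega>) = ennreal (a m ^ ?n) * ennreal (?G m \<omega>)"
        using a m' by (subst ennreal_mult[symmetric]) (auto intro!: prod_nonneg simp: mult.commute)
      then show ?thesis by (simp add: ind mult_ac)
    qed
    finally show ?thesis by simp
  qed
  have "(\<integral>\<^sup>+ \<omega>\<in>E \<inter> ?C (Suc m) ns. ennreal (?G (Suc m) \<omega>) \<partial>P)
     = (\<Sum>n. ennreal (a m ^ n) * (\<integral>\<^sup>+ \<omega>\<in>E \<inter> ?C m (ns[m := n]). ennreal (?G m \<omega>) \<partial>P))"
    by (subst nn_integral_cong[OF split], assumption, subst nn_integral_suminf)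
       (auto simp: nn_integral_cmult)
  also have "\<dots> = (\<Sum>n. ennreal (a m ^ n) *
      (\<integral>\<^sup>+ \<omega>\<in>E. ennreal (?X m \<omega> * (\<Prod>i\<in>{m..<length As}. poisson_prob (lam \<omega> i) (ns[m := n] ! i))) \<partial>P))"
    using Suc.prems by (intro suminf_cong arg_cong2[where f="(*)"] refl Suc.IH) auto
  also have "\<dots> = (\<Sum>n. ennreal (a m ^ n) *
      (\<integral>\<^sup>+ \<omega>\<in>E. ennreal (?X m \<omega> * (poisson_prob (lam \<omega> m) n * ?R \<omega>)) \<partial>P))"
  proof -
    have "(\<Prod>i\<in>{m..<length As}. poisson_prob (lam \<omega> i) (ns[m := n] ! i)) = poisson_prob (lam \<omega> m) n * ?R \<omega>" for n \<omega>
    proof -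
      have "(\<Prod>i\<in>{m..<length As}. poisson_prob (lam \<omega> i) (ns[m := n] ! i))
        = poisson_prob (lam \<omega> m) (ns[m := n] ! m) * (\<Prod>i\<in>{Suc m..<length As}. poisson_prob (lam \<omega> i) (ns[m := n] ! i))"
        using m' by (rule prod.atLeast_Suc_lessThan)
      then show ?thesis using m' Suc.prems by simp
    qed
    then show ?thesis by simp
  qed
  also have "\<dots> = (\<integral>\<^sup>+ \<omega>\<in>E. (\<Sum>n. ennreal (a m ^ n) * ennreal (?X m \<omega> * (poisson_prob (lam \<omega> m) n * ?R \<omega>))) \<partial>P)"
  proof -
    have [measurable]: "(\<lambda>\<omega>. ?X m \<omega> * (poisson_prob (lam \<omega> m) n * ?R \<omega>)) \<in> borel_measurable P" for n
      using m' by (intro borel_measurable_times borel_measurable_prod measurable_compose[OF _ poisson_prob_measurable]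
         measurable_compose[OF _ borel_measurable_exp] borel_measurable_uminus lm borel_measurable_const) auto
    show ?thesis
      by (subst nn_integral_cmult[symmetric], measurable, subst nn_integral_suminf[symmetric])
         (auto simp: ennreal_suminf_multc[symmetric] mult.assoc intro!: nn_integral_cong)
  qed
  also have "\<dots> = (\<integral>\<^sup>+ \<omega>\<in>E. ennreal (?X (Suc m) \<omega> * ?R \<omega>) \<partial>P)"
  proof -
    have "(\<Sum>n. ennreal (a m ^ n) * ennreal (?X m \<omega> * (poisson_prob (lam \<omega> m) n * ?R \<omega>))) = ennreal (?X (Suc m) \<omega> * ?R \<omega>)" for \<omega>
    proof -
      have "(\<lambda>n. (?X m \<omega> * ?R \<omega>) * (a m ^ n * poisson_prob (lam \<omega> m) n))
          sums ((?X m \<omega> * ?R \<omega>) * exp (- (lam \<omega> m * (1 - a m))))"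
        by (intro sums_mult poisson_pgf)
      moreover have "0 \<le> ?R \<omega>" by (intro prod_nonneg) (auto intro: poisson_prob_nonneg l)
      moreover have "0 \<le> ?X m \<omega>" by (intro prod_nonneg) auto
      ultimately have "(\<Sum>n. ennreal ((?X m \<omega> * ?R \<omega>) * (a m ^ n * poisson_prob (lam \<omega> m) n)))
         = ennreal ((?X m \<omega> * ?R \<omega>) * exp (- (lam \<omega> m * (1 - a m))))"
        using a[OF m'] l by (intro suminf_ennreal_eq) (auto simp: poisson_prob_nonneg)
      moreover have "ennreal (a m ^ n) * ennreal (?X m \<omega> * (poisson_prob (lam \<omega> m) n * ?R \<omega>))
         = ennreal ((?X m \<omega> * ?R \<omega>) * (a m ^ n * poisson_prob (lam \<omega> m) n))" for n
        using a[OF m'] by (subst ennreal_mult'[symmetric]) (auto simp: mult_ac)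
      ultimately show ?thesis by (simp add: mult_ac)
    qed
    then show ?thesis by simp
  qed
  finally show ?case .
qed

text \<open>\<open>pgf_prefix\<close> for the level sets of \<open>s\<close>, with base 1 - v on the
  level set of v. The Poisson means are additive in the parents, so the exponential factors into one
  \<open>1 - surv_step s y\<close> per parent.\<close>

lemma one_step_simple:
  assumes s: "simple_function M s" "unit_fun s" and E: "E \<in> gen_events P M Z k"
  shows "(\<integral>\<^sup>+ \<omega>\<in>E. ennreal (pgf_prod s (Z (Suc k) \<omega>)) \<partial>P) = (\<integral>\<^sup>+ \<omega>\<in>E. ennreal (pgf_prod (surv_step s) (Z k \<omega>)) \<partial>P)"
proof -
  have [measurable]: "s \<in> borel_measurable M" using s by auto
  have f: "finite (s ` space M)" using s by (simp add: simple_function_def)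
  then obtain vs where vs: "set vs = s ` space M" "distinct vs"
    using finite_distinct_list by blast
  define A where "A v = s -` {v} \<inter> space M" for v
  define As where "As = map A vs"
  have A [measurable]: "A v \<in> sets M" for v unfolding A_def by measurable
  have len: "length As = length vs" by (simp add: As_def)
  have nth: "As ! i = A (vs ! i)" if "i < length vs" for i using that by (simp add: As_def)
  have v01: "0 \<le> v \<and> v \<le> 1" if "v \<in> set vs" for v using that vs(1) s(2) by auto
  have Zk: "set_mset (Z j \<omega>) \<subseteq> space M" if "\<omega> \<in> space P" for j \<omega> using Z_space[OF that] by auto
  have left: "(\<Prod>i<length vs. (1 - vs ! i) ^ cnt (As ! i) (Z (Suc k) \<omega>)) = pgf_prod s (Z (Suc k) \<omega>)"
    if "\<omega> \<in> space P" for \<omega>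
  proof -
    have "(\<Prod>i<length vs. (1 - vs ! i) ^ cnt (As ! i) (Z (Suc k) \<omega>))
       = (\<Prod>i<length vs. (1 - vs ! i) ^ cnt (A (vs ! i)) (Z (Suc k) \<omega>))"
      by (intro prod.cong) (auto simp: nth)
    also have "\<dots> = (\<Prod>v\<in>set vs. (1 - v) ^ cnt (A v) (Z (Suc k) \<omega>))"
      using vs(2) by (rule prod_list_index)
    also have "\<dots> = pgf_prod s (Z (Suc k) \<omega>)"
      unfolding A_def using Zk[OF that] vs(1) f by (intro pgf_prod_level_sets[symmetric]) auto
    finally show ?thesis .
  qed
  have right: "(\<Prod>i<length vs. exp (- (offspring_mean M \<kappa> (Z k \<omega>) (As ! i) * (1 - (1 - vs ! i)))))
      = pgf_prod (surv_step s) (Z k \<omega>)" if "\<omega> \<in> space P" for \<omega>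
  proof -
    have *: "pgf_prod (surv_step s) z = exp (- (\<Sum>v\<in>set vs. v * offspring_mean M \<kappa> z (A v)))"
      if "set_mset z \<subseteq> space M" for z
      using that
    proof (induction z)
      case empty
      then show ?case by (simp add: offspring_mean_def)
    next
      case (add y z)
      have "kernel_opr s y = (\<Sum>v\<in>set vs. v * row_mass y (A v))"
        unfolding A_def using add.prems vs(1) v01 f by (intro kernel_opr_simple) auto
      then have "1 - surv_step s y = exp (- (\<Sum>v\<in>set vs. v * row_mass y (A v)))" by (simp add: surv_step_def)
      then show ?case using add
        by (simp add: offspring_mean_eq distrib_left sum.distrib flip: exp_add)
    qed
    have "(\<Prod>i<length vs. exp (- (offspring_mean M \<kappa> (Z k \<omega>) (As ! i) * (1 - (1 - vs ! i)))))
       = (\<Prod>i<length vs. exp (- (vs ! i * offspring_mean M \<kappa> (Z k \<omega>) (A (vs ! i)))))"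
      by (intro prod.cong) (auto simp: nth mult.commute)
    also have "\<dots> = (\<Prod>v\<in>set vs. exp (- (v * offspring_mean M \<kappa> (Z k \<omega>) (A v))))"
      using vs(2) by (rule prod_list_index)
    also have "\<dots> = pgf_prod (surv_step s) (Z k \<omega>)"
      by (simp add: *[OF Zk[OF that]] exp_sum flip: sum_negf)
    finally show ?thesis .
  qed
  have disj: "As ! i \<inter> As ! j = {}" if "i < length As" "j < length As" "i \<noteq> j" for i j
  proof -
    have "vs ! i \<noteq> vs ! j" using that vs(2) by (simp add: len nth_eq_iff_index_eq)
    then show ?thesis using that by (auto simp: len nth A_def)
  qed
  \<comment> \<open>At \<open>m = length As\<close> no count is prescribed any more; the list of
    zeros only has to have the right length.\<close>
  have "(\<integral>\<^sup>+ \<omega>\<in>E \<inter> {\<omega> \<in> space P. \<forall>i\<in>{length As..<length As}. cnt (As ! i) (Z (Suc k) \<omega>) = replicate (length As) 0 ! i}.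
           ennreal (\<Prod>i<length As. (1 - vs ! i) ^ cnt (As ! i) (Z (Suc k) \<omega>)) \<partial>P)
       = (\<integral>\<^sup>+ \<omega>\<in>E. ennreal ((\<Prod>i<length As. exp (- (offspring_mean M \<kappa> (Z k \<omega>) (As ! i) * (1 - (1 - vs ! i))))) *
           (\<Prod>i\<in>{length As..<length As}. poisson_prob (offspring_mean M \<kappa> (Z k \<omega>) (As ! i)) (replicate (length As) 0 ! i))) \<partial>P)"
    by (rule pgf_prefix[OF _ disj E]) (use v01 in \<open>auto simp: As_def A\<close>)
  then have "(\<integral>\<^sup>+ \<omega>. ennreal (\<Prod>i<length vs. (1 - vs ! i) ^ cnt (As ! i) (Z (Suc k) \<omega>)) * indicator (E \<inter> space P) \<omega> \<partial>P)
       = (\<integral>\<^sup>+ \<omega>\<in>E. ennreal (\<Prod>i<length vs. exp (- (offspring_mean M \<kappa> (Z k \<omega>) (As ! i) * (1 - (1 - vs ! i))))) \<partial>P)"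
    by (simp add: len)
  moreover have "(\<integral>\<^sup>+ \<omega>. ennreal (\<Prod>i<length vs. (1 - vs ! i) ^ cnt (As ! i) (Z (Suc k) \<omega>)) * indicator (E \<inter> space P) \<omega> \<partial>P)
      = (\<integral>\<^sup>+ \<omega>\<in>E. ennreal (pgf_prod s (Z (Suc k) \<omega>)) \<partial>P)"
    by (intro nn_integral_cong) (simp only: left, simp add: indicator_def)
  moreover have "(\<integral>\<^sup>+ \<omega>\<in>E. ennreal (\<Prod>i<length vs. exp (- (offspring_mean M \<kappa> (Z k \<omega>) (As ! i) * (1 - (1 - vs ! i))))) \<partial>P)
      = (\<integral>\<^sup>+ \<omega>\<in>E. ennreal (pgf_prod (surv_step s) (Z k \<omega>)) \<partial>P)"
    by (intro nn_integral_cong) (simp only: right)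
  ultimately show ?thesis by simp
qed

text \<open>Both sides are continuous along simple approximations, by bounded convergence; on the
  right this uses \<open>surv_step_tendsto\<close>.\<close>

lemma one_step:
  assumes s: "unit_fun s" and E: "E \<in> gen_events P M Z k"
  shows "(\<integral>\<^sup>+ \<omega>\<in>E. ennreal (pgf_prod s (Z (Suc k) \<omega>)) \<partial>P) = (\<integral>\<^sup>+ \<omega>\<in>E. ennreal (pgf_prod (surv_step s) (Z k \<omega>)) \<partial>P)"
proof -
  have [measurable]: "E \<in> sets P" by (rule gen_events_sets[OF E])
  obtain t where t: "\<And>i. simple_function M (t i)" "\<And>i. unit_fun (t i)"
    "\<And>y. y \<in> space M \<Longrightarrow> (\<lambda>i. t i y) \<longlonglongrightarrow> s y"
    using simple_approx[OF s] by blast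
  have lim: "(\<lambda>i. \<integral>\<^sup>+ \<omega>\<in>E. ennreal (pgf_prod (u i) (Z j \<omega>)) \<partial>P) \<longlonglongrightarrow> (\<integral>\<^sup>+ \<omega>\<in>E. ennreal (pgf_prod v (Z j \<omega>)) \<partial>P)"
    if u: "\<And>i. unit_fun (u i)" "unit_fun v" "\<And>y. y \<in> space M \<Longrightarrow> (\<lambda>i. u i y) \<longlonglongrightarrow> v y" for u v j
  proof (rule nn_integral_dominated_convergence[where w = "\<lambda>_. 1"])
    note [measurable] = pgf_prod_measurable[OF u(1)] pgf_prod_measurable[OF u(2)]
    show "(\<lambda>\<omega>. ennreal (pgf_prod (u i) (Z j \<omega>)) * indicator E \<omega>) \<in> borel_measurable P" for i by measurable
    show "(\<lambda>\<omega>. ennreal (pgf_prod v (Z j \<omega>)) * indicator E \<omega>) \<in> borel_measurable P" by measurable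
    show "AE \<omega> in P. ennreal (pgf_prod (u i) (Z j \<omega>)) * indicator E \<omega> \<le> 1" for i
      using pgf_prod_Z_bounds[OF u(1)] by (intro AE_I2) (auto simp: indicator_def)
    show "AE \<omega> in P. (\<lambda>i. ennreal (pgf_prod (u i) (Z j \<omega>)) * indicator E \<omega>)
        \<longlonglongrightarrow> ennreal (pgf_prod v (Z j \<omega>)) * indicator E \<omega>"
      by (intro AE_I2 tendsto_mult_ennreal tendsto_const tendsto_ennrealI pgf_prod_tendsto u(3))
         (auto simp: indicator_def intro: Z_space)
  qed (auto simp: P.emeasure_space_1)
  have "(\<lambda>i. \<integral>\<^sup>+ \<omega>\<in>E. ennreal (pgf_prod (t i) (Z (Suc k) \<omega>)) \<partial>P) \<longlonglongrightarrow> (\<integral>\<^sup>+ \<omega>\<in>E. ennreal (pgf_prod s (Z (Suc k) \<omega>)) \<partial>P)"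
    by (rule lim[OF t(2) s t(3)])
  moreover have "(\<lambda>i. \<integral>\<^sup>+ \<omega>\<in>E. ennreal (pgf_prod (surv_step (t i)) (Z k \<omega>)) \<partial>P) \<longlonglongrightarrow> (\<integral>\<^sup>+ \<omega>\<in>E. ennreal (pgf_prod (surv_step s) (Z k \<omega>)) \<partial>P)"
    by (rule lim) (auto intro: unit_fun_surv_step t s surv_step_tendsto)
  ultimately show ?thesis
    using one_step_simple[OF t(1,2) E] by (auto intro: LIMSEQ_unique)
qed

text \<open>Generations are removed from the last one backwards. Each removal replaces
  \<open>s\<close> by \<open>surv_step s\<close>, hence the generalisation over \<open>s\<close>,
  while \<open>E\<close> remains an event of every later history.\<close>

lemma multi_step:
  assumes "unit_fun s" "E \<in> gen_events P M Z k"
  shows "(\<integral>\<^sup>+ \<omega>\<in>E. ennreal (pgf_prod s (Z (k + j) \<omega>)) \<partial>P)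
    = (\<integral>\<^sup>+ \<omega>\<in>E. ennreal (pgf_prod ((surv_step ^^ j) s) (Z k \<omega>)) \<partial>P)"
  using assms
proof (induction j arbitrary: s)
  case (Suc j)
  have "E \<in> gen_events P M Z (k + j)" using gen_events_mono[of k "k + j"] Suc.prems by auto
  then show ?case
    using one_step[of s E "k + j"] Suc.IH[OF unit_fun_surv_step] Suc.prems
    by (simp add: funpow_swap1)
qed simp

lemma pgf:
  assumes "unit_fun s"
  shows "(\<integral>\<^sup>+ \<omega>. ennreal (pgf_prod s (Z k \<omega>)) \<partial>P) = ennreal (1 - (surv_step ^^ k) s x)"
proof -
  have "(\<integral>\<^sup>+ \<omega>. ennreal (pgf_prod s (Z k \<omega>)) \<partial>P) = (\<integral>\<^sup>+ \<omega>\<in>space P. ennreal (pgf_prod s (Z (0 + k) \<omega>)) \<partial>P)"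
    by (intro nn_integral_cong) auto
  also have "\<dots> = (\<integral>\<^sup>+ \<omega>\<in>space P. ennreal (pgf_prod ((surv_step ^^ k) s) (Z 0 \<omega>)) \<partial>P)"
    by (rule multi_step[OF assms gen_events_space])
  also have "\<dots> = (\<integral>\<^sup>+ \<omega>. ennreal (1 - (surv_step ^^ k) s x) \<partial>P)"
    by (intro nn_integral_cong) (auto simp: Z_0)
  finally show ?thesis by (simp add: P.emeasure_space_1)
qed

end

section \<open>The limit of the iterated survival operator\<close>

context kernel_rows
begin

definition surv :: "'a \<Rightarrow> real" where
  "surv y = lim (\<lambda>n. (surv_step ^^ n) (\<lambda>_. 1) y)"

lemma unit_fun_1: "unit_fun (\<lambda>_. 1)"
  by (simp add: unit_fun_def)

lemma surv_step_funpow_decseq: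
  assumes "y \<in> space M"
  shows "decseq (\<lambda>n. (surv_step ^^ n) (\<lambda>_. 1) y)"
proof (rule decseq_SucI)
  fix n
  show "(surv_step ^^ Suc n) (\<lambda>_. 1) y \<le> (surv_step ^^ n) (\<lambda>_. 1) y"
    using assms
  proof (induction n arbitrary: y)
    case 0
    then show ?case using surv_step_bounds[of "\<lambda>_. 1" y] by simp
  next
    case (Suc n)
    have "surv_step ((surv_step ^^ Suc n) (\<lambda>_. 1)) y \<le> surv_step ((surv_step ^^ n) (\<lambda>_. 1)) y"
      using Suc unit_fun_surv_step_funpow[OF unit_fun_1, of n] by (intro surv_step_mono[where B=1]) auto
    then show ?case by simp
  qed
qed

lemma surv_LIMSEQ:
  assumes "y \<in> space M"
  shows "(\<lambda>n. (surv_step ^^ n) (\<lambda>_. 1) y) \<longlonglongrightarrow> surv y"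
proof -
  have "0 \<le> (surv_step ^^ n) (\<lambda>_. 1) y" for n
    using unit_funD(2)[OF unit_fun_surv_step_funpow[OF unit_fun_1] assms] .
  then obtain L where "(\<lambda>n. (surv_step ^^ n) (\<lambda>_. 1) y) \<longlonglongrightarrow> L"
    using decseq_convergent[OF surv_step_funpow_decseq[OF assms]] by metis
  then have "convergent (\<lambda>n. (surv_step ^^ n) (\<lambda>_. 1) y)" by (auto simp: convergent_def)
  then show ?thesis by (simp add: surv_def convergent_LIMSEQ_iff)
qed

lemma unit_fun_surv: "unit_fun surv"
proof -
  have [measurable]: "(surv_step ^^ n) (\<lambda>_. 1) \<in> borel_measurable M" for n
    using unit_fun_surv_step_funpow[OF unit_fun_1] by auto
  have "surv \<in> borel_measurable M" unfolding surv_def[abs_def] by measurable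
  moreover have "0 \<le> surv y" if "y \<in> space M" for y
    by (rule LIMSEQ_le_const[OF surv_LIMSEQ[OF that]])
       (use unit_funD(2)[OF unit_fun_surv_step_funpow[OF unit_fun_1] that] in auto)
  moreover have "surv y \<le> 1" if "y \<in> space M" for y
    by (rule LIMSEQ_le_const2[OF surv_LIMSEQ[OF that]])
       (use unit_funD(3)[OF unit_fun_surv_step_funpow[OF unit_fun_1] that] in auto)
  ultimately show ?thesis by (simp add: unit_fun_def)
qed

lemma surv_fixpoint:
  assumes "y \<in> space M"
  shows "surv_step surv y = surv y"
proof (rule LIMSEQ_unique)
  show "(\<lambda>n. (surv_step ^^ Suc n) (\<lambda>_. 1) y) \<longlonglongrightarrow> surv y"
    using surv_LIMSEQ[OF assms] by (rule LIMSEQ_Suc)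
  show "(\<lambda>n. (surv_step ^^ Suc n) (\<lambda>_. 1) y) \<longlonglongrightarrow> surv_step surv y"
    using surv_step_tendsto[OF unit_fun_surv_step_funpow[OF unit_fun_1] unit_fun_surv surv_LIMSEQ assms] by simp
qed

end

section \<open>Extinction of the process\<close>

context bp
begin

text \<open>A summable sequence of natural numbers vanishes eventually; conversely, only finitely
  many finite terms remain.\<close>

lemma total_size_finite_iff:
  "total_size Z \<omega> < \<top> \<longleftrightarrow> (\<exists>n. \<forall>m\<ge>n. Z m \<omega> = {#})"
proof
  assume "total_size Z \<omega> < \<top>"
  then have fin: "(\<Sum>k. ennreal (real (size (Z k \<omega>)))) \<noteq> \<top>"
    by (simp add: total_size_def ennreal_of_nat_eq_real_of_nat)
  have "summable (\<lambda>k. real (size (Z k \<omega>)))"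
    by (rule summable_suminf_not_top) (use fin in auto)
  then have "(\<lambda>k. real (size (Z k \<omega>))) \<longlonglongrightarrow> 0" by (rule summable_LIMSEQ_zero)
  then have "eventually (\<lambda>k. real (size (Z k \<omega>)) < 1) sequentially" by (rule order_tendstoD) simp
  then show "\<exists>n. \<forall>m\<ge>n. Z m \<omega> = {#}" by (auto simp: eventually_sequentially)
next
  assume "\<exists>n. \<forall>m\<ge>n. Z m \<omega> = {#}"
  then obtain n where n: "\<And>m. n \<le> m \<Longrightarrow> Z m \<omega> = {#}" by auto
  have "total_size Z \<omega> = (\<Sum>k<n. of_nat (size (Z k \<omega>)))"
    unfolding total_size_def by (rule suminf_finite) (use n in auto)
  also have "\<dots> < \<top>" by (simp add: of_nat_less_top)
  finally show "total_size Z \<omega> < \<top>" .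
qed

lemma pgf_prod_1: "pgf_prod (\<lambda>_. 1) z = (if z = {#} then 1 else 0)"
  by (induction z) auto

lemma empty_event [measurable]: "{\<omega> \<in> space P. Z k \<omega> = {#}} \<in> sets P"
  using gen_events_sets[OF gen_events_size[of k 0]] by simp

text \<open>\<open>BP_realisation\<close> constrains laws and not paths, so emptiness is absorbing
  only almost surely. The one-step identity with s = 1 on the event \<open>?E k\<close> shows that
  \<open>?E k\<close> and \<open>?E k \<inter> ?E (Suc k)\<close> have equal probability, because
  the empty product is 1.\<close>

lemma empty_stable: "AE \<omega> in P. Z k \<omega> = {#} \<longrightarrow> Z (Suc k) \<omega> = {#}"
proof -
  let ?E = "\<lambda>k. {\<omega> \<in> space P. Z k \<omega> = {#}}"
  have E: "?E k \<in> gen_events P M Z k" using gen_events_size[of k 0] by simp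
  have "emeasure P (?E k \<inter> ?E (Suc k)) = (\<integral>\<^sup>+ \<omega>. indicator (?E k \<inter> ?E (Suc k)) \<omega> \<partial>P)"
    by simp
  also have "\<dots> = (\<integral>\<^sup>+ \<omega>\<in>?E k. ennreal (pgf_prod (\<lambda>_. 1) (Z (Suc k) \<omega>)) \<partial>P)"
    by (intro nn_integral_cong) (auto simp: pgf_prod_1 indicator_def)
  also have "\<dots> = (\<integral>\<^sup>+ \<omega>\<in>?E k. ennreal (pgf_prod (surv_step (\<lambda>_. 1)) (Z k \<omega>)) \<partial>P)"
    by (rule one_step[OF unit_fun_1 E])
  also have "\<dots> = (\<integral>\<^sup>+ \<omega>. indicator (?E k) \<omega> \<partial>P)"
    by (intro nn_integral_cong) (auto simp: indicator_def)
  also have "\<dots> = emeasure P (?E k)" by simp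
  finally have "emeasure P (?E k - ?E k \<inter> ?E (Suc k)) = 0"
    by (subst emeasure_Diff) auto
  then have "?E k - ?E k \<inter> ?E (Suc k) \<in> null_sets P" by (intro null_setsI) auto
  from AE_not_in[OF this] AE_space show ?thesis by eventually_elim auto
qed

lemma total_size_measurable [measurable]: "total_size Z \<in> borel_measurable P"
  unfolding total_size_def[abs_def] by measurable

lemma AE_empty_stable: "AE \<omega> in P. \<forall>k m. k \<le> m \<longrightarrow> Z k \<omega> = {#} \<longrightarrow> Z m \<omega> = {#}"
proof -
  have "AE \<omega> in P. \<forall>k. Z k \<omega> = {#} \<longrightarrow> Z (Suc k) \<omega> = {#}"
    using empty_stable by (simp add: AE_all_countable)
  then show ?thesis
  proof eventually_elim
    case (elim \<omega>)
    show ?case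
    proof (intro allI impI)
      fix k m :: nat assume "k \<le> m" "Z k \<omega> = {#}"
      then show "Z m \<omega> = {#}" by (induction rule: dec_induct) (use elim in auto)
    qed
  qed
qed

text \<open>For s = 1 the product is the indicator of emptiness, so the left side is the limit of
  the probabilities that \<open>E\<close> occurs and generation k + n is empty.
  \<open>multi_step\<close> moves these back to generation k, where the iterates of 1 tend to
  \<open>surv\<close>.\<close>

lemma extinct_event:
  assumes E: "E \<in> gen_events P M Z k"
  shows "(\<integral>\<^sup>+ \<omega>\<in>E. indicator {\<omega>. total_size Z \<omega> < \<top>} \<omega> \<partial>P) = (\<integral>\<^sup>+ \<omega>\<in>E. ennreal (pgf_prod surv (Z k \<omega>)) \<partial>P)"
proof (rule LIMSEQ_unique)
  have [measurable]: "E \<in> sets P" by (rule gen_events_sets[OF E])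
  show "(\<lambda>n. \<integral>\<^sup>+ \<omega>\<in>E. ennreal (pgf_prod (\<lambda>_. 1) (Z (k + n) \<omega>)) \<partial>P)
     \<longlonglongrightarrow> (\<integral>\<^sup>+ \<omega>\<in>E. indicator {\<omega>. total_size Z \<omega> < \<top>} \<omega> \<partial>P)"
  proof (rule nn_integral_dominated_convergence[where w = "\<lambda>_. 1"])
    show "(\<lambda>\<omega>. ennreal (pgf_prod (\<lambda>_. 1) (Z (k + n) \<omega>)) * indicator E \<omega>) \<in> borel_measurable P" for n
      using pgf_prod_measurable[OF unit_fun_1] by measurable
    have "(\<lambda>\<omega>. (if total_size Z \<omega> < \<top> then 1 else 0) * indicator E \<omega> :: ennreal) \<in> borel_measurable P"
      by measurable
    then show "(\<lambda>\<omega>. indicator {\<omega>. total_size Z \<omega> < \<top>} \<omega> * indicator E \<omega> :: ennreal) \<in> borel_measurable P"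
      by (simp add: indicator_def[of "Collect _", abs_def] of_bool_def)
    show "AE \<omega> in P. ennreal (pgf_prod (\<lambda>_. 1) (Z (k + n) \<omega>)) * indicator E \<omega> \<le> 1" for n
      by (auto simp: pgf_prod_1 indicator_def)
    show "AE \<omega> in P. (\<lambda>n. ennreal (pgf_prod (\<lambda>_. 1) (Z (k + n) \<omega>)) * indicator E \<omega>)
        \<longlonglongrightarrow> indicator {\<omega>. total_size Z \<omega> < \<top>} \<omega> * indicator E \<omega>"
      using AE_empty_stable
    proof eventually_elim
      case (elim \<omega>)
      show ?case
      proof (cases "total_size Z \<omega> < \<top>")
        case True
        then obtain n where n: "\<And>m. n \<le> m \<Longrightarrow> Z m \<omega> = {#}" by (auto simp: total_size_finite_iff)
        show ?thesis
          by (rule tendsto_eventually) (use n True in \<open>auto simp: eventually_sequentially pgf_prod_1 intro!: exI[of _ n]\<close>)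
      next
        case False
        then have "Z m \<omega> \<noteq> {#}" for m using elim by (auto simp: total_size_finite_iff)
        then show ?thesis using False by (simp add: pgf_prod_1)
      qed
    qed
  qed (auto simp: P.emeasure_space_1)
  have [measurable]: "(\<lambda>\<omega>. pgf_prod ((surv_step ^^ n) (\<lambda>_. 1)) (Z k \<omega>)) \<in> borel_measurable P"
    "(\<lambda>\<omega>. pgf_prod surv (Z k \<omega>)) \<in> borel_measurable P" for n
    by (rule pgf_prod_measurable, intro unit_fun_surv_step_funpow unit_fun_1 unit_fun_surv)
       (rule pgf_prod_measurable[OF unit_fun_surv])
  have "(\<lambda>n. \<integral>\<^sup>+ \<omega>\<in>E. ennreal (pgf_prod ((surv_step ^^ n) (\<lambda>_. 1)) (Z k \<omega>)) \<partial>P)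
     \<longlonglongrightarrow> (\<integral>\<^sup>+ \<omega>\<in>E. ennreal (pgf_prod surv (Z k \<omega>)) \<partial>P)"
  proof (rule nn_integral_dominated_convergence[where w = "\<lambda>_. 1"])
    show "AE \<omega> in P. ennreal (pgf_prod ((surv_step ^^ n) (\<lambda>_. 1)) (Z k \<omega>)) * indicator E \<omega> \<le> 1" for n
      using pgf_prod_Z_bounds[OF unit_fun_surv_step_funpow[OF unit_fun_1]] by (intro AE_I2) (auto simp: indicator_def)
    show "AE \<omega> in P. (\<lambda>n. ennreal (pgf_prod ((surv_step ^^ n) (\<lambda>_. 1)) (Z k \<omega>)) * indicator E \<omega>)
        \<longlonglongrightarrow> ennreal (pgf_prod surv (Z k \<omega>)) * indicator E \<omega>"
      by (intro AE_I2 tendsto_mult_ennreal tendsto_const tendsto_ennrealI pgf_prod_tendsto surv_LIMSEQ)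
         (auto simp: indicator_def intro: Z_space)
  qed (auto simp: P.emeasure_space_1)
  then show "(\<lambda>n. \<integral>\<^sup>+ \<omega>\<in>E. ennreal (pgf_prod (\<lambda>_. 1) (Z (k + n) \<omega>)) \<partial>P)
     \<longlonglongrightarrow> (\<integral>\<^sup>+ \<omega>\<in>E. ennreal (pgf_prod surv (Z k \<omega>)) \<partial>P)"
    by (simp add: multi_step[OF unit_fun_1 E])
qed

lemma prob_infinite_eq_surv: "measure P {\<omega> \<in> space P. total_size Z \<omega> = \<top>} = surv x"
proof -
  have "emeasure P {\<omega> \<in> space P. total_size Z \<omega> < \<top>} = (\<integral>\<^sup>+ \<omega>. indicator {\<omega> \<in> space P. total_size Z \<omega> < \<top>} \<omega> \<partial>P)"
    by (rule nn_integral_indicator[symmetric]) measurable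
  also have "\<dots> = (\<integral>\<^sup>+ \<omega>\<in>space P. indicator {\<omega>. total_size Z \<omega> < \<top>} \<omega> \<partial>P)"
    by (intro nn_integral_cong) (auto simp: indicator_def)
  also have "\<dots> = (\<integral>\<^sup>+ \<omega>\<in>space P. ennreal (pgf_prod surv (Z 0 \<omega>)) \<partial>P)"
    by (rule extinct_event[OF gen_events_space])
  also have "\<dots> = (\<integral>\<^sup>+ \<omega>. ennreal (1 - surv x) \<partial>P)"
    by (intro nn_integral_cong) (auto simp: Z_0)
  finally have "measure P {\<omega> \<in> space P. total_size Z \<omega> < \<top>} = 1 - surv x"
    using unit_funD(3)[OF unit_fun_surv x] by (simp add: measure_def P.emeasure_space_1)
  moreover have "space P - {\<omega> \<in> space P. total_size Z \<omega> < \<top>} = {\<omega> \<in> space P. total_size Z \<omega> = \<top>}"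
    by (auto simp: less_top[symmetric])
  ultimately show ?thesis
    using P.prob_compl[of "{\<omega> \<in> space P. total_size Z \<omega> < \<top>}"] by simp
qed

end

subsection \<open>Expected generation sizes\<close>

text \<open>The quadratic Taylor polynomials of exp (- u) and exp u multiply to 1 + (u^2 / 2)^2,
  which is at least 1, and the second one is at most exp u; so the first one is at least exp (-
  u).\<close>

lemma one_minus_exp_lower:
  assumes "0 \<le> (u::real)" shows "u - u\<^sup>2 / 2 \<le> 1 - exp (- u)"
proof -
  have "(1 - u + u\<^sup>2/2) * (1 + u + u\<^sup>2/2) = 1 + (u\<^sup>2 / 2)\<^sup>2"
    by (simp add: algebra_simps power2_eq_square)
  then have "1 \<le> (1 - u + u\<^sup>2/2) * (1 + u + u\<^sup>2/2)" by simp
  also have "\<dots> \<le> (1 - u + u\<^sup>2/2) * exp u"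
  proof (rule mult_left_mono[OF exp_lower_Taylor_quadratic[OF assms]])
    have "0 \<le> ((1 - u)\<^sup>2 + 1) / 2" by simp
    then show "0 \<le> 1 - u + u\<^sup>2/2" by (simp add: power2_diff field_simps)
  qed
  finally have "exp (- u) * 1 \<le> exp (- u) * ((1 - u + u\<^sup>2/2) * exp u)" by (intro mult_left_mono) auto
  then show ?thesis by (simp add: exp_minus field_simps)
qed

text \<open>Difference quotients: \<open>exp_quot n (size z)\<close> times \<open>pgf_prod r z\<close> is \<open>2 ^ n\<close> times the decrement of the
  generating functional when \<open>1 - r\<close> is replaced by \<open>(1 - r) * exp (- (1 / 2 ^ n))\<close>;
  along powers of two they increase to the derivative.\<close>

definition exp_quot :: "nat \<Rightarrow> real \<Rightarrow> real" where
  "exp_quot n w = 2 ^ n * (1 - exp (- (w / 2 ^ n)))"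

lemma exp_quot_mono: "v \<le> w \<Longrightarrow> exp_quot n v \<le> exp_quot n w"
  by (simp add: exp_quot_def divide_right_mono)

lemma exp_quot_nonneg: "0 \<le> w \<Longrightarrow> 0 \<le> exp_quot n w"
  by (simp add: exp_quot_def)

lemma exp_quot_le: "exp_quot n w \<le> w"
proof -
  have "1 - w / 2 ^ n \<le> exp (- (w / 2 ^ n))" using exp_ge_add_one_self[of "- (w / 2 ^ n)"] by simp
  then have "2 ^ n * (1 - exp (- (w / 2 ^ n))) \<le> 2 ^ n * (w / 2 ^ n)" by (intro mult_left_mono) auto
  then show ?thesis by (simp add: exp_quot_def)
qed

text \<open>Halving the step makes the coarser exponential the square of the finer one, e, and 2 (1
  - e) - (1 - e^2) = (1 - e)^2. This is why the steps are powers of two.\<close>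

lemma exp_quot_Suc: "exp_quot n w \<le> exp_quot (Suc n) w"
proof -
  define e where "e = exp (- (w / 2 ^ Suc n))"
  have "exp (- (w / 2 ^ n)) = e\<^sup>2" by (simp add: e_def power2_eq_square flip: exp_add)
  moreover have "1 - e\<^sup>2 \<le> 2 * (1 - e)"
    using zero_le_power2[of "1 - e"] by (simp add: power2_diff)
  ultimately have "2 ^ n * (1 - exp (- (w / 2 ^ n))) \<le> 2 ^ n * (2 * (1 - e))"
    by (intro mult_left_mono) auto
  then show ?thesis by (simp add: exp_quot_def e_def)
qed

lemma exp_quot_tendsto:
  assumes "0 \<le> w" shows "(\<lambda>n. exp_quot n w) \<longlonglongrightarrow> w"
proof (rule real_tendsto_sandwich[where h = "\<lambda>_. w"])
  show "eventually (\<lambda>n. w - w\<^sup>2 / 2 * (1/2) ^ n \<le> exp_quot n w) sequentially"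
  proof (intro always_eventually allI)
    fix n
    have "2 ^ n * (w / 2 ^ n - (w / 2 ^ n)\<^sup>2 / 2) \<le> exp_quot n w"
      unfolding exp_quot_def using assms by (intro mult_left_mono one_minus_exp_lower) auto
    moreover have "2 ^ n * (w / 2 ^ n - (w / 2 ^ n)\<^sup>2 / 2) = w - w\<^sup>2 / 2 * (1/2) ^ n"
      by (simp add: right_diff_distrib power2_eq_square power_one_over)
    ultimately show "w - w\<^sup>2 / 2 * (1/2) ^ n \<le> exp_quot n w" by simp
  qed
  have "(\<lambda>n. w - w\<^sup>2 / 2 * (1/2) ^ n) \<longlonglongrightarrow> w - w\<^sup>2 / 2 * 0"
    by (intro tendsto_intros LIMSEQ_realpow_zero) auto
  then show "(\<lambda>n. w - w\<^sup>2 / 2 * (1/2) ^ n) \<longlonglongrightarrow> w" by simp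
qed (simp_all add: exp_quot_le)

text \<open>Monotonicity in both the step and the argument allows a diagonal supremum. It is applied
  where the argument of a difference quotient is itself built from difference quotients of the same
  step.\<close>

lemma SUP_exp_quot:
  assumes "incseq w" "\<And>n. 0 \<le> w n"
  shows "(SUP n. ennreal (exp_quot n (w n))) = (SUP n. ennreal (w n))"
proof (rule antisym)
  show "(SUP n. ennreal (exp_quot n (w n))) \<le> (SUP n. ennreal (w n))"
    by (intro SUP_mono' ennreal_leI exp_quot_le)
  show "(SUP n. ennreal (w n)) \<le> (SUP n. ennreal (exp_quot n (w n)))"
  proof (rule SUP_least)
    fix m
    have "(\<lambda>n. ennreal (exp_quot n (w m))) \<longlonglongrightarrow> ennreal (w m)"
      by (intro tendsto_ennrealI exp_quot_tendsto assms)
    then show "ennreal (w m) \<le> (SUP n. ennreal (exp_quot n (w n)))"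
    proof (rule LIMSEQ_le_const2)
      have "ennreal (exp_quot n (w m)) \<le> (SUP n. ennreal (exp_quot n (w n)))" if "m \<le> n" for n
        using assms(1) that by (intro SUP_upper2[of n] ennreal_leI exp_quot_mono) (auto simp: incseq_def)
      then show "\<exists>N. \<forall>n\<ge>N. ennreal (exp_quot n (w m)) \<le> (SUP n. ennreal (exp_quot n (w n)))" by blast
    qed
  qed
qed

section \<open>Derivatives of the iterated survival operator at a fixed point\<close>

context kernel_rows
begin

lemma kernel_opr_add_cmult:
  assumes [measurable]: "s \<in> borel_measurable M" "t \<in> borel_measurable M"
    and s: "\<And>y. y \<in> space M \<Longrightarrow> 0 \<le> s y \<and> s y \<le> B" and t: "\<And>y. y \<in> space M \<Longrightarrow> 0 \<le> t y \<and> t y \<le> B"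
    and c: "0 \<le> c" and x: "x \<in> space M"
  shows "kernel_opr (\<lambda>y. s y + c * t y) x = kernel_opr s x + c * kernel_opr t x"
proof -
  have "kernel_op M \<kappa> (\<lambda>y. ennreal (s y + c * t y)) x = kernel_op M \<kappa> (\<lambda>y. ennreal (s y) + ennreal c * ennreal (t y)) x"
    unfolding kernel_op_def using s t c by (intro nn_integral_cong) (auto simp: ennreal_mult)
  also have "\<dots> = kernel_op M \<kappa> (\<lambda>y. ennreal (s y)) x + ennreal c * kernel_op M \<kappa> (\<lambda>y. ennreal (t y)) x"
    using x by (simp add: kernel_op_add kernel_op_cmult)
  also have "\<dots> = ennreal (kernel_opr s x + c * kernel_opr t x)"
    using ennreal_kernel_opr[of s B x] ennreal_kernel_opr[of t B x] s t c x kernel_opr_nonneg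
    by (simp add: ennreal_mult)
  finally show ?thesis unfolding kernel_opr_def[of "\<lambda>y. s y + c * t y"] using c
    by (simp add: kernel_opr_nonneg del: ennreal_plus)
qed

lemma surv_step_funpow_fixed:
  assumes "\<And>y. y \<in> space M \<Longrightarrow> surv_step r y = r y" "y \<in> space M"
  shows "(surv_step ^^ k) r y = r y"
  using assms(2)
proof (induction k arbitrary: y)
  case (Suc k)
  have "surv_step ((surv_step ^^ k) r) y = surv_step r y" using Suc by (intro surv_step_cong) auto
  then show ?case using assms(1)[OF Suc.prems] by simp
qed simp

text \<open>The perturbation is a factor on 1 - r and not an additive shift: the product over a
  generation then gains exactly exp (- size / 2^n).\<close>

definition thin :: "('a \<Rightarrow> real) \<Rightarrow> nat \<Rightarrow> 'a \<Rightarrow> real" where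
  "thin r n y = 1 - (1 - r y) * exp (- (1 / 2 ^ n))"

text \<open>Difference quotient of the k-th iterate. \<open>r y\<close> stands in for the iterate at
  \<open>r\<close>, which it equals at the fixed points considered.\<close>

definition pgf_incr :: "('a \<Rightarrow> real) \<Rightarrow> nat \<Rightarrow> nat \<Rightarrow> 'a \<Rightarrow> real" where
  "pgf_incr r k n y = 2 ^ n * ((surv_step ^^ k) (thin r n) y - r y)"

text \<open>The derivative of \<open>surv_step\<close> at a fixed point \<open>r\<close>:
  differentiating the exponential gives exp (- T r) T F, and exp (- T r) = 1 - r there.\<close>

definition weighted_op :: "('a \<Rightarrow> real) \<Rightarrow> ('a \<Rightarrow> ennreal) \<Rightarrow> 'a \<Rightarrow> ennreal" where
  "weighted_op r F y = ennreal (1 - r y) * kernel_op M \<kappa> F y"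

lemma unit_fun_thin:
  assumes r: "unit_fun r" shows "unit_fun (thin r n)"
proof -
  have [measurable]: "r \<in> borel_measurable M" using r by auto
  have "thin r n \<in> borel_measurable M" unfolding thin_def[abs_def] by measurable
  then show ?thesis using r by (auto simp: unit_fun_def thin_def intro!: mult_le_one)
qed

lemma pgf_incr_0: "pgf_incr r 0 n y = (1 - r y) * exp_quot n 1"
  by (simp add: pgf_incr_def thin_def exp_quot_def algebra_simps)

lemma pgf_incr_measurable: "unit_fun r \<Longrightarrow> pgf_incr r k n \<in> borel_measurable M"
  unfolding pgf_incr_def[abs_def] using unit_funD(1)[OF unit_fun_surv_step_funpow[OF unit_fun_thin[of r n], of k]]
  by (auto dest: unit_funD(1))

lemma pgf_incr_le:
  assumes "unit_fun r" "y \<in> space M" shows "pgf_incr r k n y \<le> 2 ^ n"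
proof -
  have "(surv_step ^^ k) (thin r n) y - r y \<le> 1"
    using unit_funD(3)[OF unit_fun_surv_step_funpow[OF unit_fun_thin[OF assms(1)]] assms(2)] unit_funD(2)[OF assms]
    by (smt (verit))
  then have "2 ^ n * ((surv_step ^^ k) (thin r n) y - r y) \<le> 2 ^ n * 1" by (intro mult_left_mono) auto
  then show ?thesis by (simp add: pgf_incr_def)
qed

text \<open>The chain rule without error term: an argument r + 2^-n d gives exp (- T r) exp (- T d /
  2^n), and the first factor is 1 - r. The increments have to be nonnegative since
  \<open>kernel_opr\<close> cuts off negative parts.\<close>

lemma pgf_incr_Suc:
  assumes r: "unit_fun r" and fp: "\<And>y. y \<in> space M \<Longrightarrow> surv_step r y = r y" and y: "y \<in> space M"
    and nonneg: "\<And>u. u \<in> space M \<Longrightarrow> 0 \<le> pgf_incr r k n u"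
  shows "pgf_incr r (Suc k) n y = (1 - r y) * exp_quot n (kernel_opr (pgf_incr r k n) y)"
proof -
  have "r u + 1 / 2 ^ n * pgf_incr r k n u = (surv_step ^^ k) (thin r n) u" for u
    by (simp add: pgf_incr_def)
  then have "kernel_opr ((surv_step ^^ k) (thin r n)) y = kernel_opr (\<lambda>u. r u + 1 / 2 ^ n * pgf_incr r k n u) y" by simp
  also have "\<dots> = kernel_opr r y + 1 / 2 ^ n * kernel_opr (pgf_incr r k n) y"
  proof (rule kernel_opr_add_cmult[where B = "2 ^ n"])
    show "0 \<le> r u \<and> r u \<le> 2 ^ n" if "u \<in> space M" for u
      using unit_funD(2,3)[OF r that] one_le_power[of "2::real" n] by linarith
    show "0 \<le> pgf_incr r k n u \<and> pgf_incr r k n u \<le> 2 ^ n" if "u \<in> space M" for u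
      using nonneg[OF that] pgf_incr_le[OF r that] by simp
  qed (use r y pgf_incr_measurable in auto)
  finally have "exp (- kernel_opr ((surv_step ^^ k) (thin r n)) y) = exp (- kernel_opr r y) * exp (- (kernel_opr (pgf_incr r k n) y / 2 ^ n))"
    by (simp flip: exp_add)
  moreover have "exp (- kernel_opr r y) = 1 - r y" using fp[OF y] by (simp add: surv_step_def)
  ultimately have *: "(surv_step ^^ Suc k) (thin r n) y = 1 - (1 - r y) * exp (- (kernel_opr (pgf_incr r k n) y / 2 ^ n))"
    by (simp add: surv_step_def[of "(surv_step ^^ k) _"])
  show ?thesis unfolding pgf_incr_def[of r "Suc k"] exp_quot_def * by (simp add: algebra_simps)
qed

text \<open>One induction for all three claims: sign and monotonicity at stage \<open>k\<close> are
  what lets the supremum pass through the kernel operator at stage \<open>Suc k\<close>, and what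
  makes the arguments of \<open>exp_quot\<close> increase.\<close>

lemma pgf_incr_SUP:
  assumes r: "unit_fun r" and fp: "\<And>y. y \<in> space M \<Longrightarrow> surv_step r y = r y" and "y \<in> space M"
  shows "(SUP n. ennreal (pgf_incr r k n y)) = (weighted_op r ^^ k) (\<lambda>y. ennreal (1 - r y)) y"
    and "0 \<le> pgf_incr r k n y" and "pgf_incr r k n y \<le> pgf_incr r k (Suc n) y"
proof -
  have "\<forall>y\<in>space M. (SUP n. ennreal (pgf_incr r k n y)) = (weighted_op r ^^ k) (\<lambda>y. ennreal (1 - r y)) y
     \<and> (\<forall>n. 0 \<le> pgf_incr r k n y \<and> pgf_incr r k n y \<le> pgf_incr r k (Suc n) y)"
  proof (induction k)
    case 0
    have "(SUP n. ennreal (pgf_incr r 0 n y)) = ennreal (1 - r y)" if y: "y \<in> space M" for y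
    proof -
      have "(SUP n. ennreal (pgf_incr r 0 n y)) = (SUP n. ennreal (1 - r y) * ennreal (exp_quot n 1))"
        using unit_funD(3)[OF r y] by (simp add: pgf_incr_0 ennreal_mult exp_quot_nonneg)
      also have "\<dots> = ennreal (1 - r y) * (SUP n. ennreal (exp_quot n 1))"
        by (rule SUP_mult_left_ennreal[symmetric])
      also have "(SUP n. ennreal (exp_quot n 1)) = (SUP n::nat. ennreal 1)"
        by (rule SUP_exp_quot[of "\<lambda>_. 1"]) (auto simp: incseq_def)
      finally show ?thesis by simp
    qed
    then show ?case using unit_funD(3)[OF r]
      by (auto simp: pgf_incr_0 intro!: mult_nonneg_nonneg mult_left_mono exp_quot_nonneg exp_quot_Suc)
  next
    case (Suc k)
    then have nn: "0 \<le> pgf_incr r k n y" and mono: "pgf_incr r k n y \<le> pgf_incr r k (Suc n) y"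
      and sup: "(SUP n. ennreal (pgf_incr r k n y)) = (weighted_op r ^^ k) (\<lambda>y. ennreal (1 - r y)) y"
      if "y \<in> space M" for y n using that by auto
    have rec: "pgf_incr r (Suc k) n y = (1 - r y) * exp_quot n (kernel_opr (pgf_incr r k n) y)" if "y \<in> space M" for n y
      by (rule pgf_incr_Suc[OF r fp that nn])
    have Tmono: "kernel_opr (pgf_incr r k n) y \<le> kernel_opr (pgf_incr r k (Suc n)) y" if "y \<in> space M" for n y
      using that by (intro kernel_opr_mono[where B = "2 ^ Suc n"] mono pgf_incr_le r) auto
    show ?case
    proof (intro ballI conjI allI)
      fix y n assume y: "y \<in> space M"
      have r1: "0 \<le> 1 - r y" using unit_funD(3)[OF r y] by simp
      show "0 \<le> pgf_incr r (Suc k) n y"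
        using r1 by (simp add: rec[OF y] exp_quot_nonneg kernel_opr_nonneg)
      show "pgf_incr r (Suc k) n y \<le> pgf_incr r (Suc k) (Suc n) y"
        unfolding rec[OF y] using r1 Tmono[OF y, of n]
        by (intro mult_left_mono) (auto intro: order_trans[OF exp_quot_mono exp_quot_Suc])
      have "(SUP n. ennreal (pgf_incr r (Suc k) n y)) = (SUP n. ennreal (1 - r y) * ennreal (exp_quot n (kernel_opr (pgf_incr r k n) y)))"
        using r1 by (simp add: rec[OF y] ennreal_mult exp_quot_nonneg kernel_opr_nonneg)
      also have "\<dots> = ennreal (1 - r y) * (SUP n. ennreal (exp_quot n (kernel_opr (pgf_incr r k n) y)))"
        by (rule SUP_mult_left_ennreal[symmetric])
      also have "(SUP n. ennreal (exp_quot n (kernel_opr (pgf_incr r k n) y))) = (SUP n. ennreal (kernel_opr (pgf_incr r k n) y))"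
        by (rule SUP_exp_quot) (auto intro: incseq_SucI Tmono[OF y] kernel_opr_nonneg)
      also have "\<dots> = (SUP n. kernel_op M \<kappa> (\<lambda>u. ennreal (pgf_incr r k n u)) y)"
        by (intro SUP_cong refl ennreal_kernel_opr[OF pgf_incr_le[OF r]] y)
      also have "\<dots> = kernel_op M \<kappa> (\<lambda>u. SUP n. ennreal (pgf_incr r k n u)) y"
        using pgf_incr_measurable[OF r] y by (intro kernel_op_SUP[symmetric] ennreal_leI mono) auto
      also have "\<dots> = kernel_op M \<kappa> ((weighted_op r ^^ k) (\<lambda>y. ennreal (1 - r y))) y"
        unfolding kernel_op_def by (intro nn_integral_cong) (simp add: sup)
      finally show "(SUP n. ennreal (pgf_incr r (Suc k) n y)) = (weighted_op r ^^ Suc k) (\<lambda>y. ennreal (1 - r y)) y"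
        by (simp add: weighted_op_def)
    qed
  qed
  then show "(SUP n. ennreal (pgf_incr r k n y)) = (weighted_op r ^^ k) (\<lambda>y. ennreal (1 - r y)) y"
    "0 \<le> pgf_incr r k n y" "pgf_incr r k n y \<le> pgf_incr r k (Suc n) y" using assms(3) by auto
qed

end

section \<open>First moments of the process\<close>

context bp
begin

lemma pgf_prod_thin: "pgf_prod (thin r n) z = pgf_prod r z * exp (- (real (size z) / 2 ^ n))"
proof (induction z)
  case (add y z)
  have "exp (- (real (size (add_mset y z)) / 2 ^ n)) = exp (- (1 / 2 ^ n)) * exp (- (real (size z) / 2 ^ n))"
    by (simp add: add_divide_distrib flip: exp_add)
  then show ?case using add by (simp add: thin_def[of r n y])
qed simp

text \<open>Monotone convergence on both sides: the quotients \<open>exp_quot n\<close> increase to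
  the size inside the expectation, while their expectations are the quotients
  \<open>pgf_incr\<close> of the generating functional. Infinite moments are covered.\<close>

lemma expected_size:
  assumes r: "unit_fun r" and fp: "\<And>y. y \<in> space M \<Longrightarrow> surv_step r y = r y"
  shows "(\<integral>\<^sup>+ \<omega>. of_nat (size (Z k \<omega>)) * ennreal (pgf_prod r (Z k \<omega>)) \<partial>P)
    = (weighted_op r ^^ k) (\<lambda>y. ennreal (1 - r y)) x"
proof -
  note [measurable] = pgf_prod_measurable[OF r] pgf_prod_measurable[OF unit_fun_thin[OF r]]
  have "(\<integral>\<^sup>+ \<omega>. of_nat (size (Z k \<omega>)) * ennreal (pgf_prod r (Z k \<omega>)) \<partial>P)
     = (\<integral>\<^sup>+ \<omega>. (SUP n. ennreal (exp_quot n (size (Z k \<omega>)) * pgf_prod r (Z k \<omega>))) \<partial>P)"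
  proof (intro nn_integral_cong)
    fix \<omega> assume "\<omega> \<in> space P"
    then have z: "0 \<le> pgf_prod r (Z k \<omega>)" using pgf_prod_Z_bounds[OF r] by auto
    have "(SUP n. ennreal (exp_quot n (size (Z k \<omega>)) * pgf_prod r (Z k \<omega>)))
       = (SUP n. ennreal (exp_quot n (size (Z k \<omega>)))) * ennreal (pgf_prod r (Z k \<omega>))"
      using z by (simp add: ennreal_mult exp_quot_nonneg SUP_mult_right_ennreal)
    also have "(SUP n. ennreal (exp_quot n (size (Z k \<omega>)))) = (SUP n::nat. ennreal (size (Z k \<omega>)))"
      by (rule SUP_exp_quot[of "\<lambda>_. real (size (Z k \<omega>))"]) (auto simp: incseq_def)
    finally show "of_nat (size (Z k \<omega>)) * ennreal (pgf_prod r (Z k \<omega>))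
      = (SUP n. ennreal (exp_quot n (size (Z k \<omega>)) * pgf_prod r (Z k \<omega>)))"
      by (simp add: ennreal_of_nat_eq_real_of_nat)
  qed
  also have "\<dots> = (SUP n. \<integral>\<^sup>+ \<omega>. ennreal (exp_quot n (size (Z k \<omega>)) * pgf_prod r (Z k \<omega>)) \<partial>P)"
  proof (rule nn_integral_monotone_convergence_SUP_AE)
    show "AE \<omega> in P. ennreal (exp_quot n (size (Z k \<omega>)) * pgf_prod r (Z k \<omega>))
        \<le> ennreal (exp_quot (Suc n) (size (Z k \<omega>)) * pgf_prod r (Z k \<omega>))" for n
      using pgf_prod_Z_bounds[OF r] by (intro AE_I2 ennreal_leI mult_right_mono exp_quot_Suc) auto
    show "(\<lambda>\<omega>. ennreal (exp_quot n (size (Z k \<omega>)) * pgf_prod r (Z k \<omega>))) \<in> borel_measurable P" for n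
      unfolding exp_quot_def by measurable
  qed
  also have "\<dots> = (SUP n. ennreal (pgf_incr r k n x))"
  proof (intro SUP_cong refl)
    fix n
    let ?I = "\<integral>\<^sup>+ \<omega>. ennreal (exp_quot n (size (Z k \<omega>)) * pgf_prod r (Z k \<omega>)) \<partial>P"
    define t where "t = (surv_step ^^ k) (thin r n) x"
    have t: "0 \<le> t" "t \<le> 1" using unit_funD(2,3)[OF unit_fun_surv_step_funpow[OF unit_fun_thin[OF r]] x] by (auto simp: t_def)
    have rx: "0 \<le> r x" "r x \<le> 1" using unit_funD(2,3)[OF r x] by auto
    \<comment> \<open>Subtraction in \<open>ennreal\<close> is avoided: the finite term belonging to
      \<open>thin\<close> is added to both sides and cancelled at the end.\<close>
    have "?I + 2 ^ n * ennreal (1 - t) = ?I + (\<integral>\<^sup>+ \<omega>. 2 ^ n * ennreal (pgf_prod (thin r n) (Z k \<omega>)) \<partial>P)"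
      by (simp add: nn_integral_cmult pgf[OF unit_fun_thin[OF r]] t_def)
    also have "\<dots> = (\<integral>\<^sup>+ \<omega>. ennreal (exp_quot n (size (Z k \<omega>)) * pgf_prod r (Z k \<omega>)) + 2 ^ n * ennreal (pgf_prod (thin r n) (Z k \<omega>)) \<partial>P)"
      unfolding exp_quot_def by (rule nn_integral_add[symmetric]) auto
    also have "\<dots> = (\<integral>\<^sup>+ \<omega>. 2 ^ n * ennreal (pgf_prod r (Z k \<omega>)) \<partial>P)"
    proof (intro nn_integral_cong)
      fix \<omega> assume "\<omega> \<in> space P"
      then have z: "0 \<le> pgf_prod r (Z k \<omega>)" "0 \<le> pgf_prod (thin r n) (Z k \<omega>)"
        using pgf_prod_Z_bounds[OF r] pgf_prod_Z_bounds[OF unit_fun_thin[OF r]] by auto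
      have "exp_quot n (size (Z k \<omega>)) * pgf_prod r (Z k \<omega>) + 2 ^ n * pgf_prod (thin r n) (Z k \<omega>) = 2 ^ n * pgf_prod r (Z k \<omega>)"
        by (simp add: exp_quot_def pgf_prod_thin algebra_simps)
      moreover have "2 ^ n * ennreal u = ennreal (2 ^ n * u)" if "0 \<le> u" for u
        using that by (simp add: ennreal_mult flip: ennreal_power)
      ultimately show "ennreal (exp_quot n (size (Z k \<omega>)) * pgf_prod r (Z k \<omega>)) + 2 ^ n * ennreal (pgf_prod (thin r n) (Z k \<omega>))
        = 2 ^ n * ennreal (pgf_prod r (Z k \<omega>))"
        using z by (simp add: exp_quot_nonneg flip: ennreal_plus)
    qed
    also have "\<dots> = 2 ^ n * ennreal (1 - r x)"
      by (simp add: nn_integral_cmult pgf[OF r] surv_step_funpow_fixed[OF fp x])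
    also have "\<dots> = ennreal (2 ^ n * (t - r x)) + 2 ^ n * ennreal (1 - t)"
    proof -
      have "2 ^ n * ennreal u = ennreal (2 ^ n * u)" if "0 \<le> u" for u
        using that by (simp add: ennreal_mult flip: ennreal_power)
      moreover have "0 \<le> 2 ^ n * (t - r x)" using pgf_incr_SUP(2)[OF r fp x, of k n] by (simp add: pgf_incr_def t_def)
      moreover have "2 ^ n * (t - r x) + 2 ^ n * (1 - t) = 2 ^ n * (1 - r x)" by (simp add: algebra_simps)
      ultimately show ?thesis using t rx by (simp flip: ennreal_plus)
    qed
    finally have "?I + 2 ^ n * ennreal (1 - t) = ennreal (2 ^ n * (t - r x)) + 2 ^ n * ennreal (1 - t)" .
    then have "?I = ennreal (2 ^ n * (t - r x))"
      by (simp add: add.commute[of _ "2 ^ n * ennreal (1 - t)"] ennreal_add_left_cancel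
        ennreal_mult_eq_top_iff power_eq_top_ennreal)
    then show "?I = ennreal (pgf_incr r k n x)" by (simp add: pgf_incr_def t_def)
  qed
  also have "\<dots> = (weighted_op r ^^ k) (\<lambda>y. ennreal (1 - r y)) x"
    by (rule pgf_incr_SUP(1)[OF r fp x])
  finally show ?thesis .
qed

lemma expected_total_size: "(\<integral>\<^sup>+ \<omega>. total_size Z \<omega> \<partial>P) = neumann_one x"
proof -
  have u: "unit_fun (\<lambda>_. 0)" by (simp add: unit_fun_def)
  have fp: "surv_step (\<lambda>_. 0) y = 0" for y by (simp add: surv_step_def kernel_opr_def kernel_op_def)
  have z: "pgf_prod (\<lambda>_. 0) z = 1" for z by (induction z) auto
  have q: "weighted_op (\<lambda>_. 0) = kernel_op M \<kappa>" by (intro ext) (simp add: weighted_op_def)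
  have "(\<integral>\<^sup>+ \<omega>. total_size Z \<omega> \<partial>P) = (\<Sum>k. \<integral>\<^sup>+ \<omega>. of_nat (size (Z k \<omega>)) \<partial>P)"
    unfolding total_size_def by (rule nn_integral_suminf) measurable
  also have "\<dots> = neumann_one x"
    using expected_size[OF u fp] by (simp add: z q neumann_one_def)
  finally show ?thesis .
qed

text \<open>\<open>extinct_event\<close> compares integrals over events known by generation k, so
  the factor \<open>size (Z k \<omega>)\<close> is first decomposed along the events that fix its
  value.\<close>

lemma expected_extinct_size:
  "(\<integral>\<^sup>+ \<omega>. of_nat (size (Z k \<omega>)) * indicator {\<omega>. total_size Z \<omega> < \<top>} \<omega> \<partial>P)
    = (weighted_op surv ^^ k) (\<lambda>y. ennreal (1 - surv y)) x"
proof -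
  let ?E = "\<lambda>m. {\<omega> \<in> space P. size (Z k \<omega>) = m}"
  have [measurable]: "?E m \<in> sets P" for m by (rule gen_events_sets[OF gen_events_size])
  have [measurable]: "(\<lambda>\<omega>. pgf_prod surv (Z k \<omega>)) \<in> borel_measurable P"
    by (rule pgf_prod_measurable[OF unit_fun_surv])
  have "(\<lambda>\<omega>. (if total_size Z \<omega> < \<top> then 1 else 0) :: ennreal) \<in> borel_measurable P"
    by measurable
  then have [measurable]: "(\<lambda>\<omega>. indicator {\<omega>. total_size Z \<omega> < \<top>} \<omega> :: ennreal) \<in> borel_measurable P"
    by (simp add: indicator_def[of "Collect _", abs_def] of_bool_def)
  have split: "(\<integral>\<^sup>+ \<omega>. of_nat (size (Z k \<omega>)) * F \<omega> \<partial>P) = (\<Sum>m. of_nat m * (\<integral>\<^sup>+ \<omega>\<in>?E m. F \<omega> \<partial>P))"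
    if [measurable]: "F \<in> borel_measurable P" for F :: "'b \<Rightarrow> ennreal"
  proof -
    have "(\<integral>\<^sup>+ \<omega>. of_nat (size (Z k \<omega>)) * F \<omega> \<partial>P) = (\<integral>\<^sup>+ \<omega>. (\<Sum>m. of_nat m * (F \<omega> * indicator (?E m) \<omega>)) \<partial>P)"
    proof (intro nn_integral_cong)
      fix \<omega> assume "\<omega> \<in> space P"
      then show "of_nat (size (Z k \<omega>)) * F \<omega> = (\<Sum>m. of_nat m * (F \<omega> * indicator (?E m) \<omega>))"
        by (subst suminf_finite[of "{size (Z k \<omega>)}"]) auto
    qed
    also have "\<dots> = (\<Sum>m. of_nat m * (\<integral>\<^sup>+ \<omega>\<in>?E m. F \<omega> \<partial>P))"
      by (subst nn_integral_suminf) (auto simp: nn_integral_cmult)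
    finally show ?thesis .
  qed
  have "(\<integral>\<^sup>+ \<omega>. of_nat (size (Z k \<omega>)) * indicator {\<omega>. total_size Z \<omega> < \<top>} \<omega> \<partial>P)
      = (\<integral>\<^sup>+ \<omega>. of_nat (size (Z k \<omega>)) * ennreal (pgf_prod surv (Z k \<omega>)) \<partial>P)"
    by (simp add: split extinct_event[OF gen_events_size])
  also have "\<dots> = (weighted_op surv ^^ k) (\<lambda>y. ennreal (1 - surv y)) x"
    by (rule expected_size[OF unit_fun_surv surv_fixpoint])
  finally show ?thesis .
qed

lemma expected_total_size_extinct:
  "(\<integral>\<^sup>+ \<omega>. total_size Z \<omega> * indicator {\<omega>. total_size Z \<omega> < \<top>} \<omega> \<partial>P)
    = (\<Sum>k. (weighted_op surv ^^ k) (\<lambda>y. ennreal (1 - surv y)) x)"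
proof -
  have "(\<lambda>\<omega>. (if total_size Z \<omega> < \<top> then 1 else 0) :: ennreal) \<in> borel_measurable P"
    by measurable
  then have [measurable]: "(\<lambda>\<omega>. indicator {\<omega>. total_size Z \<omega> < \<top>} \<omega> :: ennreal) \<in> borel_measurable P"
    by (simp add: indicator_def[of "Collect _", abs_def] of_bool_def)
  have "(\<integral>\<^sup>+ \<omega>. total_size Z \<omega> * indicator {\<omega>. total_size Z \<omega> < \<top>} \<omega> \<partial>P)
     = (\<integral>\<^sup>+ \<omega>. (\<Sum>k. of_nat (size (Z k \<omega>)) * indicator {\<omega>. total_size Z \<omega> < \<top>} \<omega>) \<partial>P)"
    by (intro nn_integral_cong) (simp only: total_size_def[of Z] ennreal_suminf_multc)
  also have "\<dots> = (\<Sum>k. \<integral>\<^sup>+ \<omega>. of_nat (size (Z k \<omega>)) * indicator {\<omega>. total_size Z \<omega> < \<top>} \<omega> \<partial>P)"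
    by (rule nn_integral_suminf) measurable
  finally show ?thesis by (simp add: expected_extinct_size)
qed

end

subsection \<open>Survival of supercritical processes\<close>

locale sym_kernel = kernel_rows M \<kappa> + prob_space M for M :: "'a measure" and \<kappa> +
  assumes sym: "\<And>x y. x \<in> space M \<Longrightarrow> y \<in> space M \<Longrightarrow> \<kappa> x y = \<kappa> y x"
begin

lemma kernel_op_symmetric:
  assumes [measurable]: "F \<in> borel_measurable M" "G \<in> borel_measurable M"
  shows "(\<integral>\<^sup>+ x. F x * kernel_op M \<kappa> G x \<partial>M) = (\<integral>\<^sup>+ x. kernel_op M \<kappa> F x * G x \<partial>M)"
proof -
  interpret pair_sigma_finite M M ..
  have [measurable]: "(\<lambda>y. \<kappa> x y) \<in> borel_measurable M" if "x \<in> space M" for x using that by measurable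
  have "(\<integral>\<^sup>+ x. F x * kernel_op M \<kappa> G x \<partial>M) = (\<integral>\<^sup>+ x. \<integral>\<^sup>+ y. F x * (ennreal (\<kappa> x y) * G y) \<partial>M \<partial>M)"
    unfolding kernel_op_def by (intro nn_integral_cong nn_integral_cmult[symmetric]) auto
  also have "\<dots> = (\<integral>\<^sup>+ y. \<integral>\<^sup>+ x. F x * (ennreal (\<kappa> x y) * G y) \<partial>M \<partial>M)"
    by (rule Fubini'[symmetric]) measurable
  also have "\<dots> = (\<integral>\<^sup>+ y. \<integral>\<^sup>+ x. ennreal (\<kappa> y x) * F x * G y \<partial>M \<partial>M)"
    by (intro nn_integral_cong) (simp add: sym mult_ac)
  also have "\<dots> = (\<integral>\<^sup>+ y. kernel_op M \<kappa> F y * G y \<partial>M)"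
    unfolding kernel_op_def by (intro nn_integral_cong nn_integral_multc) auto
  finally show ?thesis .
qed

text \<open>Symmetry moves one T across: |T^(k+1) F|^2 is the inner product of T^k F and T^(k+2) F.
  Cauchy-Schwarz finishes.\<close>

lemma L2_sq_kernel_op_power_convex:
  assumes [measurable]: "F \<in> borel_measurable M"
  shows "(L2_sq M ((kernel_op M \<kappa> ^^ Suc k) F))\<^sup>2 \<le> L2_sq M ((kernel_op M \<kappa> ^^ k) F) * L2_sq M ((kernel_op M \<kappa> ^^ Suc (Suc k)) F)"
proof -
  let ?G = "\<lambda>k. (kernel_op M \<kappa> ^^ k) F"
  have "L2_sq M (?G (Suc k)) = (\<integral>\<^sup>+ x. ?G k x * ?G (Suc (Suc k)) x \<partial>M)"
    using kernel_op_symmetric[of "?G k" "?G (Suc k)"] by (simp add: L2_sq_def power2_eq_square)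
  then show ?thesis
    using Cauchy_Schwarz_nn_integral[of "?G k" M "?G (Suc (Suc k))"] by (simp add: L2_sq_def)
qed

end

text \<open>Boundedness makes T map L^1 to bounded functions. Iterates of bounded functions then
  have finite norms, and a small mean of the survival iterates makes the next exponent uniformly
  small.\<close>

locale bounded_sym_kernel = sym_kernel +
  fixes B :: real
  assumes B: "0 < B" and bounded: "\<And>x y. x \<in> space M \<Longrightarrow> y \<in> space M \<Longrightarrow> \<kappa> x y \<le> B"
begin

lemma kernel_op_le_integral:
  assumes x: "x \<in> space M" and [measurable]: "F \<in> borel_measurable M"
  shows "kernel_op M \<kappa> F x \<le> ennreal B * (\<integral>\<^sup>+ y. F y \<partial>M)"
proof -
  have "kernel_op M \<kappa> F x \<le> (\<integral>\<^sup>+ y. ennreal B * F y \<partial>M)"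
    unfolding kernel_op_def using bounded[OF x] by (intro nn_integral_mono mult_right_mono ennreal_leI) auto
  then show ?thesis by (simp add: nn_integral_cmult)
qed

lemma kernel_op_funpow_bounded:
  assumes [measurable]: "F \<in> borel_measurable M" and F: "\<And>y. y \<in> space M \<Longrightarrow> F y \<le> ennreal C"
    and "x \<in> space M" and C: "0 \<le> C"
  shows "(kernel_op M \<kappa> ^^ k) F x \<le> ennreal (B ^ k * C)"
  using \<open>x \<in> space M\<close>
proof (induction k arbitrary: x)
  case 0
  then show ?case using F by simp
next
  case (Suc k)
  have "(kernel_op M \<kappa> ^^ Suc k) F x \<le> ennreal B * (\<integral>\<^sup>+ y. (kernel_op M \<kappa> ^^ k) F y \<partial>M)"
    using kernel_op_le_integral[OF Suc.prems, of "(kernel_op M \<kappa> ^^ k) F"] by simp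
  also have "\<dots> \<le> ennreal B * (\<integral>\<^sup>+ y. ennreal (B ^ k * C) \<partial>M)"
    by (intro mult_left_mono nn_integral_mono Suc.IH) auto
  also have "\<dots> = ennreal (B ^ Suc k * C)"
    using B C by (simp add: emeasure_space_1 mult.assoc flip: ennreal_mult)
  finally show ?case .
qed

text \<open>By log-convexity the ratios of consecutive squared norms do not decrease, so the first
  ratio, which exceeds 1, bounds all later ones from below.\<close>

lemma L2_sq_growth:
  assumes [measurable]: "F \<in> borel_measurable M" and F: "\<And>y. y \<in> space M \<Longrightarrow> F y \<le> ennreal C"
    and C: "0 \<le> C" and gt: "L2_sq M F < L2_sq M (kernel_op M \<kappa> F)"
  obtains r c where "1 < r" "0 < c" "\<And>k. ennreal (c * r ^ k) \<le> L2_sq M ((kernel_op M \<kappa> ^^ k) F)"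
proof -
  define U where "U k = enn2real (L2_sq M ((kernel_op M \<kappa> ^^ k) F))" for k
  have fin: "L2_sq M ((kernel_op M \<kappa> ^^ k) F) < \<top>" for k
  proof -
    have "L2_sq M ((kernel_op M \<kappa> ^^ k) F) \<le> (\<integral>\<^sup>+ y. (ennreal (B ^ k * C))\<^sup>2 \<partial>M)"
      unfolding L2_sq_def using F C by (intro nn_integral_mono power_mono kernel_op_funpow_bounded) auto
    also have "\<dots> < \<top>" by (simp add: emeasure_space_1 power_less_top_ennreal)
    finally show ?thesis .
  qed
  then have U: "L2_sq M ((kernel_op M \<kappa> ^^ k) F) = ennreal (U k)" for k by (simp add: U_def)
  have U0: "0 \<le> U k" for k by (simp add: U_def)
  have convex: "(U (Suc k))\<^sup>2 \<le> U k * U (Suc (Suc k))" for k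
  proof -
    have "ennreal ((U (Suc k))\<^sup>2) \<le> ennreal (U k * U (Suc (Suc k)))"
      using L2_sq_kernel_op_power_convex[of F k] unfolding U by (simp add: U0 ennreal_power ennreal_mult)
    then show ?thesis by (simp add: U0)
  qed
  have "U 0 < U 1"
    using gt U[of 0] U[of 1] U0[of 0] by (simp add: ennreal_less_iff)
  have pos: "0 < U 0"
  proof (rule ccontr)
    assume "\<not> 0 < U 0"
    then have "L2_sq M F = 0" using U[of 0] U0[of 0] by simp
    then have "AE x in M. F x = 0" unfolding L2_sq_def by (subst (asm) nn_integral_0_iff_AE) auto
    then have "kernel_op M \<kappa> F x = 0" for x using kernel_op_cong_AE[of F "\<lambda>_. 0" x] by (simp add: kernel_op_def)
    then show False using gt by (simp add: L2_sq_def)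
  qed
  define r where "r = U 1 / U 0"
  have r: "1 < r" using \<open>U 0 < U 1\<close> pos by (simp add: r_def)
  have step: "0 < U k \<and> r * U k \<le> U (Suc k)" for k
  proof (induction k)
    case 0
    then show ?case using pos by (simp add: r_def)
  next
    case (Suc k)
    have "U k \<le> r * U k" using r Suc by simp
    with Suc have p: "0 < U (Suc k)" by linarith
    have "r * (U (Suc k) * U (Suc k)) \<le> r * (U k * U (Suc (Suc k)))"
      using convex[of k] r by (simp add: power2_eq_square)
    also have "\<dots> = r * U k * U (Suc (Suc k))" by simp
    also have "\<dots> \<le> U (Suc k) * U (Suc (Suc k))" using Suc U0 by (intro mult_right_mono) auto
    finally have "U (Suc k) * (r * U (Suc k)) \<le> U (Suc k) * U (Suc (Suc k))" by (simp add: mult_ac)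
    then show ?case using p by simp
  qed
  have "U 0 * r ^ k \<le> U k" for k
  proof (induction k)
    case (Suc k)
    have "U 0 * r ^ Suc k = r * (U 0 * r ^ k)" by simp
    also have "\<dots> \<le> r * U k" using Suc r by (intro mult_left_mono) auto
    also have "\<dots> \<le> U (Suc k)" using step by simp
    finally show ?case .
  qed simp
  then show ?thesis using that[of r "U 0"] r pos by (simp add: U ennreal_leI)
qed

lemma kernel_op_funpow_cmult:
  assumes [measurable]: "F \<in> borel_measurable M" and "x \<in> space M"
  shows "kernel_op M \<kappa> (\<lambda>y. c * (kernel_op M \<kappa> ^^ k) F y) x = c * (kernel_op M \<kappa> ^^ Suc k) F x"
  using kernel_op_cmult[of "(kernel_op M \<kappa> ^^ k) F" x c] assms by simp

text \<open>If the iterates \<open>R n\<close> tended to 0, their means would too, and from some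
  \<open>n0\<close> on one step would lose at most a factor \<open>\<theta>\<close> against T,
  uniformly in the point. Then \<open>R (n0 + m)\<close> dominates a multiple of \<theta>^m T^(n0 +
  m) F, whose squared norm stays away from 0.\<close>

lemma not_extinct:
  assumes F [measurable]: "F \<in> borel_measurable M" and F_le: "\<And>y. y \<in> space M \<Longrightarrow> F y \<le> ennreal C"
    and C: "0 < C" and gt: "L2_sq M F < L2_sq M (kernel_op M \<kappa> F)"
  shows "\<not> (AE y in M. (\<lambda>n. (surv_step ^^ n) (\<lambda>_. 1) y) \<longlonglongrightarrow> 0)"
proof
  assume lim: "AE y in M. (\<lambda>n. (surv_step ^^ n) (\<lambda>_. 1) y) \<longlonglongrightarrow> 0"
  define R where "R n = (surv_step ^^ n) (\<lambda>_. 1)" for n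
  have R_Suc: "R (Suc n) = surv_step (R n)" for n by (simp add: R_def)
  have u: "unit_fun (R n)" for n unfolding R_def by (rule unit_fun_surv_step_funpow[OF unit_fun_1])
  have [measurable]: "R n \<in> borel_measurable M" for n using u by auto
  have R01: "0 \<le> R n y" "R n y \<le> 1" if "y \<in> space M" for n y using u that by auto
  obtain r c where rc: "1 < r" "0 < c" "\<And>k. ennreal (c * r ^ k) \<le> L2_sq M ((kernel_op M \<kappa> ^^ k) F)"
    by (rule L2_sq_growth[OF F F_le less_imp_le[OF C] gt]) auto
  \<comment> \<open>The loss \<theta>^2 per step in the squared norm exactly balances the growth
    \<open>r\<close>.\<close>
  define \<theta> where "\<theta> = sqrt (1 / r)"
  have \<theta>: "0 < \<theta>" "\<theta> < 1" "\<theta>\<^sup>2 * r = 1" using rc(1) by (auto simp: \<theta>_def)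
  define I where "I n = enn2real (\<integral>\<^sup>+ y. ennreal (R n y) \<partial>M)" for n
  have int_le: "(\<integral>\<^sup>+ y. ennreal (R n y) \<partial>M) \<le> 1" for n
  proof -
    have "(\<integral>\<^sup>+ y. ennreal (R n y) \<partial>M) \<le> (\<integral>\<^sup>+ y. 1 \<partial>M)" using R01 by (intro nn_integral_mono) auto
    then show ?thesis by (simp add: emeasure_space_1)
  qed
  then have I: "(\<integral>\<^sup>+ y. ennreal (R n y) \<partial>M) = ennreal (I n)" "I n \<le> 1" "0 \<le> I n" for n
  proof -
    show "(\<integral>\<^sup>+ y. ennreal (R n y) \<partial>M) = ennreal (I n)"
      using le_less_trans[OF int_le[of n]] by (simp add: I_def)
    then show "I n \<le> 1" using int_le[of n] by simp
  qed (simp add: I_def)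
  have kernel_opr_le: "kernel_opr (R n) x \<le> B * I n" if x: "x \<in> space M" for n x
  proof -
    have "ennreal (kernel_opr (R n) x) = kernel_op M \<kappa> (\<lambda>y. ennreal (R n y)) x"
      by (rule ennreal_kernel_opr[OF R01(2) x])
    also have "\<dots> \<le> ennreal (B * I n)"
      using kernel_op_le_integral[OF x, of "\<lambda>y. ennreal (R n y)"] B by (simp add: I ennreal_mult)
    finally show ?thesis using B I by simp
  qed
  have lower: "ennreal a * kernel_op M \<kappa> (\<lambda>y. ennreal (R n y)) x \<le> ennreal (R (Suc n) x)"
    if x: "x \<in> space M" and a: "0 \<le> a" and le: "a * kernel_opr (R n) x \<le> 1 - exp (- kernel_opr (R n) x)" for a n x
  proof -
    have "ennreal a * kernel_op M \<kappa> (\<lambda>y. ennreal (R n y)) x = ennreal (a * kernel_opr (R n) x)"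
      using ennreal_kernel_opr[where s = "R n", OF R01(2) x] a by (simp add: ennreal_mult kernel_opr_nonneg)
    then show ?thesis using le by (simp add: R_Suc surv_step_def ennreal_leI)
  qed
  \<comment> \<open>A crude loss for the first \<open>n0\<close> steps, where the exponents are only
    known to be at most \<open>B\<close>: 1 - exp (- s) is at least s / (1 + s).\<close>
  define b where "b = 1 / (1 + B)"
  have b: "0 < b" using B by (simp add: b_def)
  have low1: "ennreal b * kernel_op M \<kappa> (\<lambda>y. ennreal (R n y)) x \<le> ennreal (R (Suc n) x)" if x: "x \<in> space M" for n x
  proof (rule lower[OF x])
    let ?s = "kernel_opr (R n) x"
    have s: "0 \<le> ?s" by (rule kernel_opr_nonneg)
    have "B * I n \<le> B * 1" using B I by (intro mult_left_mono) auto
    then have sB: "?s \<le> B" using kernel_opr_le[OF x, of n] by simp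
    have "b * ?s \<le> ?s / (1 + ?s)" using s sB B unfolding b_def by (simp add: frac_le)
    also have "\<dots> = 1 - 1 / (1 + ?s)" using s by (simp add: field_simps)
    also have "\<dots> \<le> 1 - exp (- ?s)"
      using s exp_ge_add_one_self[of ?s] by (simp add: exp_minus inverse_eq_divide frac_le)
    finally show "b * ?s \<le> 1 - exp (- ?s)" .
  qed (use b in simp)
  have low2: "ennreal (b ^ n / C) * (kernel_op M \<kappa> ^^ n) F x \<le> ennreal (R n x)" if "x \<in> space M" for n x
    using that
  proof (induction n arbitrary: x)
    case 0
    have "ennreal (1 / C) * F x \<le> ennreal (1 / C) * ennreal C" by (intro mult_left_mono F_le 0) auto
    also have "\<dots> = 1" using C by (simp flip: ennreal_mult)
    finally show ?case by (simp add: R_def)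
  next
    case (Suc n)
    have "ennreal (b ^ Suc n / C) * (kernel_op M \<kappa> ^^ Suc n) F x = ennreal b * (ennreal (b ^ n / C) * (kernel_op M \<kappa> ^^ Suc n) F x)"
      using b C by (simp add: mult.assoc[symmetric] flip: ennreal_mult)
    also have "\<dots> = ennreal b * kernel_op M \<kappa> (\<lambda>y. ennreal (b ^ n / C) * (kernel_op M \<kappa> ^^ n) F y) x"
      by (simp add: kernel_op_funpow_cmult Suc.prems del: funpow.simps)
    also have "\<dots> \<le> ennreal b * kernel_op M \<kappa> (\<lambda>y. ennreal (R n y)) x"
      by (intro mult_left_mono kernel_op_mono Suc.IH) auto
    also have "\<dots> \<le> ennreal (R (Suc n) x)" by (rule low1[OF Suc.prems])
    finally show ?case .
  qed
  have "(\<lambda>n. \<integral>\<^sup>+ y. ennreal (R n y) \<partial>M) \<longlonglongrightarrow> (\<integral>\<^sup>+ y. 0 \<partial>M)"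
  proof (rule nn_integral_dominated_convergence[where w = "\<lambda>_. 1"])
    show "AE y in M. (\<lambda>n. ennreal (R n y)) \<longlonglongrightarrow> 0"
      using lim by eventually_elim (use tendsto_ennrealI[of _ 0] in \<open>auto simp: R_def\<close>)
  qed (use R01 in \<open>auto simp: emeasure_space_1\<close>)
  then have "(\<lambda>n. ennreal (I n)) \<longlonglongrightarrow> ennreal 0" by (simp add: I)
  from tendsto_enn2real[OF this] have "I \<longlonglongrightarrow> 0" by (simp add: I)
  \<comment> \<open>The exponents are at most B I n, and s - s^2 / 2 is at least \<theta> s as soon
    as s is at most 2 (1 - \<theta>).\<close>
  then have "eventually (\<lambda>n. I n < 2 * (1 - \<theta>) / B) sequentially"
    by (rule order_tendstoD) (use \<theta> B in simp)
  then obtain n0 where n0: "\<And>n. n0 \<le> n \<Longrightarrow> I n < 2 * (1 - \<theta>) / B" by (auto simp: eventually_sequentially)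
  have low3: "ennreal \<theta> * kernel_op M \<kappa> (\<lambda>y. ennreal (R n y)) x \<le> ennreal (R (Suc n) x)"
    if x: "x \<in> space M" and n: "n0 \<le> n" for n x
  proof (rule lower[OF x])
    let ?s = "kernel_opr (R n) x"
    have s: "0 \<le> ?s" by (rule kernel_opr_nonneg)
    have "B * I n \<le> 2 * (1 - \<theta>)" using n0[OF n] B by (simp add: field_simps)
    then have "\<theta> \<le> 1 - ?s / 2" using kernel_opr_le[OF x, of n] by simp
    then have "\<theta> * ?s \<le> (1 - ?s / 2) * ?s" using s by (rule mult_right_mono)
    also have "\<dots> = ?s - ?s\<^sup>2 / 2" by (simp add: algebra_simps power2_eq_square)
    also have "\<dots> \<le> 1 - exp (- ?s)" by (rule one_minus_exp_lower[OF s])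
    finally show "\<theta> * ?s \<le> 1 - exp (- ?s)" .
  qed (use \<theta> in simp)
  define d where "d = b ^ n0 / C"
  have d: "0 < d" using b C by (simp add: d_def)
  have low4: "ennreal (\<theta> ^ m * d) * (kernel_op M \<kappa> ^^ (n0 + m)) F x \<le> ennreal (R (n0 + m) x)" if "x \<in> space M" for m x
    using that
  proof (induction m arbitrary: x)
    case 0
    then show ?case using low2[of x n0] by (simp add: d_def)
  next
    case (Suc m)
    have "ennreal (\<theta> ^ Suc m * d) * (kernel_op M \<kappa> ^^ (n0 + Suc m)) F x
        = ennreal \<theta> * (ennreal (\<theta> ^ m * d) * (kernel_op M \<kappa> ^^ Suc (n0 + m)) F x)"
      using \<theta> d by (simp add: mult.assoc[symmetric] flip: ennreal_mult)
    also have "\<dots> = ennreal \<theta> * kernel_op M \<kappa> (\<lambda>y. ennreal (\<theta> ^ m * d) * (kernel_op M \<kappa> ^^ (n0 + m)) F y) x"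
      by (simp add: kernel_op_funpow_cmult Suc.prems del: funpow.simps)
    also have "\<dots> \<le> ennreal \<theta> * kernel_op M \<kappa> (\<lambda>y. ennreal (R (n0 + m) y)) x"
      by (intro mult_left_mono kernel_op_mono Suc.IH) auto
    also have "\<dots> \<le> ennreal (R (n0 + Suc m) x)" using low3[OF Suc.prems, of "n0 + m"] by simp
    finally show ?case .
  qed
  have large: "ennreal (d\<^sup>2 * c * r ^ n0) \<le> L2_sq M (\<lambda>y. ennreal (R (n0 + m) y))" for m
  proof -
    have "(\<theta>\<^sup>2 * r) ^ m = 1" using \<theta> by simp
    then have "d\<^sup>2 * c * r ^ n0 = (\<theta> ^ m * d)\<^sup>2 * (c * r ^ (n0 + m))"
      by (simp add: power_mult_distrib power_add power_mult[symmetric] mult_ac)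
    then have "ennreal (d\<^sup>2 * c * r ^ n0) = (ennreal (\<theta> ^ m * d))\<^sup>2 * ennreal (c * r ^ (n0 + m))"
      using \<theta> d rc by (simp add: ennreal_power flip: ennreal_mult)
    also have "\<dots> \<le> (ennreal (\<theta> ^ m * d))\<^sup>2 * L2_sq M ((kernel_op M \<kappa> ^^ (n0 + m)) F)"
      by (intro mult_left_mono rc) auto
    also have "\<dots> = L2_sq M (\<lambda>x. ennreal (\<theta> ^ m * d) * (kernel_op M \<kappa> ^^ (n0 + m)) F x)"
      unfolding L2_sq_def power_mult_distrib by (rule nn_integral_cmult[symmetric]) measurable
    also have "\<dots> \<le> L2_sq M (\<lambda>y. ennreal (R (n0 + m) y))"
      unfolding L2_sq_def by (intro nn_integral_mono power_mono low4) auto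
    finally show ?thesis .
  qed
  have "(\<lambda>n. L2_sq M (\<lambda>y. ennreal (R n y))) \<longlonglongrightarrow> (\<integral>\<^sup>+ y. 0 \<partial>M)"
    unfolding L2_sq_def
  proof (rule nn_integral_dominated_convergence[where w = "\<lambda>_. 1"])
    show "AE y in M. (\<lambda>n. (ennreal (R n y))\<^sup>2) \<longlonglongrightarrow> 0"
      using lim AE_space
    proof eventually_elim
      case (elim y)
      have "(\<lambda>n. ennreal ((R n y)\<^sup>2)) \<longlonglongrightarrow> ennreal (0\<^sup>2)"
        using elim by (intro tendsto_ennrealI tendsto_power) (simp add: R_def)
      then show ?case using R01[OF elim(2)] by (simp add: ennreal_power)
    qed
    show "AE y in M. (ennreal (R n y))\<^sup>2 \<le> 1" for n
      using R01 by (intro AE_I2) (auto intro!: power_le_one)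
  qed (auto simp: emeasure_space_1)
  then have "(\<lambda>m. L2_sq M (\<lambda>y. ennreal (R (n0 + m) y))) \<longlonglongrightarrow> 0"
    using LIMSEQ_ignore_initial_segment[of _ 0 n0] by (simp add: add.commute)
  then have "ennreal (d\<^sup>2 * c * r ^ n0) \<le> 0" by (rule LIMSEQ_le_const) (use large in auto)
  moreover have "0 < d\<^sup>2 * c * r ^ n0" using d rc by simp
  ultimately show False by (metis ennreal_eq_0_iff le_zero_eq not_le)
qed

end

section \<open>Truncation of an unbounded kernel\<close>

context sym_kernel
begin

text \<open>Comparison principle by which extinction passes from the kernel to its
  truncations.\<close>

lemma surv_step_kernel_mono:
  assumes K': "kernel_rows M \<kappa>'" and le: "\<And>x y. x \<in> space M \<Longrightarrow> y \<in> space M \<Longrightarrow> \<kappa>' x y \<le> \<kappa> x y"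
    and y: "y \<in> space M"
  shows "(kernel_rows.surv_step M \<kappa>' ^^ n) (\<lambda>_. 1) y \<le> (surv_step ^^ n) (\<lambda>_. 1) y"
  using y
proof (induction n arbitrary: y)
  case (Suc n)
  interpret K': kernel_rows M \<kappa>' by (rule K')
  have u: "unit_fun ((surv_step ^^ n) (\<lambda>_. 1))" by (rule unit_fun_surv_step_funpow[OF unit_fun_1])
  have "kernel_op M \<kappa>' (\<lambda>u. ennreal ((K'.surv_step ^^ n) (\<lambda>_. 1) u)) y \<le> kernel_op M \<kappa> (\<lambda>u. ennreal ((surv_step ^^ n) (\<lambda>_. 1) u)) y"
    unfolding kernel_op_def using Suc le by (intro nn_integral_mono mult_mono ennreal_leI) auto
  then have "K'.kernel_opr ((K'.surv_step ^^ n) (\<lambda>_. 1)) y \<le> kernel_opr ((surv_step ^^ n) (\<lambda>_. 1)) y"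
    unfolding K'.kernel_opr_def kernel_opr_def using kernel_op_bounded_finite[of _ 1 y] u Suc.prems by (intro enn2real_mono) auto
  then show ?case by (simp add: K'.surv_step_def[of "(K'.surv_step ^^ n) _"] surv_step_def[of "(surv_step ^^ n) _"])
qed simp

text \<open>A test function that witnesses norm above 1 and the kernel are cut at the same level n.
  Monotone convergence preserves the strict inequality for some n, while the cut test function still
  has norm at most 1, so \<open>not_extinct\<close> applies to the truncated kernel.\<close>

lemma supercritical_imp_not_extinct:
  assumes norm: "1 < kernel_norm M \<kappa>"
  shows "\<not> (AE y in M. surv y = 0)"
proof
  assume ext: "AE y in M. surv y = 0"
  obtain f where f [measurable]: "f \<in> borel_measurable M" and f0: "\<And>x. x \<in> space M \<Longrightarrow> 0 \<le> f x"
    and f1: "(\<integral>\<^sup>+ x. ennreal ((f x)\<^sup>2) \<partial>M) \<le> 1"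
    and gt: "1 < enn_sqrt (\<integral>\<^sup>+ x. (\<integral>\<^sup>+ y. ennreal (\<kappa> x y * f y) \<partial>M)\<^sup>2 \<partial>M)"
    using norm unfolding kernel_norm_def less_SUP_iff by auto
  have kf: "(\<integral>\<^sup>+ y. ennreal (\<kappa> x y * f y) \<partial>M) = kernel_op M \<kappa> (\<lambda>y. ennreal (f y)) x" if "x \<in> space M" for x
    unfolding kernel_op_def using that kernel_nonneg f0
    by (intro nn_integral_cong) (auto simp: ennreal_mult)
  have gt: "1 < L2_sq M (kernel_op M \<kappa> (\<lambda>y. ennreal (f y)))"
  proof (rule ccontr)
    assume "\<not> ?thesis"
    then have le: "(\<integral>\<^sup>+ x. (\<integral>\<^sup>+ y. ennreal (\<kappa> x y * f y) \<partial>M)\<^sup>2 \<partial>M) \<le> 1"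
      by (simp add: L2_sq_def kf not_less cong: nn_integral_cong)
    then have "enn_sqrt (\<integral>\<^sup>+ x. (\<integral>\<^sup>+ y. ennreal (\<kappa> x y * f y) \<partial>M)\<^sup>2 \<partial>M) \<le> 1"
      using enn2real_mono[OF le] by (auto simp: enn_sqrt_def top_unique)
    then show False using gt by simp
  qed
  let ?k = "\<lambda>n x y. min (\<kappa> x y) (real n)"
  let ?f = "\<lambda>n y. ennreal (min (f y) (real n))"
  have SUPmin: "(SUP n. ennreal (min a (real n))) = ennreal a" if "0 \<le> a" for a
  proof (rule antisym)
    obtain n where "a \<le> real n" using real_arch_simple by blast
    then show "ennreal a \<le> (SUP n. ennreal (min a (real n)))" by (intro SUP_upper2[of n]) auto
  qed (auto intro!: SUP_least ennreal_leI)
  have pw: "kernel_op M \<kappa> (\<lambda>y. ennreal (f y)) x = (SUP n. kernel_op M (?k n) (?f n) x)" if x: "x \<in> space M" for x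
  proof -
    have [measurable]: "(\<lambda>y. \<kappa> x y) \<in> borel_measurable M" using x by measurable
    have inc1: "ennreal (?k n x y) \<le> ennreal (?k (Suc n) x y)" for n y
      by (intro ennreal_leI min.mono) auto
    have inc2: "?f n y \<le> ?f (Suc n) y" for n y by (intro ennreal_leI min.mono) auto
    have "kernel_op M \<kappa> (\<lambda>y. ennreal (f y)) x = (\<integral>\<^sup>+ y. (SUP n. ennreal (?k n x y) * ?f n y) \<partial>M)"
      unfolding kernel_op_def
    proof (intro nn_integral_cong)
      fix y assume y: "y \<in> space M"
      have "(\<lambda>n. ennreal (?k n x y) * ?f n y) \<longlonglongrightarrow> (SUP n. ennreal (?k n x y)) * (SUP n. ?f n y)"
        by (intro tendsto_mult_ennreal LIMSEQ_SUP incseq_SucI inc1 inc2)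
           (use kernel_nonneg[OF x y] f0[OF y] in \<open>auto simp: SUPmin\<close>)
      moreover have "(\<lambda>n. ennreal (?k n x y) * ?f n y) \<longlonglongrightarrow> (SUP n. ennreal (?k n x y) * ?f n y)"
        by (intro LIMSEQ_SUP incseq_SucI mult_mono inc1 inc2) auto
      ultimately show "ennreal (\<kappa> x y) * ennreal (f y) = (SUP n. ennreal (?k n x y) * ?f n y)"
        using kernel_nonneg[OF x y] f0[OF y] by (auto simp: SUPmin intro: LIMSEQ_unique)
    qed
    also have "\<dots> = (SUP n. kernel_op M (?k n) (?f n) x)"
      unfolding kernel_op_def
      by (intro nn_integral_monotone_convergence_SUP_AE AE_I2 mult_mono inc1 inc2) auto
    finally show ?thesis .
  qed
  have incK: "kernel_op M (?k n) (?f n) x \<le> kernel_op M (?k (Suc n)) (?f (Suc n)) x" for n x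
    unfolding kernel_op_def by (intro nn_integral_mono mult_mono ennreal_leI min.mono) auto
  have K': "kernel_rows M (?k n)" for n
  proof
    show "(\<lambda>(x, y). ?k n x y) \<in> borel_measurable (M \<Otimes>\<^sub>M M)" by measurable
    show "0 \<le> ?k n x y" if "x \<in> space M" "y \<in> space M" for x y using kernel_nonneg[OF that] by simp
    show "kernel_op M (?k n) (\<lambda>_. 1) x < \<top>" if "x \<in> space M" for x
    proof -
      have "kernel_op M (?k n) (\<lambda>_. 1) x \<le> kernel_op M \<kappa> (\<lambda>_. 1) x"
        unfolding kernel_op_def by (intro nn_integral_mono mult_right_mono ennreal_leI) auto
      then show ?thesis using rows[OF that] by simp
    qed
  qed
  have meas [measurable]: "kernel_op M (?k n) (?f n) \<in> borel_measurable M" for n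
    by (rule kernel_space.kernel_op_measurable[OF kernel_rows.axioms(1)[OF K']]) measurable
  have "L2_sq M (kernel_op M \<kappa> (\<lambda>y. ennreal (f y))) = (\<integral>\<^sup>+ x. (SUP n. (kernel_op M (?k n) (?f n) x)\<^sup>2) \<partial>M)"
    unfolding L2_sq_def
  proof (intro nn_integral_cong)
    fix x assume x: "x \<in> space M"
    \<comment> \<open>Side condition for the limit of a product: in a square the form 0 times
      infinity cannot occur.\<close>
    have "\<not> ((a = 0 \<and> a = \<infinity>) \<or> (a = \<infinity> \<and> a = 0))" for a :: ennreal by auto
    then have "(\<lambda>n. kernel_op M (?k n) (?f n) x * kernel_op M (?k n) (?f n) x) \<longlonglongrightarrow>
        (SUP n. kernel_op M (?k n) (?f n) x) * (SUP n. kernel_op M (?k n) (?f n) x)"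
      by (intro tendsto_mult_ennreal LIMSEQ_SUP incseq_SucI incK)
    moreover have "(\<lambda>n. (kernel_op M (?k n) (?f n) x)\<^sup>2) \<longlonglongrightarrow> (SUP n. (kernel_op M (?k n) (?f n) x)\<^sup>2)"
      by (intro LIMSEQ_SUP incseq_SucI power_mono incK) auto
    ultimately show "(kernel_op M \<kappa> (\<lambda>y. ennreal (f y)) x)\<^sup>2 = (SUP n. (kernel_op M (?k n) (?f n) x)\<^sup>2)"
      unfolding pw[OF x] power2_eq_square by (rule LIMSEQ_unique)
  qed
  also have "\<dots> = (SUP n. L2_sq M (kernel_op M (?k n) (?f n)))"
    unfolding L2_sq_def by (intro nn_integral_monotone_convergence_SUP_AE AE_I2 power_mono incK) auto
  finally have "1 < (SUP n. L2_sq M (kernel_op M (?k n) (?f n)))" using gt by simp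
  then obtain n where n: "1 < L2_sq M (kernel_op M (?k n) (?f n))" by (auto simp: less_SUP_iff)
  \<comment> \<open>A bounded kernel comes with a positive bound; at level 0 the truncated kernel
    would vanish.\<close>
  have "n \<noteq> 0"
  proof
    assume "n = 0"
    have "kernel_op M (?k n) (?f n) x = 0" if "x \<in> space M" for x
      unfolding kernel_op_def using that kernel_nonneg[OF that] by (simp add: \<open>n = 0\<close> cong: nn_integral_cong)
    then show False using n by (simp add: L2_sq_def cong: nn_integral_cong)
  qed
  interpret K': kernel_rows M "?k n" by (rule K')
  interpret K': bounded_sym_kernel M "?k n" "real n"
    by unfold_locales (use \<open>n \<noteq> 0\<close> in \<open>auto simp: sym\<close>)
  have "L2_sq M (?f n) \<le> 1"
  proof -
    have "L2_sq M (?f n) \<le> (\<integral>\<^sup>+ x. ennreal ((f x)\<^sup>2) \<partial>M)"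
      unfolding L2_sq_def using f0 by (intro nn_integral_mono) (auto simp: ennreal_power intro!: ennreal_leI power_mono)
    then show ?thesis using f1 by simp
  qed
  then have "\<not> (AE y in M. (\<lambda>m. (K'.surv_step ^^ m) (\<lambda>_. 1) y) \<longlonglongrightarrow> 0)"
    using n \<open>n \<noteq> 0\<close> by (intro K'.not_extinct[of "?f n" "real n"]) (auto intro: ennreal_leI)
  moreover have "AE y in M. (\<lambda>m. (K'.surv_step ^^ m) (\<lambda>_. 1) y) \<longlonglongrightarrow> 0"
    using ext AE_space
  proof eventually_elim
    case (elim y)
    have "(\<lambda>m. (surv_step ^^ m) (\<lambda>_. 1) y) \<longlonglongrightarrow> 0" using surv_LIMSEQ[OF elim(2)] elim(1) by simp
    then show ?case
      by (rule real_tendsto_sandwich[OF _ _ tendsto_const, rotated -1])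
         (use K'.unit_funD(2)[OF K'.unit_fun_surv_step_funpow[OF K'.unit_fun_1] elim(2)]
           surv_step_kernel_mono[OF K' _ elim(2)] in auto)
  qed
  ultimately show False by contradiction
qed

end

subsection \<open>The dual kernel\<close>

context kernel_rows
begin

lemma surv_less_1: "y \<in> space M \<Longrightarrow> surv y < 1"
  using surv_step_bounds(2)[of surv y] by (simp add: surv_fixpoint)

lemma surv_nonneg: "y \<in> space M \<Longrightarrow> 0 \<le> surv y"
  using unit_funD(2)[OF unit_fun_surv] .

lemma surv_measurable [measurable]: "surv \<in> borel_measurable M"
  using unit_fun_surv by auto

lemma exp_kernel_opr_surv: "y \<in> space M \<Longrightarrow> exp (- kernel_opr surv y) = 1 - surv y"
  using surv_fixpoint[of y] by (simp add: surv_step_def)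

text \<open>\<open>mu_hat\<close> with \<open>surv\<close> in place of \<open>rho_BP\<close>, so
  that the dual operator can be studied without a realisation of the process.\<close>

definition mu_dual :: "'a measure" where
  "mu_dual = density M (\<lambda>y. ennreal (1 - surv y))"

lemma sets_mu_dual [measurable_cong, simp]: "sets mu_dual = sets M"
  by (simp add: mu_dual_def)

lemma space_mu_dual [simp]: "space mu_dual = space M"
  by (simp add: mu_dual_def)

lemma nn_integral_mu_dual:
  assumes "F \<in> borel_measurable M"
  shows "(\<integral>\<^sup>+ y. F y \<partial>mu_dual) = (\<integral>\<^sup>+ y. ennreal (1 - surv y) * F y \<partial>M)"
  unfolding mu_dual_def using assms by (intro nn_integral_density) measurable

lemma finite_measure_mu_dual: "finite_measure mu_dual"
proof (rule finite_measureI)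
  have "emeasure mu_dual (space mu_dual) = (\<integral>\<^sup>+ y. ennreal (1 - surv y) \<partial>M)"
    using nn_integral_mu_dual[of "\<lambda>_. 1"] by simp
  also have "\<dots> \<le> (\<integral>\<^sup>+ y. 1 \<partial>M)"
    using surv_nonneg by (intro nn_integral_mono) simp
  finally show "emeasure mu_dual (space mu_dual) \<noteq> \<infinity>"
    using finite_emeasure_space by (auto simp: top_unique)
qed

sublocale hat: kernel_space mu_dual \<kappa>
proof (intro kernel_space.intro kernel_space_axioms.intro finite_measure_mu_dual)
  have "sets (mu_dual \<Otimes>\<^sub>M mu_dual) = sets (M \<Otimes>\<^sub>M M)" by (intro sets_pair_measure_cong) auto
  then show "(\<lambda>(x, y). \<kappa> x y) \<in> borel_measurable (mu_dual \<Otimes>\<^sub>M mu_dual)"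
    using kernel_measurable by (simp cong: measurable_cong_sets)
qed (auto intro: kernel_nonneg)

lemma kernel_op_mu_dual:
  assumes "F \<in> borel_measurable M" "x \<in> space M"
  shows "kernel_op mu_dual \<kappa> F x = kernel_op M \<kappa> (\<lambda>y. ennreal (1 - surv y) * F y) x"
proof -
  have [measurable]: "(\<lambda>y. \<kappa> x y) \<in> borel_measurable M" using assms(2) by measurable
  show ?thesis unfolding kernel_op_def using assms(1)
    by (subst nn_integral_mu_dual) (auto simp: mult_ac)
qed

text \<open>Conjugation by q = 1 - surv: q T q T ... q regroups as q followed by powers of T q, and
  T q is the operator of the dual measure.\<close>

lemma weighted_op_funpow:
  assumes "y \<in> space M"
  shows "(weighted_op surv ^^ k) (\<lambda>y. ennreal (1 - surv y)) y = ennreal (1 - surv y) * (kernel_op mu_dual \<kappa> ^^ k) (\<lambda>_. 1) y"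
  using assms
proof (induction k arbitrary: y)
  case (Suc k)
  have [measurable]: "(kernel_op mu_dual \<kappa> ^^ k) (\<lambda>_. 1) \<in> borel_measurable M"
    using hat.kernel_op_funpow_measurable[of "\<lambda>_. 1" k] by (simp cong: measurable_cong_sets)
  have "kernel_op M \<kappa> ((weighted_op surv ^^ k) (\<lambda>y. ennreal (1 - surv y))) y
      = kernel_op M \<kappa> (\<lambda>y. ennreal (1 - surv y) * (kernel_op mu_dual \<kappa> ^^ k) (\<lambda>_. 1) y) y"
    by (rule kernel_op_cong_AE) (auto simp: Suc.IH)
  also have "\<dots> = kernel_op mu_dual \<kappa> ((kernel_op mu_dual \<kappa> ^^ k) (\<lambda>_. 1)) y"
    by (rule kernel_op_mu_dual[symmetric]) (use Suc.prems in auto)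
  finally show ?case by (simp add: weighted_op_def[of _ "(weighted_op surv ^^ k) _"])
qed simp

lemma suminf_weighted_op:
  assumes "y \<in> space M"
  shows "(\<Sum>k. (weighted_op surv ^^ k) (\<lambda>y. ennreal (1 - surv y)) y) = ennreal (1 - surv y) * hat.neumann_one y"
  unfolding weighted_op_funpow[OF assms] hat.neumann_one_def by (rule ennreal_suminf_cmult)

end

section \<open>Contraction of the dual operator\<close>

context sym_kernel
begin

text \<open>Where \<open>surv\<close> vanishes, its fixed-point equation forces T surv = 0, so there
  is no kernel mass from such points to \<open>A\<close>. By irreducibility \<open>A\<close> is null
  or of full measure in \<open>S'\<close>. It is not null, since off \<open>S'\<close> the kernel
  and hence \<open>surv\<close> vanish, and \<open>surv\<close> would be 0 almost
  everywhere.\<close>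

lemma survival_pos:
  assumes S: "S' \<in> sets M" and irr: "irreducible_kernel (restrict_space M S') \<kappa>"
    and zero: "\<And>x y. x \<in> space M \<Longrightarrow> y \<in> space M \<Longrightarrow> x \<notin> S' \<or> y \<notin> S' \<Longrightarrow> \<kappa> x y = 0"
    and norm: "1 < kernel_norm M \<kappa>"
  shows "AE y in M. y \<in> S' \<longrightarrow> 0 < surv y"
proof -
  define N where "N = restrict_space M S'"
  have spN: "space N = S'" using sets.sets_into_space[OF S] by (auto simp: N_def space_restrict_space)
  have inM: "y \<in> space M" if "y \<in> S'" for y using sets.sets_into_space[OF S] that by auto
  interpret N: finite_measure N
    unfolding N_def by (rule finite_measure_restrict_space[OF _ S]) unfold_locales
  interpret pair_sigma_finite N N ..
  have id [measurable]: "(\<lambda>x. x) \<in> measurable N M" unfolding N_def by (rule measurable_restrict_space1) simp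
  define A where "A = {y \<in> S'. 0 < surv y}"
  have "{y \<in> space N. 0 < surv y} \<in> sets N" by measurable
  then have A [measurable]: "A \<in> sets N" by (simp add: A_def spN)
  have kN [measurable]: "(\<lambda>p. \<kappa> (fst p) (snd p)) \<in> borel_measurable (N \<Otimes>\<^sub>M N)"
    by (rule kernel_comp_measurable) (rule measurable_compose[OF _ id], measurable)
  have AEk: "AE x in N. x \<in> A \<longrightarrow> \<kappa> x y = 0" if y: "y \<in> S'" "y \<notin> A" for y
  proof -
    have sM: "surv y = 0" using y surv_nonneg[OF inM] by (force simp: A_def)
    have [measurable]: "(\<lambda>u. \<kappa> y u) \<in> borel_measurable M" using inM[OF y(1)] by measurable
    have "ennreal (kernel_opr surv y) = kernel_op M \<kappa> (\<lambda>y. ennreal (surv y)) y"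
      using surv_less_1 by (intro ennreal_kernel_opr[where B = 1] inM y less_imp_le)
    moreover have "kernel_opr surv y = 0" using exp_kernel_opr_surv[OF inM[OF y(1)]] sM by simp
    ultimately have "(\<integral>\<^sup>+ u. ennreal (\<kappa> y u) * ennreal (surv u) \<partial>M) = 0" by (simp add: kernel_op_def)
    then have "AE u in M. ennreal (\<kappa> y u) * ennreal (surv u) = 0"
      by (subst (asm) nn_integral_0_iff_AE) auto
    then have "AE u in N. ennreal (\<kappa> y u) * ennreal (surv u) = 0"
      unfolding N_def using S inM by (subst AE_restrict_space_iff) auto
    then show ?thesis using AE_space
    proof eventually_elim
      case (elim u)
      then have "\<kappa> y u \<le> 0 \<or> surv u \<le> 0" by (auto simp: ennreal_eq_0_iff)
      then show ?case using kernel_nonneg[of y u] sym[of y u] elim(2) y inM by (auto simp: A_def spN)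
    qed
  qed
  \<comment> \<open>\<open>AEk\<close> fixes the second coordinate outside \<open>A\<close>, whereas
    the product measure is disintegrated along the first; hence the later use of
    \<open>AE_commute\<close>.\<close>
  have "AE y in N. AE x in N. x \<in> A \<and> y \<notin> A \<longrightarrow> \<kappa> x y = 0"
  proof (rule AE_I2)
    fix y assume "y \<in> space N"
    then show "AE x in N. x \<in> A \<and> y \<notin> A \<longrightarrow> \<kappa> x y = 0"
      using AEk[of y] by (cases "y \<in> A") (auto simp: spN)
  qed
  moreover have meas: "{p \<in> space (N \<Otimes>\<^sub>M N). fst p \<in> A \<and> snd p \<notin> A \<longrightarrow> \<kappa> (fst p) (snd p) = 0} \<in> sets (N \<Otimes>\<^sub>M N)"
    by measurable
  ultimately have "AE p in N \<Otimes>\<^sub>M N. fst p \<in> A \<and> snd p \<notin> A \<longrightarrow> \<kappa> (fst p) (snd p) = 0"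
    using AE_commute[of "\<lambda>x y. x \<in> A \<and> y \<notin> A \<longrightarrow> \<kappa> x y = 0"]
      AE_pair_iff[of "\<lambda>x y. x \<in> A \<and> y \<notin> A \<longrightarrow> \<kappa> x y = 0"] by simp
  with irr A have "measure N A = 0 \<or> \<not> measure N A < measure N (space N)"
    unfolding irreducible_kernel_def N_def[symmetric] using measure_nonneg[of N A] by (auto simp: less_le)
  moreover have "measure N A \<noteq> 0"
  proof
    assume "measure N A = 0"
    then have "A \<in> null_sets N" by (intro null_setsI A) (simp add: N.emeasure_eq_measure)
    then have "AE y in N. y \<notin> A" by (rule AE_not_in)
    then have "AE y in M. y \<in> S' \<longrightarrow> y \<notin> A"
      unfolding N_def using S inM by (subst (asm) AE_restrict_space_iff) (auto simp: Int_absorb2)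
    then have "AE y in M. surv y = 0"
      using AE_space
    proof eventually_elim
      case (elim y)
      show ?case
      proof (cases "y \<in> S'")
        case True
        then show ?thesis using elim surv_nonneg by (force simp: A_def)
      next
        case False
        then have "kernel_opr surv y = 0" unfolding kernel_opr_def kernel_op_def
          using zero elim by (simp cong: nn_integral_cong)
        then show ?thesis using exp_kernel_opr_surv[OF elim(2)] by simp
      qed
    qed
    then show False using supercritical_imp_not_extinct[OF norm] by simp
  qed
  ultimately have "measure N (space N) \<le> measure N A" by auto
  then have "measure N (space N - A) = 0"
    using N.finite_measure_compl[OF A] measure_nonneg[of N "space N - A"] by linarith
  then have "space N - A \<in> null_sets N" by (intro null_setsI) (auto simp: N.emeasure_eq_measure)
  then have "AE y in N. y \<notin> space N - A" by (rule AE_not_in)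
  then have "AE y in M. y \<in> S' \<longrightarrow> y \<notin> space N - A"
    unfolding N_def using S inM by (subst (asm) AE_restrict_space_iff) (auto simp: Int_absorb2)
  then show ?thesis by eventually_elim (auto simp: spN A_def)
qed

text \<open>With L = T surv one has surv = 1 - exp (- L) and surv at most L. So the left side is at
  most exp (- L) (L + L^2 / 2), which is at most exp (- L) (exp L - 1) = surv.\<close>

lemma dual_contraction_factor:
  assumes "y \<in> space M"
  shows "(1 - surv y) * kernel_opr surv y * (1 + surv y / 2) \<le> surv y"
proof -
  let ?L = "kernel_opr surv y"
  have L: "0 \<le> ?L" by (rule kernel_opr_nonneg)
  have q: "exp (- ?L) = 1 - surv y" by (rule exp_kernel_opr_surv[OF assms])
  have sL: "surv y \<le> ?L" using exp_ge_add_one_self[of "- ?L"] q by simp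
  have q0: "0 \<le> 1 - surv y" using surv_less_1[OF assms] by simp
  have "(1 - surv y) * ?L * (1 + surv y / 2) \<le> (1 - surv y) * ?L * (1 + ?L / 2)"
    using L q0 sL by (intro mult_left_mono) auto
  also have "\<dots> = exp (- ?L) * (?L + ?L\<^sup>2 / 2)"
    by (simp add: q power2_eq_square distrib_left)
  also have "\<dots> \<le> exp (- ?L) * (exp ?L - 1)"
    using exp_lower_Taylor_quadratic[OF L] by (intro mult_left_mono) auto
  also have "\<dots> = surv y"
  proof -
    have "exp (- ?L) * exp ?L = 1" by (simp flip: exp_add)
    then show ?thesis using q by (simp add: right_diff_distrib)
  qed
  finally show ?thesis .
qed

text \<open>The Schur test: Cauchy-Schwarz with the kernel split by the weight \<open>surv\<close>
  produces a factor T surv in x. After it is absorbed, symmetry moves T onto \<open>surv\<close>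
  once more, now in y, where \<open>dual_contraction_factor\<close> applies with its gain.\<close>

lemma hat_L2_sq_le_weighted:
  assumes zero: "\<And>x y. x \<in> space M \<Longrightarrow> y \<in> space M \<Longrightarrow> x \<notin> S' \<or> y \<notin> S' \<Longrightarrow> \<kappa> x y = 0"
    and pos: "AE y in M. y \<in> S' \<longrightarrow> 0 < surv y"
    and f [measurable]: "f \<in> borel_measurable M" and f0: "\<And>y. y \<in> space M \<Longrightarrow> 0 \<le> f y"
  shows "(\<integral>\<^sup>+ x. (\<integral>\<^sup>+ y. ennreal (\<kappa> x y * f y) \<partial>mu_dual)\<^sup>2 \<partial>mu_dual)
    \<le> (\<integral>\<^sup>+ y. ennreal ((1 - surv y) * (f y)\<^sup>2 / (1 + surv y / 2)) \<partial>M)"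
proof -
  let ?q = "\<lambda>y. 1 - surv y"
  let ?w = "\<lambda>y. (?q y * f y)\<^sup>2 / surv y"
  have q0: "0 \<le> ?q y" if "y \<in> space M" for y using surv_less_1[OF that] by simp
  have inner: "(\<integral>\<^sup>+ y. ennreal (\<kappa> x y * f y) \<partial>mu_dual)\<^sup>2 \<le> ennreal (kernel_opr surv x) * kernel_op M \<kappa> (\<lambda>y. ennreal (?w y)) x"
    if x: "x \<in> space M" for x
  proof -
    have [measurable]: "(\<lambda>y. \<kappa> x y) \<in> borel_measurable M" using x by measurable
    have "(\<integral>\<^sup>+ y. ennreal (\<kappa> x y * f y) \<partial>mu_dual) = (\<integral>\<^sup>+ y. ennreal (?q y) * ennreal (\<kappa> x y * f y) \<partial>M)"
      by (rule nn_integral_mu_dual) measurable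
    \<comment> \<open>An identity almost everywhere: on \<open>S'\<close> the weight is positive off
      a null set, and outside \<open>S'\<close> the kernel is 0.\<close>
    also have "\<dots> = (\<integral>\<^sup>+ y. ennreal (sqrt (\<kappa> x y * surv y)) * ennreal (sqrt (\<kappa> x y / surv y) * (?q y * f y)) \<partial>M)"
    proof (rule nn_integral_cong_AE)
      show "AE y in M. ennreal (?q y) * ennreal (\<kappa> x y * f y)
          = ennreal (sqrt (\<kappa> x y * surv y)) * ennreal (sqrt (\<kappa> x y / surv y) * (?q y * f y))"
        using pos AE_space
      proof eventually_elim
        case (elim y)
        note k0 = kernel_nonneg[OF x elim(2)] and s0 = surv_nonneg[OF elim(2)]
        have "sqrt (\<kappa> x y * surv y) * sqrt (\<kappa> x y / surv y) = \<kappa> x y"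
        proof (cases "y \<in> S'")
          case True
          then have "(\<kappa> x y * surv y) * (\<kappa> x y / surv y) = \<kappa> x y * \<kappa> x y" using elim by simp
          then show ?thesis using k0 by (simp flip: real_sqrt_mult)
        next
          case False
          then show ?thesis using zero x elim by simp
        qed
        then have "?q y * (\<kappa> x y * f y) = sqrt (\<kappa> x y * surv y) * (sqrt (\<kappa> x y / surv y) * (?q y * f y))"
          by (metis mult.assoc mult.left_commute)
        then show ?case using k0 s0 q0[OF elim(2)] f0[OF elim(2)] by (simp flip: ennreal_mult)
      qed
    qed
    finally have "(\<integral>\<^sup>+ y. ennreal (\<kappa> x y * f y) \<partial>mu_dual)\<^sup>2
      \<le> (\<integral>\<^sup>+ y. (ennreal (sqrt (\<kappa> x y * surv y)))\<^sup>2 \<partial>M) * (\<integral>\<^sup>+ y. (ennreal (sqrt (\<kappa> x y / surv y) * (?q y * f y)))\<^sup>2 \<partial>M)"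
      by (simp only:) (rule Cauchy_Schwarz_nn_integral; measurable)
    also have "(\<integral>\<^sup>+ y. (ennreal (sqrt (\<kappa> x y * surv y)))\<^sup>2 \<partial>M) = kernel_op M \<kappa> (\<lambda>y. ennreal (surv y)) x"
      unfolding kernel_op_def
      by (intro nn_integral_cong)
         (simp add: ennreal_power ennreal_mult kernel_nonneg x surv_nonneg)
    also have "(\<integral>\<^sup>+ y. (ennreal (sqrt (\<kappa> x y / surv y) * (?q y * f y)))\<^sup>2 \<partial>M) = kernel_op M \<kappa> (\<lambda>y. ennreal (?w y)) x"
      unfolding kernel_op_def
    proof (intro nn_integral_cong)
      fix y assume y: "y \<in> space M"
      have "(sqrt (\<kappa> x y / surv y) * (?q y * f y))\<^sup>2 = \<kappa> x y * ?w y"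
        using kernel_nonneg[OF x y] surv_nonneg[OF y] by (simp add: power_mult_distrib[of "sqrt _"])
      then show "(ennreal (sqrt (\<kappa> x y / surv y) * (?q y * f y)))\<^sup>2 = ennreal (\<kappa> x y) * ennreal (?w y)"
        using kernel_nonneg[OF x y] surv_nonneg[OF y] q0[OF y] f0[OF y]
        by (simp add: ennreal_power flip: ennreal_mult)
    qed
    also have "kernel_op M \<kappa> (\<lambda>y. ennreal (surv y)) x = ennreal (kernel_opr surv x)"
      using surv_less_1 x by (intro ennreal_kernel_opr[symmetric, where B = 1]) (auto intro: less_imp_le)
    finally show ?thesis .
  qed
  have meas_in [measurable]: "(\<lambda>x. \<integral>\<^sup>+ y. ennreal (\<kappa> x y * f y) \<partial>mu_dual) \<in> borel_measurable M"
  proof -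
    have "(\<lambda>x. \<integral>\<^sup>+ y. ennreal (?q y) * ennreal (\<kappa> x y * f y) \<partial>M) \<in> borel_measurable M" by measurable
    moreover have "(\<integral>\<^sup>+ y. ennreal (\<kappa> x y * f y) \<partial>mu_dual) = (\<integral>\<^sup>+ y. ennreal (?q y) * ennreal (\<kappa> x y * f y) \<partial>M)"
      if x: "x \<in> space M" for x
    proof -
      have [measurable]: "(\<lambda>y. \<kappa> x y) \<in> borel_measurable M" using x by measurable
      show ?thesis by (rule nn_integral_mu_dual) measurable
    qed
    ultimately show ?thesis by (simp cong: measurable_cong)
  qed
  have "(\<integral>\<^sup>+ x. (\<integral>\<^sup>+ y. ennreal (\<kappa> x y * f y) \<partial>mu_dual)\<^sup>2 \<partial>mu_dual)
     = (\<integral>\<^sup>+ x. ennreal (?q x) * (\<integral>\<^sup>+ y. ennreal (\<kappa> x y * f y) \<partial>mu_dual)\<^sup>2 \<partial>M)"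
    by (rule nn_integral_mu_dual) measurable
  also have "\<dots> \<le> (\<integral>\<^sup>+ x. ennreal (surv x) * kernel_op M \<kappa> (\<lambda>y. ennreal (?w y)) x \<partial>M)"
  proof (intro nn_integral_mono)
    fix x assume x: "x \<in> space M"
    have "?q x * kernel_opr surv x * 1 \<le> ?q x * kernel_opr surv x * (1 + surv x / 2)"
      using q0[OF x] kernel_opr_nonneg surv_nonneg[OF x] by (intro mult_left_mono) auto
    \<comment> \<open>In the outer variable the factor is used without its gain; the gain is kept
      for the variable of \<open>f\<close>.\<close>
    then have le: "?q x * kernel_opr surv x \<le> surv x" using dual_contraction_factor[OF x] by simp
    have "ennreal (?q x) * (\<integral>\<^sup>+ y. ennreal (\<kappa> x y * f y) \<partial>mu_dual)\<^sup>2
        \<le> ennreal (?q x) * (ennreal (kernel_opr surv x) * kernel_op M \<kappa> (\<lambda>y. ennreal (?w y)) x)"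
      by (intro mult_left_mono inner x) auto
    also have "\<dots> = ennreal (?q x * kernel_opr surv x) * kernel_op M \<kappa> (\<lambda>y. ennreal (?w y)) x"
      using q0[OF x] by (simp add: ennreal_mult kernel_opr_nonneg mult.assoc)
    also have "\<dots> \<le> ennreal (surv x) * kernel_op M \<kappa> (\<lambda>y. ennreal (?w y)) x"
      using le by (intro mult_right_mono ennreal_leI) auto
    finally show "ennreal (?q x) * (\<integral>\<^sup>+ y. ennreal (\<kappa> x y * f y) \<partial>mu_dual)\<^sup>2
      \<le> ennreal (surv x) * kernel_op M \<kappa> (\<lambda>y. ennreal (?w y)) x" .
  qed
  also have "\<dots> = (\<integral>\<^sup>+ y. kernel_op M \<kappa> (\<lambda>y. ennreal (surv y)) y * ennreal (?w y) \<partial>M)"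
    by (rule kernel_op_symmetric) measurable
  also have "\<dots> \<le> (\<integral>\<^sup>+ y. ennreal (?q y * (f y)\<^sup>2 / (1 + surv y / 2)) \<partial>M)"
  proof (intro nn_integral_mono)
    fix y assume y: "y \<in> space M"
    have "kernel_op M \<kappa> (\<lambda>y. ennreal (surv y)) y * ennreal (?w y) = ennreal (kernel_opr surv y) * ennreal (?w y)"
      using surv_less_1 y by (subst ennreal_kernel_opr[where B = 1]) (auto intro: less_imp_le)
    also have "\<dots> = ennreal (kernel_opr surv y * ?w y)"
      using surv_nonneg[OF y] by (intro ennreal_mult''[symmetric]) simp
    also have "\<dots> \<le> ennreal (?q y * (f y)\<^sup>2 / (1 + surv y / 2))"
    proof (intro ennreal_leI)
      show "kernel_opr surv y * ?w y \<le> ?q y * (f y)\<^sup>2 / (1 + surv y / 2)"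
      \<comment> \<open>At such points division by zero makes \<open>?w y\<close> equal to
        0.\<close>
      proof (cases "surv y = 0")
        case True
        then show ?thesis by simp
      next
        case False
        then have s: "0 < surv y" using surv_nonneg[OF y] by simp
        have "?q y * kernel_opr surv y \<le> surv y / (1 + surv y / 2)"
          using dual_contraction_factor[OF y] s by (simp add: pos_le_divide_eq)
        then have "(?q y * kernel_opr surv y) * (?q y * (f y)\<^sup>2 / surv y) \<le> (surv y / (1 + surv y / 2)) * (?q y * (f y)\<^sup>2 / surv y)"
          using q0[OF y] s by (intro mult_right_mono) auto
        then show ?thesis using s by (simp add: power2_eq_square mult_ac)
      qed
    qed
    finally show "kernel_op M \<kappa> (\<lambda>y. ennreal (surv y)) y * ennreal (?w y) \<le> ennreal (?q y * (f y)\<^sup>2 / (1 + surv y / 2))" .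
  qed
  finally show ?thesis .
qed

text \<open>Complements the Schur bound when \<open>f\<close> has little mass off \<open>D\<close>:
  the part of \<open>f\<close> off \<open>D\<close> pays with that mass times the full
  Hilbert-Schmidt norm, the part on \<open>D\<close> only with the Hilbert-Schmidt mass of the
  columns in \<open>D\<close>.\<close>

lemma hat_L2_sq_le_split:
  assumes f [measurable]: "f \<in> borel_measurable M" and f0: "\<And>y. y \<in> space M \<Longrightarrow> 0 \<le> f y"
    and f1: "(\<integral>\<^sup>+ y. ennreal ((f y)\<^sup>2) \<partial>mu_dual) \<le> 1" and D [measurable]: "D \<in> sets M"
  shows "(\<integral>\<^sup>+ x. (\<integral>\<^sup>+ y. ennreal (\<kappa> x y * f y) \<partial>mu_dual)\<^sup>2 \<partial>mu_dual)
    \<le> 2 * (\<integral>\<^sup>+ x. \<integral>\<^sup>+ y. ennreal ((\<kappa> x y)\<^sup>2) \<partial>M \<partial>M) * (\<integral>\<^sup>+ y\<in>space M - D. ennreal ((1 - surv y) * (f y)\<^sup>2) \<partial>M)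
     + 2 * (\<integral>\<^sup>+ x. (\<integral>\<^sup>+ y\<in>D. ennreal ((\<kappa> x y)\<^sup>2) \<partial>M) \<partial>M)"
proof -
  let ?q = "\<lambda>y. 1 - surv y"
  let ?IB = "\<integral>\<^sup>+ y\<in>space M - D. ennreal (?q y * (f y)\<^sup>2) \<partial>M"
  let ?K = "\<lambda>x. \<integral>\<^sup>+ y. ennreal ((\<kappa> x y)\<^sup>2) \<partial>M" and ?KD = "\<lambda>x. \<integral>\<^sup>+ y\<in>D. ennreal ((\<kappa> x y)\<^sup>2) \<partial>M"
  have q0: "0 \<le> ?q y" "?q y \<le> 1" if "y \<in> space M" for y
    using surv_less_1[OF that] surv_nonneg[OF that] by simp_all
  have "(\<integral>\<^sup>+ y. ennreal ((f y)\<^sup>2) \<partial>mu_dual) = (\<integral>\<^sup>+ y. ennreal (?q y * (f y)\<^sup>2) \<partial>M)"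
    by (subst nn_integral_mu_dual) (auto intro!: nn_integral_cong simp: ennreal_mult'')
  then have If: "(\<integral>\<^sup>+ y. ennreal (?q y * (f y)\<^sup>2) \<partial>M) \<le> 1" using f1 by simp
  have CS: "(\<integral>\<^sup>+ y\<in>D'. ennreal (?q y * (\<kappa> x y * f y)) \<partial>M)\<^sup>2
      \<le> (\<integral>\<^sup>+ y\<in>D'. ennreal ((\<kappa> x y)\<^sup>2) \<partial>M) * (\<integral>\<^sup>+ y\<in>D'. ennreal (?q y * (f y)\<^sup>2) \<partial>M)"
    if x: "x \<in> space M" and [measurable]: "D' \<in> sets M" for x D'
  proof -
    have [measurable]: "(\<lambda>y. \<kappa> x y) \<in> borel_measurable M" using x by measurable
    have "(\<integral>\<^sup>+ y\<in>D'. ennreal (?q y * (\<kappa> x y * f y)) \<partial>M)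
      = (\<integral>\<^sup>+ y. ennreal (sqrt (?q y) * \<kappa> x y * indicator D' y) * ennreal (sqrt (?q y) * f y * indicator D' y) \<partial>M)"
    proof (intro nn_integral_cong)
      fix y assume y: "y \<in> space M"
      have "sqrt (?q y) * \<kappa> x y * (sqrt (?q y) * f y) = (sqrt (?q y) * sqrt (?q y)) * (\<kappa> x y * f y)"
        by (simp only: mult_ac)
      also have "sqrt (?q y) * sqrt (?q y) = ?q y" using q0[OF y] by simp
      finally show "ennreal (?q y * (\<kappa> x y * f y)) * indicator D' y
        = ennreal (sqrt (?q y) * \<kappa> x y * indicator D' y) * ennreal (sqrt (?q y) * f y * indicator D' y)"
        using q0[OF y] kernel_nonneg[OF x y] f0[OF y] by (auto simp: indicator_def simp flip: ennreal_mult)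
    qed
    then have "(\<integral>\<^sup>+ y\<in>D'. ennreal (?q y * (\<kappa> x y * f y)) \<partial>M)\<^sup>2
      \<le> (\<integral>\<^sup>+ y. (ennreal (sqrt (?q y) * \<kappa> x y * indicator D' y))\<^sup>2 \<partial>M)
       * (\<integral>\<^sup>+ y. (ennreal (sqrt (?q y) * f y * indicator D' y))\<^sup>2 \<partial>M)"
      by (simp only:) (rule Cauchy_Schwarz_nn_integral; measurable)
    also have "\<dots> \<le> (\<integral>\<^sup>+ y\<in>D'. ennreal ((\<kappa> x y)\<^sup>2) \<partial>M) * (\<integral>\<^sup>+ y\<in>D'. ennreal (?q y * (f y)\<^sup>2) \<partial>M)"
    proof (intro mult_mono nn_integral_mono)
      fix y assume y: "y \<in> space M"
      have "?q y * (\<kappa> x y)\<^sup>2 \<le> 1 * (\<kappa> x y)\<^sup>2" using q0[OF y] by (intro mult_right_mono) auto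
      then show "(ennreal (sqrt (?q y) * \<kappa> x y * indicator D' y))\<^sup>2 \<le> ennreal ((\<kappa> x y)\<^sup>2) * indicator D' y"
        using q0[OF y] kernel_nonneg[OF x y]
        by (auto simp: indicator_def ennreal_power power_mult_distrib intro!: ennreal_leI)
      show "(ennreal (sqrt (?q y) * f y * indicator D' y))\<^sup>2 \<le> ennreal (?q y * (f y)\<^sup>2) * indicator D' y"
        using q0[OF y] f0[OF y] by (auto simp: indicator_def ennreal_power power_mult_distrib)
    qed auto
    finally show ?thesis .
  qed
  have inner: "(\<integral>\<^sup>+ y. ennreal (\<kappa> x y * f y) \<partial>mu_dual)\<^sup>2 \<le> 2 * (?K x * ?IB) + 2 * ?KD x" if x: "x \<in> space M" for x
  proof -
    have [measurable]: "(\<lambda>y. \<kappa> x y) \<in> borel_measurable M" using x by measurable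
    have "(\<integral>\<^sup>+ y. ennreal (\<kappa> x y * f y) \<partial>mu_dual) = (\<integral>\<^sup>+ y. ennreal (?q y) * ennreal (\<kappa> x y * f y) \<partial>M)"
      by (rule nn_integral_mu_dual) measurable
    also have "\<dots> = (\<integral>\<^sup>+ y. ennreal (?q y * (\<kappa> x y * f y)) * indicator (space M - D) y
        + ennreal (?q y * (\<kappa> x y * f y)) * indicator D y \<partial>M)"
    proof (intro nn_integral_cong)
      fix y assume y: "y \<in> space M"
      have "0 \<le> \<kappa> x y * f y" using kernel_nonneg[OF x y] f0[OF y] by simp
      from ennreal_mult''[OF this, of "?q y"] y
      show "ennreal (?q y) * ennreal (\<kappa> x y * f y) = ennreal (?q y * (\<kappa> x y * f y)) * indicator (space M - D) y
        + ennreal (?q y * (\<kappa> x y * f y)) * indicator D y"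
        by (auto simp: indicator_def)
    qed
    also have "\<dots> = (\<integral>\<^sup>+ y\<in>space M - D. ennreal (?q y * (\<kappa> x y * f y)) \<partial>M) + (\<integral>\<^sup>+ y\<in>D. ennreal (?q y * (\<kappa> x y * f y)) \<partial>M)"
      by (rule nn_integral_add) measurable
    finally have "(\<integral>\<^sup>+ y. ennreal (\<kappa> x y * f y) \<partial>mu_dual)\<^sup>2
      \<le> ennreal (1 + 1/1) * (\<integral>\<^sup>+ y\<in>space M - D. ennreal (?q y * (\<kappa> x y * f y)) \<partial>M)\<^sup>2
        + ennreal (1 + 1) * (\<integral>\<^sup>+ y\<in>D. ennreal (?q y * (\<kappa> x y * f y)) \<partial>M)\<^sup>2"
      by (simp only:) (rule sq_sum_weighted, simp)
    also have "\<dots> \<le> ennreal (1 + 1/1) * (?K x * ?IB) + ennreal (1 + 1) * (?KD x * 1)"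
    proof (intro add_mono mult_left_mono)
      have "(\<integral>\<^sup>+ y\<in>space M - D. ennreal ((\<kappa> x y)\<^sup>2) \<partial>M) \<le> ?K x"
        by (intro nn_integral_mono) (auto simp: indicator_def)
      then show "(\<integral>\<^sup>+ y\<in>space M - D. ennreal (?q y * (\<kappa> x y * f y)) \<partial>M)\<^sup>2 \<le> ?K x * ?IB"
        by (intro order_trans[OF CS[OF x]] mult_right_mono) auto
      have "(\<integral>\<^sup>+ y\<in>D. ennreal (?q y * (f y)\<^sup>2) \<partial>M) \<le> (\<integral>\<^sup>+ y. ennreal (?q y * (f y)\<^sup>2) \<partial>M)"
        by (intro nn_integral_mono) (auto simp: indicator_def)
      then show "(\<integral>\<^sup>+ y\<in>D. ennreal (?q y * (\<kappa> x y * f y)) \<partial>M)\<^sup>2 \<le> ?KD x * 1"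
        using If by (intro order_trans[OF CS[OF x]] mult_left_mono) auto
    qed auto
    finally show ?thesis by simp
  qed
  have "(\<integral>\<^sup>+ x. (\<integral>\<^sup>+ y. ennreal (\<kappa> x y * f y) \<partial>mu_dual)\<^sup>2 \<partial>mu_dual)
     \<le> (\<integral>\<^sup>+ x. 2 * (?K x * ?IB) + 2 * ?KD x \<partial>mu_dual)"
    by (intro nn_integral_mono inner) simp
  also have "\<dots> = (\<integral>\<^sup>+ x. ennreal (?q x) * (2 * (?K x * ?IB) + 2 * ?KD x) \<partial>M)"
    by (rule nn_integral_mu_dual) measurable
  also have "\<dots> \<le> (\<integral>\<^sup>+ x. 1 * (2 * (?K x * ?IB) + 2 * ?KD x) \<partial>M)"
    using q0 by (intro nn_integral_mono mult_right_mono) auto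
  also have "\<dots> = 2 * (\<integral>\<^sup>+ x. ?K x \<partial>M) * ?IB + 2 * (\<integral>\<^sup>+ x. ?KD x \<partial>M)"
    by (simp add: nn_integral_add nn_integral_cmult nn_integral_multc mult.assoc)
  finally show ?thesis .
qed

text \<open>Since \<open>surv\<close> is positive almost everywhere on \<open>S'\<close> and the
  kernel vanishes elsewhere, the kernel mass over the sets \<open>?D n\<close> tends to 0. With one
  such set fixed, either the Schur bound or the split bound is at most one constant
  \<open>l < 1\<close>, according to the mass \<open>b\<close> of \<open>f\<close> off the
  set.\<close>

lemma hat_norm_less_1:
  assumes S: "S' \<in> sets M"
    and zero: "\<And>x y. x \<in> space M \<Longrightarrow> y \<in> space M \<Longrightarrow> x \<notin> S' \<or> y \<notin> S' \<Longrightarrow> \<kappa> x y = 0"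
    and pos: "AE y in M. y \<in> S' \<longrightarrow> 0 < surv y"
    and HS: "(\<integral>\<^sup>+ p. ennreal ((\<kappa> (fst p) (snd p))\<^sup>2) \<partial>(M \<Otimes>\<^sub>M M)) < \<top>"
  shows "kernel_norm mu_dual \<kappa> < 1"
proof -
  interpret MM: pair_sigma_finite M M ..
  let ?q = "\<lambda>y. 1 - surv y"
  have q0: "0 \<le> ?q y" "?q y \<le> 1" if "y \<in> space M" for y
    using surv_less_1[OF that] surv_nonneg[OF that] by simp_all
  let ?D = "\<lambda>n. {y \<in> space M. surv y < 1 / real (Suc n)}"
  have D [measurable]: "?D n \<in> sets M" for n by measurable
  let ?\<delta> = "\<lambda>n. \<integral>\<^sup>+ x. (\<integral>\<^sup>+ y\<in>?D n. ennreal ((\<kappa> x y)\<^sup>2) \<partial>M) \<partial>M"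
  have [measurable]: "(\<lambda>p. \<kappa> (fst p) (snd p)) \<in> borel_measurable (M \<Otimes>\<^sub>M M)" by measurable
  have \<delta>_prod: "?\<delta> n = (\<integral>\<^sup>+ p. ennreal ((\<kappa> (fst p) (snd p))\<^sup>2) * indicator (?D n) (snd p) \<partial>(M \<Otimes>\<^sub>M M))" for n
  proof -
    have "(\<lambda>p. ennreal ((\<kappa> (fst p) (snd p))\<^sup>2) * indicator (?D n) (snd p)) \<in> borel_measurable (M \<Otimes>\<^sub>M M)"
      by measurable
    from nn_integral_fst[OF this] show ?thesis by simp
  qed
  have "(\<lambda>n. \<integral>\<^sup>+ p. ennreal ((\<kappa> (fst p) (snd p))\<^sup>2) * indicator (?D n) (snd p) \<partial>(M \<Otimes>\<^sub>M M))
     \<longlonglongrightarrow> (\<integral>\<^sup>+ p. 0 \<partial>(M \<Otimes>\<^sub>M M))"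
  proof (rule nn_integral_dominated_convergence[where w = "\<lambda>p. ennreal ((\<kappa> (fst p) (snd p))\<^sup>2)"])
    have "AE p in M \<Otimes>\<^sub>M M. snd p \<in> S' \<longrightarrow> 0 < surv (snd p)"
      by (rule MM.AE_pair_measure) (use S pos in auto)
    then show "AE p in M \<Otimes>\<^sub>M M. (\<lambda>n. ennreal ((\<kappa> (fst p) (snd p))\<^sup>2) * indicator (?D n) (snd p)) \<longlonglongrightarrow> 0"
      using AE_space
    proof eventually_elim
      case (elim p)
      then have sp: "fst p \<in> space M" "snd p \<in> space M" by (auto simp: space_pair_measure)
      show ?case
      proof (cases "snd p \<in> S'")
        case True
        then have "0 < surv (snd p)" using elim by simp
        moreover have "(\<lambda>n. 1 / real (Suc n)) \<longlonglongrightarrow> 0" using LIMSEQ_inverse_real_of_nat by (simp add: inverse_eq_divide)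
        ultimately have "eventually (\<lambda>n. 1 / real (Suc n) < surv (snd p)) sequentially"
          by (metis order_tendstoD(2))
        then have "eventually (\<lambda>n. ennreal ((\<kappa> (fst p) (snd p))\<^sup>2) * indicator (?D n) (snd p) = 0) sequentially"
          by (rule eventually_mono) simp
        then show ?thesis by (rule tendsto_eventually)
      next
        case False
        then show ?thesis using zero sp by simp
      qed
    qed
  qed (use HS in \<open>auto simp: indicator_def\<close>)
  then have "?\<delta> \<longlonglongrightarrow> 0" unfolding \<delta>_prod by simp
  \<comment> \<open>The split bound doubles this to 1/2, which leaves room below 1 for the term with
    \<open>b\<close>.\<close>
  then have "eventually (\<lambda>n. ?\<delta> n < ennreal (1/4)) sequentially" by (rule order_tendstoD) simp
  then obtain n where n: "?\<delta> n < ennreal (1/4)" by (auto simp: eventually_sequentially)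
  define \<epsilon> where "\<epsilon> = 1 / real (Suc n)"
  \<comment> \<open>The largest Schur factor at points where \<open>surv\<close> is at least
    \<open>\<epsilon>\<close>, that is, off \<open>?D n\<close>.\<close>
  define t where "t = 1 / (1 + \<epsilon> / 2)"
  have "0 < \<epsilon>" by (simp add: \<epsilon>_def)
  then have t: "0 < t" "t < 1" by (auto simp: t_def)
  define K where "K = enn2real (\<integral>\<^sup>+ x. \<integral>\<^sup>+ y. ennreal ((\<kappa> x y)\<^sup>2) \<partial>M \<partial>M)"
  have "(\<integral>\<^sup>+ x. \<integral>\<^sup>+ y. ennreal ((\<kappa> x y)\<^sup>2) \<partial>M \<partial>M) < \<top>"
  proof -
    have "(\<lambda>p. ennreal ((\<kappa> (fst p) (snd p))\<^sup>2)) \<in> borel_measurable (M \<Otimes>\<^sub>M M)" by measurable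
    from nn_integral_fst[OF this] HS show ?thesis by simp
  qed
  then have K: "(\<integral>\<^sup>+ x. \<integral>\<^sup>+ y. ennreal ((\<kappa> x y)\<^sup>2) \<partial>M \<partial>M) = ennreal K" "0 \<le> K" by (auto simp: K_def)
  \<comment> \<open>The threshold for \<open>b\<close> is 1 / (8 K + 8). Up to it, 2 K b is at most
    1/4 and the split bound at most 3/4; beyond it, t b + c is at most 1 - (1 - t) b, hence at most
    the second argument. The added 8 keeps the denominator positive when K = 0.\<close>
  define l where "l = max (3/4) (1 - (1 - t) / (8 * K + 8))"
  have l: "0 \<le> l" "l < 1" using t K by (auto simp: l_def intro!: divide_pos_pos)
  have l_ge: "3/4 \<le> l" "1 - (1 - t) / (8 * K + 8) \<le> l" by (simp_all add: l_def)
  have bound: "(\<integral>\<^sup>+ x. (\<integral>\<^sup>+ y. ennreal (\<kappa> x y * f y) \<partial>mu_dual)\<^sup>2 \<partial>mu_dual) \<le> ennreal l"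
    if f [measurable]: "f \<in> borel_measurable M" and f0: "\<And>y. y \<in> space M \<Longrightarrow> 0 \<le> f y"
      and f1: "(\<integral>\<^sup>+ y. ennreal ((f y)\<^sup>2) \<partial>mu_dual) \<le> 1" for f
  proof -
    let ?v = "\<integral>\<^sup>+ x. (\<integral>\<^sup>+ y. ennreal (\<kappa> x y * f y) \<partial>mu_dual)\<^sup>2 \<partial>mu_dual"
    let ?g = "\<lambda>y. ennreal (?q y * (f y)\<^sup>2)"
    have "(\<integral>\<^sup>+ y. ennreal ((f y)\<^sup>2) \<partial>mu_dual) = (\<integral>\<^sup>+ y. ?g y \<partial>M)"
      by (subst nn_integral_mu_dual) (auto intro!: nn_integral_cong simp: ennreal_mult'')
    then have If: "(\<integral>\<^sup>+ y. ?g y \<partial>M) \<le> 1" using f1 by simp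
    have split: "(\<integral>\<^sup>+ y. ?g y \<partial>M) = (\<integral>\<^sup>+ y\<in>space M - ?D n. ?g y \<partial>M) + (\<integral>\<^sup>+ y\<in>?D n. ?g y \<partial>M)"
      by (subst nn_integral_add[symmetric]) (auto intro!: nn_integral_cong simp: indicator_def)
    define b where "b = enn2real (\<integral>\<^sup>+ y\<in>space M - ?D n. ?g y \<partial>M)"
    define c where "c = enn2real (\<integral>\<^sup>+ y\<in>?D n. ?g y \<partial>M)"
    have bc: "(\<integral>\<^sup>+ y\<in>space M - ?D n. ?g y \<partial>M) = ennreal b" "(\<integral>\<^sup>+ y\<in>?D n. ?g y \<partial>M) = ennreal c"
      "0 \<le> b" "0 \<le> c"
    proof -
      have "(\<integral>\<^sup>+ y\<in>space M - ?D n. ?g y \<partial>M) + (\<integral>\<^sup>+ y\<in>?D n. ?g y \<partial>M) < \<top>"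
        using If unfolding split by (rule le_less_trans) simp
      then show "(\<integral>\<^sup>+ y\<in>space M - ?D n. ?g y \<partial>M) = ennreal b" "(\<integral>\<^sup>+ y\<in>?D n. ?g y \<partial>M) = ennreal c"
        by (auto simp: b_def c_def)
    qed (auto simp: b_def c_def)
    have "ennreal (b + c) \<le> 1" using If bc by (simp add: split)
    then have bc1: "b + c \<le> 1" using bc by (simp del: ennreal_plus)
    have "?v \<le> (\<integral>\<^sup>+ y. ennreal (?q y * (f y)\<^sup>2 / (1 + surv y / 2)) \<partial>M)"
      by (rule hat_L2_sq_le_weighted[OF zero pos f f0])
    also have "\<dots> \<le> (\<integral>\<^sup>+ y. ennreal t * (?g y * indicator (space M - ?D n) y) + ?g y * indicator (?D n) y \<partial>M)"
    proof (intro nn_integral_mono)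
      fix y assume y: "y \<in> space M"
      have g0: "0 \<le> ?q y * (f y)\<^sup>2" using q0[OF y] by simp
      show "ennreal (?q y * (f y)\<^sup>2 / (1 + surv y / 2))
        \<le> ennreal t * (?g y * indicator (space M - ?D n) y) + ?g y * indicator (?D n) y"
      proof (cases "y \<in> ?D n")
        case True
        have "?q y * (f y)\<^sup>2 / (1 + surv y / 2) \<le> ?q y * (f y)\<^sup>2 / 1"
          using g0 surv_nonneg[OF y] by (intro divide_left_mono) auto
        then show ?thesis using True by (simp add: ennreal_leI)
      next
        case False
        then have "\<epsilon> \<le> surv y" using y by (simp add: \<epsilon>_def)
        then have "?q y * (f y)\<^sup>2 / (1 + surv y / 2) \<le> ?q y * (f y)\<^sup>2 / (1 + \<epsilon> / 2)"
          using g0 \<open>0 < \<epsilon>\<close> by (intro divide_left_mono) auto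
        also have "\<dots> = t * (?q y * (f y)\<^sup>2)" by (simp add: t_def)
        finally show ?thesis using False y t g0 by (simp add: ennreal_leI flip: ennreal_mult)
      qed
    qed
    also have "\<dots> = ennreal (t * b + c)"
      using bc t by (simp add: nn_integral_add nn_integral_cmult ennreal_mult)
    finally have v1: "?v \<le> ennreal (t * b + c)" .
    have "?v \<le> 2 * ennreal K * ennreal b + 2 * ?\<delta> n"
      using hat_L2_sq_le_split[OF f f0 f1 D, of n] by (simp only: K(1) bc(1))
    also have "\<dots> \<le> 2 * ennreal K * ennreal b + 2 * ennreal (1/4)"
      using n by (intro add_left_mono mult_left_mono) auto
    also have "\<dots> = ennreal (2 * K * b + 1/2)"
    proof -
      have "ennreal 2 * ennreal (1/4) = ennreal (1/2)" by (subst ennreal_mult[symmetric]) auto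
      moreover have "2 * ennreal K * ennreal b = ennreal (2 * K * b)" using K bc by (simp add: ennreal_mult)
      moreover have "ennreal (2 * K * b + 1/2) = ennreal (2 * K * b) + ennreal (1/2)"
        using K bc by (intro ennreal_plus) auto
      ultimately show ?thesis by simp
    qed
    finally have v2: "?v \<le> ennreal (2 * K * b + 1/2)" .
    have "t * b + c \<le> l \<or> 2 * K * b + 1/2 \<le> l"
    proof (cases "b \<le> 1 / (8 * K + 8)")
      case True
      then have "2 * K * b \<le> 2 * K * (1 / (8 * K + 8))" using K by (intro mult_left_mono) auto
      also have "\<dots> \<le> 1/4" using K by (simp add: field_simps)
      finally have "2 * K * b \<le> 1/4" .
      then show ?thesis using l_ge(1) by linarith
    next
      case False
      then have "(1 - t) * (1 / (8 * K + 8)) \<le> (1 - t) * b" using t by (intro mult_left_mono) auto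
      then have "t * b + c \<le> 1 - (1 - t) / (8 * K + 8)" using bc1 by (simp add: algebra_simps)
      then show ?thesis using l_ge(2) by linarith
    qed
    then show ?thesis using v1 v2 by (auto intro: order_trans ennreal_leI)
  qed
  have "kernel_norm mu_dual \<kappa> \<le> ennreal (sqrt l)"
    unfolding kernel_norm_def
  proof (rule SUP_least, elim CollectE conjE)
    fix f :: "'a \<Rightarrow> real"
    assume "f \<in> borel_measurable mu_dual" "\<forall>x\<in>space mu_dual. 0 \<le> f x" "(\<integral>\<^sup>+ x. ennreal ((f x)\<^sup>2) \<partial>mu_dual) \<le> 1"
    then have le: "(\<integral>\<^sup>+ x. (\<integral>\<^sup>+ y. ennreal (\<kappa> x y * f y) \<partial>mu_dual)\<^sup>2 \<partial>mu_dual) \<le> ennreal l"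
      by (intro bound) (auto cong: measurable_cong_sets)
    then show "enn_sqrt (\<integral>\<^sup>+ x. (\<integral>\<^sup>+ y. ennreal (\<kappa> x y * f y) \<partial>mu_dual)\<^sup>2 \<partial>mu_dual) \<le> ennreal (sqrt l)"
      using enn2real_mono[OF le] l by (auto simp: enn_sqrt_def top_unique intro!: ennreal_leI)
  qed
  also have "\<dots> < 1" using l by (simp add: ennreal_less_one_iff)
  finally show ?thesis .
qed

end

section \<open>Transfer from kernels to the branching process\<close>

theorem theorem3p3:
  fixes M :: "'a measure" and \<kappa> :: "'a \<Rightarrow> 'a \<Rightarrow> real"
    and P :: "'a \<Rightarrow> 'b measure" and Z :: "'a \<Rightarrow> nat \<Rightarrow> 'b \<Rightarrow> 'a multiset"
  assumes "prob_space M"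
    and "is_kernel M \<kappa>"
    and "is_BP_family M \<kappa> P Z"
  shows
    "(kernel_norm M \<kappa> < 1 \<longrightarrow>
       (\<exists>g. resolvent_one M \<kappa> g \<and>
            (AE x in M. chi_BP P Z x = ennreal (g x)) \<and>
            (\<integral>\<^sup>+ x. chi_BP P Z x \<partial>M) = ennreal (\<integral> x. g x \<partial>M) \<and>
            (\<integral>\<^sup>+ x. chi_BP P Z x \<partial>M) < \<top>))
     \<and>
     (kernel_norm M \<kappa> > 1 \<and> kernel_norm (mu_hat M (rho_BP P Z)) \<kappa> < 1 \<longrightarrow>
       (\<exists>g. resolvent_one (mu_hat M (rho_BP P Z)) \<kappa> g \<and>
            (AE x in M. chi_hat_BP P Z x = ennreal ((1 - rho_BP P Z x) * g x)) \<and>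
            (\<integral>\<^sup>+ x. chi_hat_BP P Z x \<partial>M) = ennreal (\<integral> x. g x \<partial>(mu_hat M (rho_BP P Z))) \<and>
            (\<integral>\<^sup>+ x. chi_hat_BP P Z x \<partial>M) < \<top>))
     \<and>
     (kernel_norm M \<kappa> > 1 \<and> quasi_irreducible_kernel M \<kappa> \<and>
      (\<integral>\<^sup>+ p. ennreal ((\<kappa> (fst p) (snd p))\<^sup>2) \<partial>(M \<Otimes>\<^sub>M M)) < \<top> \<longrightarrow>
       kernel_norm (mu_hat M (rho_BP P Z)) \<kappa> < 1)"
proof -
  interpret prob_space M by fact
  interpret sym_kernel M \<kappa>
    by unfold_locales (use assms(2) in \<open>auto simp: is_kernel_def kernel_op_def\<close>)
  have bp: "bp M \<kappa> x (P x) (Z x)" if "x \<in> space M" for x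
    by unfold_locales (use assms(3) that in \<open>auto simp: is_BP_family_def\<close>)
  have rho: "rho_BP P Z x = surv x" if "x \<in> space M" for x
    unfolding rho_BP_def by (rule bp.prob_infinite_eq_surv[OF bp[OF that]])
  have hat: "mu_hat M (rho_BP P Z) = mu_dual"
  proof -
    have "rho_BP P Z \<in> borel_measurable M" using surv_measurable by (simp add: rho cong: measurable_cong)
    then show ?thesis unfolding mu_hat_def mu_dual_def by (intro density_cong) (auto simp: rho)
  qed
  have chi: "chi_BP P Z x = neumann_one x" if "x \<in> space M" for x
    unfolding chi_BP_def by (rule bp.expected_total_size[OF bp[OF that]])
  have chi_hat: "chi_hat_BP P Z x = ennreal (1 - surv x) * hat.neumann_one x" if "x \<in> space M" for x
    unfolding chi_hat_BP_def using bp.expected_total_size_extinct[OF bp[OF that]] suminf_weighted_op[OF that] by simp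
  show ?thesis
  proof (intro conjI impI)
    assume norm: "kernel_norm M \<kappa> < 1"
    have eq: "(\<integral>\<^sup>+ x. chi_BP P Z x \<partial>M) = (\<integral>\<^sup>+ x. neumann_one x \<partial>M)"
      by (intro nn_integral_cong chi)
    have "AE x in M. chi_BP P Z x = ennreal (enn2real (neumann_one x))"
      using resolvent_one_neumann_one(2)[OF norm] AE_space by eventually_elim (simp add: chi)
    then show "\<exists>g. resolvent_one M \<kappa> g \<and>
            (AE x in M. chi_BP P Z x = ennreal (g x)) \<and>
            (\<integral>\<^sup>+ x. chi_BP P Z x \<partial>M) = ennreal (\<integral> x. g x \<partial>M) \<and>
            (\<integral>\<^sup>+ x. chi_BP P Z x \<partial>M) < \<top>"
      using resolvent_one_neumann_one[OF norm] eq by (intro exI[of _ "\<lambda>x. enn2real (neumann_one x)"]) simp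
  next
    assume "1 < kernel_norm M \<kappa> \<and> kernel_norm (mu_hat M (rho_BP P Z)) \<kappa> < 1"
    then have norm: "kernel_norm mu_dual \<kappa> < 1" by (simp add: hat)
    note R = hat.resolvent_one_neumann_one[OF norm]
    have gm: "hat.neumann_one \<in> borel_measurable M"
      using hat.neumann_one_measurable by (simp cong: measurable_cong_sets)
    have eq: "(\<integral>\<^sup>+ x. chi_hat_BP P Z x \<partial>M) = (\<integral>\<^sup>+ x. hat.neumann_one x \<partial>mu_dual)"
      unfolding nn_integral_mu_dual[OF gm] by (intro nn_integral_cong chi_hat)
    \<comment> \<open>Finiteness is known almost everywhere for the dual measure. As
      \<open>surv\<close> is below 1 at every point, its density is positive and the statement holds
      almost everywhere for \<open>M\<close>.\<close>
    have "AE x in M. 0 < ennreal (1 - surv x) \<longrightarrow> hat.neumann_one x < \<top>"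
      using R(2) unfolding mu_dual_def by (subst (asm) AE_density) auto
    then have "AE x in M. chi_hat_BP P Z x = ennreal ((1 - rho_BP P Z x) * enn2real (hat.neumann_one x))"
      using AE_space
    proof eventually_elim
      case (elim x)
      then have "hat.neumann_one x < \<top>" using surv_less_1[OF elim(2)] by simp
      then show ?case using surv_less_1[OF elim(2)] elim(2) by (simp add: chi_hat rho ennreal_mult)
    qed
    then show "\<exists>g. resolvent_one (mu_hat M (rho_BP P Z)) \<kappa> g \<and>
            (AE x in M. chi_hat_BP P Z x = ennreal ((1 - rho_BP P Z x) * g x)) \<and>
            (\<integral>\<^sup>+ x. chi_hat_BP P Z x \<partial>M) = ennreal (\<integral> x. g x \<partial>(mu_hat M (rho_BP P Z))) \<and>
            (\<integral>\<^sup>+ x. chi_hat_BP P Z x \<partial>M) < \<top>"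
      using R eq unfolding hat by (intro exI[of _ "\<lambda>x. enn2real (hat.neumann_one x)"]) simp
  next
    assume A: "1 < kernel_norm M \<kappa> \<and> quasi_irreducible_kernel M \<kappa> \<and>
      (\<integral>\<^sup>+ p. ennreal ((\<kappa> (fst p) (snd p))\<^sup>2) \<partial>(M \<Otimes>\<^sub>M M)) < \<top>"
    then obtain S' where S: "S' \<in> sets M" "irreducible_kernel (restrict_space M S') \<kappa>"
      "\<And>x y. x \<in> space M \<Longrightarrow> y \<in> space M \<Longrightarrow> x \<notin> S' \<or> y \<notin> S' \<Longrightarrow> \<kappa> x y = 0"
      unfolding quasi_irreducible_kernel_def by blast
    show "kernel_norm (mu_hat M (rho_BP P Z)) \<kappa> < 1"
      unfolding hat using A S by (intro hat_norm_less_1[OF S(1,3) survival_pos[OF S]]) auto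
  qed
qed

end
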